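(* Let $(X_0,X_1)$ and $(Y_0,Y_1)$ be two compatible couples of complex Banach spaces and let $f:X_0+X_1\to Y_0+Y_1$ be a function with $f(X_j)\subseteq Y_j$ for $j=0,1$, such that $f:X_0+X_1\to Y_0+Y_1$ is holomorphic and $f:X_j\to Y_j$ is holomorphic for $j=0,1$. Then $f:[X_0,X_1]_\theta\to[Y_0,Y_1]_\theta$ is holomorphic for every $0\le\theta\le1$.
   Context: All Banach spaces are over $\mathbb{C}$. A pair $(X_0,X_1)$ of Banach spaces is a compatible couple if both are (continuously embedded) subspaces of a common topological vector space. Then $X_0\cap X_1$ carries the norm $\max\{\|x\|_{X_0},\|x\|_{X_1}\}$ and $X_0+X_1$ the norm $\inf\{\|x_0\|_{X_0}+\|x_1\|_{X_1}: x=x_0+x_1,\ x_i\in X_i\}$; both are Banach spaces. A function $f:X\to Y$ between Banach spaces is holomorphic if for every $x\in X$ there are $r>0$ and continuous $m$-homogeneous polynomials $P_mf(x):X\to Y$ ($m\ge 0$) with $f(y)=\sum_{m\ge0}P_mf(x)(y-x)$ for $\|y-x\|_X<r$, the convergence being uniform on some ball around $x$. Let $\mathbb{L}=\{z\in\mathbb{C}:1<|z|<e\}$. $\mathcal{F}\{X_0,X_1\}$ is the space of functions $\phi:\overline{\mathbb{L}}\to X_0+X_1$ that are continuous on $\overline{\mathbb{L}}$, holomorphic on $\mathbb{L}$ as $(X_0+X_1)$-valued functions, and such that for $j=0,1$ the restriction of $\phi$ to $\{|z|=e^j\}$ takes values in $X_j$ and is continuous into $X_j$. It is a Banach space under $\|\phi\|_{\mathcal{F}\{X_0,X_1\}}=\max_{t\in[0,2\pi]}\max\{\|\phi(e^{it})\|_{X_0},\|\phi(e^{1+it})\|_{X_1}\}$.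 Calderón's complex interpolation space, for $0\le\theta\le1$, is $[X_0,X_1]_\theta=\{\phi(e^\theta):\phi\in\mathcal{F}\{X_0,X_1\}\}$ with norm $\|x\|_{[X_0,X_1]_\theta}=\inf\{\|\phi\|_{\mathcal{F}\{X_0,X_1\}}:\phi\in\mathcal{F}\{X_0,X_1\},\ \phi(e^\theta)=x\}$. *)

theory Defs
  imports "HOL-Analysis.Analysis"
begin

section \<open>Complex topological vector spaces\<close>

class scaleC =
  fixes scaleC :: "complex \<Rightarrow> 'a \<Rightarrow> 'a"  (infixr "*\<^sub>C" 75)

class complex_vector = scaleC + ab_group_add +
  assumes scaleC_add_right: "c *\<^sub>C (x + y) = c *\<^sub>C x + c *\<^sub>C y"
    and scaleC_add_left: "(c + d) *\<^sub>C x = c *\<^sub>C x + d *\<^sub>C x"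
    and scaleC_scaleC: "c *\<^sub>C (d *\<^sub>C x) = (c * d) *\<^sub>C x"
    and scaleC_one: "1 *\<^sub>C x = x"

text \<open>Topological vector spaces are Hausdorff; otherwise the norm of the sum of two
  continuously embedded Banach spaces could fail to be definite.\<close>

class complex_tvs = complex_vector + topological_ab_group_add + t2_space +
  assumes tendsto_scaleC_Pair: "LIM p (nhds c \<times>\<^sub>F nhds x). fst p *\<^sub>C snd p :> nhds (c *\<^sub>C x)"

instantiation complex :: complex_tvs
begin

definition scaleC_complex :: "complex \<Rightarrow> complex \<Rightarrow> complex"
  where "scaleC_complex c z = c * z"

instance
proof
  fix c x :: complex
  show "LIM p (nhds c \<times>\<^sub>F nhds x). fst p *\<^sub>C snd p :> nhds (c *\<^sub>C x)"
    unfolding scaleC_complex_def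
    by (intro tendsto_mult filterlim_fst filterlim_snd)
qed (simp_all add: scaleC_complex_def algebra_simps)

end

global_interpretation complex_vector: vector_space "scaleC :: complex \<Rightarrow> 'a \<Rightarrow> 'a::complex_vector"
  by standard (simp_all add: scaleC_add_right scaleC_add_left scaleC_scaleC scaleC_one)


section \<open>Normed spaces carried by subspaces of a vector space\<close>

text \<open>The norm is only meaningful on the carrier \<open>vecs X\<close>.\<close>

record 'v nspace =
  vecs :: "'v set"
  nrm :: "'v \<Rightarrow> real"

definition normed_subspace :: "'v::complex_vector nspace \<Rightarrow> bool" where
  "normed_subspace X \<longleftrightarrow>
     complex_vector.subspace (vecs X) \<and>
     (\<forall>x\<in>vecs X. 0 \<le> nrm X x) \<and>
     (\<forall>x\<in>vecs X. nrm X x = 0 \<longleftrightarrow> x = 0) \<and>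
     (\<forall>x\<in>vecs X. \<forall>y\<in>vecs X. nrm X (x + y) \<le> nrm X x + nrm X y) \<and>
     (\<forall>c. \<forall>x\<in>vecs X. nrm X (c *\<^sub>C x) = cmod c * nrm X x)"

text \<open>The value \<open>0\<close> off the carrier is needed because \<^locale>\<open>Metric_space\<close> demands
  non-negativity and symmetry of the distance everywhere.\<close>

definition nrm_dist :: "'v::complex_vector nspace \<Rightarrow> 'v \<Rightarrow> 'v \<Rightarrow> real" where
  "nrm_dist X x y = (if x \<in> vecs X \<and> y \<in> vecs X then nrm X (x - y) else 0)"

definition nrm_topology :: "'v::complex_vector nspace \<Rightarrow> 'v topology" where
  "nrm_topology X = Metric_space.mtopology (vecs X) (nrm_dist X)"

definition banach_subspace :: "'v::complex_vector nspace \<Rightarrow> bool" where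
  "banach_subspace X \<longleftrightarrow>
     normed_subspace X \<and> Metric_space.mcomplete (vecs X) (nrm_dist X)"

lemma Metric_space_nrm_dist:
  assumes "normed_subspace X"
  shows "Metric_space (vecs X) (nrm_dist X)"
proof -
  have sub: "complex_vector.subspace (vecs X)"
    and tri: "\<And>x y. x \<in> vecs X \<Longrightarrow> y \<in> vecs X \<Longrightarrow> nrm X (x + y) \<le> nrm X x + nrm X y"
    and hom: "\<And>c x. x \<in> vecs X \<Longrightarrow> nrm X (c *\<^sub>C x) = cmod c * nrm X x"
    and nn: "\<And>x. x \<in> vecs X \<Longrightarrow> 0 \<le> nrm X x"
    and zero: "\<And>x. x \<in> vecs X \<Longrightarrow> nrm X x = 0 \<longleftrightarrow> x = 0"
    using assms by (auto simp: normed_subspace_def)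
  have diff: "x - y \<in> vecs X" if "x \<in> vecs X" "y \<in> vecs X" for x y
    using sub that by (rule complex_vector.subspace_diff)
  have minus: "nrm X (x - y) = nrm X (y - x)" if "x \<in> vecs X" "y \<in> vecs X" for x y
    using hom[OF diff[OF that(2,1)], of "-1"] by simp
  show ?thesis
  proof
    fix x y z assume "x \<in> vecs X" "y \<in> vecs X" "z \<in> vecs X"
    then show "nrm_dist X x z \<le> nrm_dist X x y + nrm_dist X y z"
      using tri[OF diff[of x y] diff[of y z]] by (simp add: nrm_dist_def)
  qed (auto simp: nrm_dist_def nn diff zero minus)
qed


section \<open>Holomorphic functions between normed spaces\<close>

text \<open>Elements of \<open>X\<^sup>m\<close> are extensional functions on \<open>{..<m}\<close>.\<close>

definition multilinear ::
    "nat \<Rightarrow> 'v::complex_vector nspace \<Rightarrow> 'w::complex_vector nspace \<Rightarrow> ((nat \<Rightarrow> 'v) \<Rightarrow> 'w) \<Rightarrow> bool" where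
  "multilinear m X Y A \<longleftrightarrow>
     A \<in> ({..<m} \<rightarrow>\<^sub>E vecs X) \<rightarrow> vecs Y \<and>
     (\<forall>a \<in> {..<m} \<rightarrow>\<^sub>E vecs X. \<forall>i<m. \<forall>x\<in>vecs X. \<forall>y\<in>vecs X.
        A (a(i := x + y)) = A (a(i := x)) + A (a(i := y))) \<and>
     (\<forall>a \<in> {..<m} \<rightarrow>\<^sub>E vecs X. \<forall>i<m. \<forall>c. \<forall>x\<in>vecs X.
        A (a(i := c *\<^sub>C x)) = c *\<^sub>C A (a(i := x)))"

definition homogeneous_polynomial ::
    "nat \<Rightarrow> 'v::complex_vector nspace \<Rightarrow> 'w::complex_vector nspace \<Rightarrow> ('v \<Rightarrow> 'w) \<Rightarrow> bool" where
  "homogeneous_polynomial m X Y P \<longleftrightarrow>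
     (\<exists>A. multilinear m X Y A \<and> (\<forall>x\<in>vecs X. P x = A (\<lambda>i\<in>{..<m}. x)))"

text \<open>Local power series expansions at every point of \<open>U \<subseteq> vecs X\<close>; the condition
  \<open>y \<in> U\<close> makes \<open>U\<close> open in \<open>X\<close>.\<close>

definition nholomorphic_on ::
    "'v::complex_vector nspace \<Rightarrow> 'v set \<Rightarrow> 'w::complex_vector nspace \<Rightarrow> ('v \<Rightarrow> 'w) \<Rightarrow> bool" where
  "nholomorphic_on X U Y f \<longleftrightarrow>
     U \<subseteq> vecs X \<and> f \<in> U \<rightarrow> vecs Y \<and>
     (\<forall>x\<in>U. \<exists>r>0. \<exists>P.
        (\<forall>m. homogeneous_polynomial m X Y (P m) \<and>
             continuous_map (nrm_topology X) (nrm_topology Y) (P m)) \<and>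
        (\<forall>y\<in>vecs X. nrm X (y - x) < r \<longrightarrow>
           y \<in> U \<and>
           limitin (nrm_topology Y) (\<lambda>n. \<Sum>m<n. P m (y - x)) (f y) sequentially) \<and>
        (\<exists>s>0. s \<le> r \<and>
           (\<forall>\<epsilon>>0. \<exists>N. \<forall>n\<ge>N. \<forall>y\<in>vecs X. nrm X (y - x) < s \<longrightarrow>
              nrm Y ((\<Sum>m<n. P m (y - x)) - f y) < \<epsilon>)))"

abbreviation nholomorphic ::
    "'v::complex_vector nspace \<Rightarrow> 'w::complex_vector nspace \<Rightarrow> ('v \<Rightarrow> 'w) \<Rightarrow> bool" where
  "nholomorphic X Y f \<equiv> nholomorphic_on X (vecs X) Y f"


section \<open>Compatible couples and complex interpolation\<close>

definition compatible_couple :: "'v::complex_tvs nspace \<Rightarrow> 'v nspace \<Rightarrow> bool" where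
  "compatible_couple X0 X1 \<longleftrightarrow>
     banach_subspace X0 \<and> continuous_map (nrm_topology X0) euclidean id \<and>
     banach_subspace X1 \<and> continuous_map (nrm_topology X1) euclidean id"

definition sum_space :: "'v::complex_vector nspace \<Rightarrow> 'v nspace \<Rightarrow> 'v nspace" where
  "sum_space X0 X1 =
     \<lparr>vecs = {x0 + x1 | x0 x1. x0 \<in> vecs X0 \<and> x1 \<in> vecs X1},
      nrm = (\<lambda>x. Inf {nrm X0 x0 + nrm X1 x1 | x0 x1.
                       x0 \<in> vecs X0 \<and> x1 \<in> vecs X1 \<and> x = x0 + x1})\<rparr>"

definition complex_nspace :: "complex nspace" where
  "complex_nspace = \<lparr>vecs = UNIV, nrm = cmod\<rparr>"

definition annulus :: "complex set" where
  "annulus = {z. 1 < cmod z \<and> cmod z < exp 1}"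

text \<open>Only the values on the closed annulus matter, so functions are not required to be
  extensional. Being a \<^const>\<open>continuous_map\<close> includes taking values in the target space.\<close>

definition calderon_functions ::
    "'v::complex_vector nspace \<Rightarrow> 'v nspace \<Rightarrow> (complex \<Rightarrow> 'v) set" where
  "calderon_functions X0 X1 =
     {\<phi>. continuous_map (top_of_set (closure annulus)) (nrm_topology (sum_space X0 X1)) \<phi> \<and>
         nholomorphic_on complex_nspace annulus (sum_space X0 X1) \<phi> \<and>
         continuous_map (top_of_set {z. cmod z = 1}) (nrm_topology X0) \<phi> \<and>
         continuous_map (top_of_set {z. cmod z = exp 1}) (nrm_topology X1) \<phi>}"

definition calderon_norm ::
    "'v::complex_vector nspace \<Rightarrow> 'v nspace \<Rightarrow> (complex \<Rightarrow> 'v) \<Rightarrow> real" where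
  "calderon_norm X0 X1 \<phi> =
     (SUP t\<in>{0..2 * pi}. max (nrm X0 (\<phi> (exp (\<i> * complex_of_real t))))
                             (nrm X1 (\<phi> (exp (1 + \<i> * complex_of_real t)))))"

definition interpolation_space ::
    "'v::complex_vector nspace \<Rightarrow> 'v nspace \<Rightarrow> real \<Rightarrow> 'v nspace" where
  "interpolation_space X0 X1 \<theta> =
     \<lparr>vecs = {\<phi> (complex_of_real (exp \<theta>)) | \<phi>. \<phi> \<in> calderon_functions X0 X1},
      nrm = (\<lambda>x. Inf {calderon_norm X0 X1 \<phi> | \<phi>.
                       \<phi> \<in> calderon_functions X0 X1 \<and> \<phi> (complex_of_real (exp \<theta>)) = x})\<rparr>"

end

theory Submission
  imports Defs
begin

text \<open>
  Let \<open>x = \<phi> (exp \<theta>)\<close> with \<open>\<phi>\<close> in Calderon's space of the first couple. The Taylor polynomials of \<open>f\<close>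
  at \<open>x\<close>, taken in the sum spaces, are also the Taylor polynomials of \<open>f\<close> between the interpolation
  spaces. To see that they map one interpolation space to the other, move the base point along \<open>\<phi>\<close>:
  for every Calderon function \<open>\<psi>\<close> the function \<open>z \<mapsto> P\<^sub>m f(\<phi>(z))(\<psi>(z))\<close> is again a Calderon function
  (\<open>calderon_functions_taylor\<close>) and its value at \<open>exp \<theta>\<close> is \<open>P\<^sub>m f(x)(\<psi>(exp \<theta>))\<close>. On each of the two
  boundary circles \<open>\<phi>\<close> has compact range in \<open>X\<^sub>j\<close>, so the expansions of \<open>f : X\<^sub>j \<rightarrow> Y\<^sub>j\<close> around the points
  \<open>\<phi>(z)\<close> converge geometrically on balls of a common radius \<open>d\<close>. As the Calderon norm is a maximum
  over the boundary, the remainders of the expansion of \<open>f \<circ> (\<phi> + \<psi>)\<close> tend to \<open>0\<close> in that norm,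
  uniformly for \<open>\<parallel>\<psi>\<parallel> < d\<close> (\<open>taylor_calderon_estimates\<close>), and passing to the quotient norm of the
  interpolation space gives the theorem.

  Three ingredients need work in a setting where spaces are mere subsets with a norm.

  Vector-valued power series in one variable are handled by averaging over roots of unity in place of
  contour integration: such an average extracts a coefficient of a polynomial exactly, which gives
  Cauchy's estimates for uniform limits of polynomials (\<open>approx_series_estimates\<close>).

  That \<open>z \<mapsto> P\<^sub>m f(\<phi>(z))(\<psi>(z))\<close> is holomorphic is shown by expanding \<open>f(\<phi>(z + h) + l \<psi>(z + h))\<close> jointly
  in \<open>h\<close> and \<open>l\<close> and reading off the coefficient of \<open>l\<^sup>m\<close> (\<open>taylor_along_curve_power_series\<close>); the case
  \<open>m = 0\<close> says that \<open>f \<circ> \<phi>\<close> is holomorphic.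

  That the interpolation norm is definite, so that the interpolation space is a normed space at all,
  is the maximum principle for the norm of a vector-valued holomorphic function
  (\<open>calderon_maximum_principle\<close>).
\<close>


section \<open>Elementary properties of the norms\<close>

lemma normed_subspaceD:
  assumes "normed_subspace X"
  shows vecs_subspace: "complex_vector.subspace (vecs X)"
    and nrm_nonneg: "x \<in> vecs X \<Longrightarrow> 0 \<le> nrm X x"
    and nrm_eq_0: "x \<in> vecs X \<Longrightarrow> nrm X x = 0 \<longleftrightarrow> x = 0"
    and nrm_triangle: "x \<in> vecs X \<Longrightarrow> y \<in> vecs X \<Longrightarrow> nrm X (x + y) \<le> nrm X x + nrm X y"
    and nrm_scale: "x \<in> vecs X \<Longrightarrow> nrm X (c *\<^sub>C x) = cmod c * nrm X x"
  using assms by (auto simp: normed_subspace_def)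

lemma vecs_closed:
  assumes "normed_subspace X"
  shows vecs_0: "0 \<in> vecs X"
    and vecs_add: "x \<in> vecs X \<Longrightarrow> y \<in> vecs X \<Longrightarrow> x + y \<in> vecs X"
    and vecs_diff: "x \<in> vecs X \<Longrightarrow> y \<in> vecs X \<Longrightarrow> x - y \<in> vecs X"
    and vecs_scale: "x \<in> vecs X \<Longrightarrow> c *\<^sub>C x \<in> vecs X"
    and vecs_sum: "(\<And>i. i \<in> I \<Longrightarrow> u i \<in> vecs X) \<Longrightarrow> sum u I \<in> vecs X"
  using vecs_subspace[OF assms]
  by (auto intro: complex_vector.subspace_0 complex_vector.subspace_add
      complex_vector.subspace_diff complex_vector.subspace_scale complex_vector.subspace_sum)

lemma nrm_0: "normed_subspace X \<Longrightarrow> nrm X 0 = 0"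
  by (simp add: nrm_eq_0 vecs_0)

lemma nrm_minus_commute:
  assumes "normed_subspace X" "x \<in> vecs X" "y \<in> vecs X"
  shows "nrm X (x - y) = nrm X (y - x)"
  using nrm_scale[OF assms(1) vecs_diff[OF assms(1,3,2)], of "-1"] by simp

lemma nrm_triangle_diff:
  assumes "normed_subspace X" "x \<in> vecs X" "y \<in> vecs X"
  shows "nrm X (x - y) \<le> nrm X x + nrm X y"
  using nrm_triangle[OF assms(1,2), of "(-1) *\<^sub>C y"] assms
  by (simp add: vecs_scale nrm_scale del: complex_vector.scale_minus_left)
    (simp add: nrm_scale)

lemma nrm_triangle_sub:
  assumes "normed_subspace X" "x \<in> vecs X" "y \<in> vecs X" "z \<in> vecs X"
  shows "nrm X (x - z) \<le> nrm X (x - y) + nrm X (y - z)"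
  using nrm_triangle[OF assms(1), of "x - y" "y - z"] assms by (simp add: vecs_closed)

lemma nrm_diff_le:
  assumes "normed_subspace X" "x \<in> vecs X" "y \<in> vecs X"
  shows "nrm X x \<le> nrm X y + nrm X (x - y)"
  using nrm_triangle[OF assms(1,3), of "x - y"] assms by (simp add: vecs_closed)

lemma nrm_sum_le:
  assumes "normed_subspace X" "\<And>i. i \<in> I \<Longrightarrow> u i \<in> vecs X"
  shows "nrm X (sum u I) \<le> (\<Sum>i\<in>I. nrm X (u i))"
  using assms(2)
proof (induction I rule: infinite_finite_induct)
  case (insert i I)
  then have "nrm X (u i + sum u I) \<le> nrm X (u i) + nrm X (sum u I)"
    by (intro nrm_triangle assms(1) vecs_sum) auto
  with insert show ?case by fastforce
qed (auto simp: nrm_0 assms(1))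

lemma nrm_combine_less:
  assumes X: "normed_subspace X" and u: "u \<in> vecs X" and v: "v \<in> vecs X"
    and "nrm X u < e / (cmod a + 1)" "nrm X v < e / (cmod a + 1)"
  shows "nrm X (u + a *\<^sub>C v) < e"
proof -
  have a: "cmod a + 1 > 0" by (simp add: add_nonneg_pos)
  have "nrm X (u + a *\<^sub>C v) \<le> nrm X u + cmod a * nrm X v"
    using nrm_triangle[OF X u vecs_scale[OF X v], of a] by (simp add: nrm_scale[OF X v])
  also have "\<dots> < e / (cmod a + 1) + cmod a * (e / (cmod a + 1))"
    using assms by (intro add_less_le_mono mult_left_mono) auto
  also have "\<dots> = (cmod a + 1) * (e / (cmod a + 1))" by (simp only: distrib_right mult_1_left add.commute)
  finally show ?thesis using a by simp
qed

lemma normed_subspaceI: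
  assumes sub: "complex_vector.subspace (vecs X)"
    and nonneg: "\<And>x. x \<in> vecs X \<Longrightarrow> 0 \<le> nrm X x"
    and definite: "\<And>x. x \<in> vecs X \<Longrightarrow> nrm X x = 0 \<Longrightarrow> x = 0"
    and tri: "\<And>x y. x \<in> vecs X \<Longrightarrow> y \<in> vecs X \<Longrightarrow> nrm X (x + y) \<le> nrm X x + nrm X y"
    and scale_le: "\<And>c x. x \<in> vecs X \<Longrightarrow> nrm X (c *\<^sub>C x) \<le> cmod c * nrm X x"
  shows "normed_subspace X"
proof -
  have zero: "nrm X 0 = 0"
    using scale_le[of 0 0] nonneg[of 0] complex_vector.subspace_0[OF sub] by simp
  have "nrm X (c *\<^sub>C x) = cmod c * nrm X x" if x: "x \<in> vecs X" for c x
  proof (cases "c = 0")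
    case False
    have "nrm X (inverse c *\<^sub>C c *\<^sub>C x) \<le> cmod (inverse c) * nrm X (c *\<^sub>C x)"
      using x sub by (intro scale_le complex_vector.subspace_scale)
    then have "cmod c * nrm X x \<le> nrm X (c *\<^sub>C x)"
      using False by (simp add: norm_divide field_simps)
    then show ?thesis using scale_le[OF x, of c] by simp
  qed (simp add: zero)
  then show ?thesis unfolding normed_subspace_def using sub nonneg zero definite tri by blast
qed

lemma limitin_nrm_iff:
  assumes "normed_subspace X"
  shows "limitin (nrm_topology X) u l sequentially \<longleftrightarrow>
    l \<in> vecs X \<and> (\<forall>e>0. \<forall>\<^sub>F n in sequentially. u n \<in> vecs X \<and> nrm X (u n - l) < e)"
  unfolding nrm_topology_def Metric_space.limitin_metric[OF Metric_space_nrm_dist[OF assms]]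
  by (auto simp: nrm_dist_def elim!: eventually_mono)

lemma continuous_map_nrm_iff:
  assumes "normed_subspace X" "normed_subspace Y"
  shows "continuous_map (nrm_topology X) (nrm_topology Y) g \<longleftrightarrow>
    g \<in> vecs X \<rightarrow> vecs Y \<and>
    (\<forall>x\<in>vecs X. \<forall>e>0. \<exists>d>0. \<forall>y\<in>vecs X. nrm X (y - x) < d \<longrightarrow> nrm Y (g y - g x) < e)"
    (is "?L \<longleftrightarrow> ?R")
proof -
  have "?L \<longleftrightarrow> g ` vecs X \<subseteq> vecs Y \<and> (\<forall>a\<in>vecs X. \<forall>e>0. \<exists>d>0. \<forall>x. x \<in> vecs X \<and>
      nrm_dist X a x < d \<longrightarrow> nrm_dist Y (g a) (g x) < e)"
    unfolding nrm_topology_def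
    by (rule Metric_space.metric_continuous_map) (intro Metric_space_nrm_dist assms)+
  also have "\<dots> \<longleftrightarrow> ?R"
  proof (cases "g \<in> vecs X \<rightarrow> vecs Y")
    case True
    then have "nrm_dist X a x = nrm X (x - a)" "nrm_dist Y (g a) (g x) = nrm Y (g x - g a)"
      if "a \<in> vecs X" "x \<in> vecs X" for a x
      using that by (auto simp: nrm_dist_def Pi_iff nrm_minus_commute assms)
    then show ?thesis
      using True by (simp add: image_subset_iff_funcset Ball_def imp_conjL cong: imp_cong conj_cong)
  qed auto
  finally show ?thesis .
qed

lemma continuous_map_set_nrm_iff:
  fixes S :: "'a::metric_space set"
  assumes "normed_subspace Y"
  shows "continuous_map (top_of_set S) (nrm_topology Y) g \<longleftrightarrow>
    g \<in> S \<rightarrow> vecs Y \<and>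
    (\<forall>x\<in>S. \<forall>e>0. \<exists>d>0. \<forall>y\<in>S. dist y x < d \<longrightarrow> nrm Y (g y - g x) < e)" (is "?L \<longleftrightarrow> ?R")
proof -
  interpret Y: Metric_space "vecs Y" "nrm_dist Y"
    by (rule Metric_space_nrm_dist) fact
  have "?L \<longleftrightarrow> (\<forall>x\<in>S. \<forall>e>0. \<exists>U. openin (top_of_set S) U \<and> x \<in> U \<and> (\<forall>y\<in>U. g y \<in> Y.mball (g x) e))"
    unfolding nrm_topology_def Y.continuous_map_to_metric by simp
  also have "\<dots> \<longleftrightarrow> (\<forall>x\<in>S. \<forall>e>0. \<exists>d>0. \<forall>y\<in>S. dist y x < d \<longrightarrow> g y \<in> Y.mball (g x) e)"
  proof (intro ball_cong refl all_cong iffI)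
    fix x and e :: real assume x: "x \<in> S"
    {
      assume "\<exists>U. openin (top_of_set S) U \<and> x \<in> U \<and> (\<forall>y\<in>U. g y \<in> Y.mball (g x) e)"
      then obtain U where U: "openin (top_of_set S) U" "x \<in> U" "\<forall>y\<in>U. g y \<in> Y.mball (g x) e"
        by blast
      then obtain d where "d > 0" "\<forall>y\<in>S. dist y x < d \<longrightarrow> y \<in> U"
        unfolding openin_euclidean_subtopology_iff by meson
      with U show "\<exists>d>0. \<forall>y\<in>S. dist y x < d \<longrightarrow> g y \<in> Y.mball (g x) e" by blast
    next
      assume "\<exists>d>0. \<forall>y\<in>S. dist y x < d \<longrightarrow> g y \<in> Y.mball (g x) e"
      then obtain d where d: "d > 0" "\<forall>y\<in>S. dist y x < d \<longrightarrow> g y \<in> Y.mball (g x) e" by blast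
      show "\<exists>U. openin (top_of_set S) U \<and> x \<in> U \<and> (\<forall>y\<in>U. g y \<in> Y.mball (g x) e)"
        using d x by (intro exI[of _ "S \<inter> ball x d"]) (auto simp: dist_commute)
    }
  qed
  also have "\<dots> \<longleftrightarrow> ?R"
  proof
    assume L: "\<forall>x\<in>S. \<forall>e>0. \<exists>d>0. \<forall>y\<in>S. dist y x < d \<longrightarrow> g y \<in> Y.mball (g x) e"
    have g: "g x \<in> vecs Y" if x: "x \<in> S" for x
    proof -
      obtain d where "d > 0" "\<forall>y\<in>S. dist y x < d \<longrightarrow> g y \<in> Y.mball (g x) 1"
        using bspec[OF L x] zero_less_one by metis
      then have "g x \<in> Y.mball (g x) 1" using x by auto
      then show ?thesis by auto
    qed
    then have "g y \<in> Y.mball (g x) e \<longleftrightarrow> nrm Y (g y - g x) < e" if "x \<in> S" "y \<in> S" for x y e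
      using that by (auto simp: nrm_dist_def nrm_minus_commute assms)
    with L g show ?R by simp
  next
    assume R: ?R
    then have "g y \<in> Y.mball (g x) e \<longleftrightarrow> nrm Y (g y - g x) < e" if "x \<in> S" "y \<in> S" for x y e
      using that by (auto simp: nrm_dist_def nrm_minus_commute assms Pi_iff)
    with R show "\<forall>x\<in>S. \<forall>e>0. \<exists>d>0. \<forall>y\<in>S. dist y x < d \<longrightarrow> g y \<in> Y.mball (g x) e" by simp
  qed
  finally show ?thesis .
qed

lemma normed_subspace_complex: "normed_subspace complex_nspace"
  by (simp add: normed_subspace_def complex_nspace_def scaleC_complex_def norm_mult norm_triangle_ineq)

abbreviation vpoly :: "(nat \<Rightarrow> 'v::complex_vector) \<Rightarrow> nat \<Rightarrow> complex \<Rightarrow> 'v" where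
  "vpoly c n l \<equiv> (\<Sum>k<n. l ^ k *\<^sub>C c k)"

lemma sum_split_scale:
  "(\<Sum>k<n. l ^ k *\<^sub>C (c k - d k)) = vpoly c n l - vpoly d n l"
  for c d :: "nat \<Rightarrow> 'a::complex_vector"
  by (simp add: complex_vector.scale_right_diff_distrib sum_subtractf)


section \<open>Power series with vector coefficients\<close>

text \<open>Averaging a polynomial of degree less than \<open>n\<close> against a character over the \<open>n\<close>-th roots of
  unity isolates one coefficient exactly; this plays the role of Cauchy's integral formula.\<close>

lemma cauchy_estimate_polynomial:
  assumes Y: "normed_subspace Y" and c: "\<And>k. k < n \<Longrightarrow> c k \<in> vecs Y" and "r \<ge> 0"
    and M: "\<And>l. cmod l = r \<Longrightarrow> nrm Y (vpoly c n l) \<le> M" and j: "j < n"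
  shows "nrm Y (c j) * r ^ j \<le> M"
proof -
  define w where "w k = exp (2 * of_real pi * \<i> * of_nat k / of_nat n)" for k :: nat
  have n: "n \<ge> 1" using j by simp
  have w_pow: "w k ^ n = 1" for k
    unfolding w_def using complex_root_unity[of n k] n by simp
  have w_mult: "w a ^ b = w b ^ a" for a b
    unfolding w_def exp_of_nat_mult[symmetric] by (simp add: mult_ac)
  have w_eq: "w a = w b \<longleftrightarrow> a = b" if "a < n" "b < n" for a b
    using complex_root_unity_eq[OF n, of a b] that by (simp add: w_def)
  have w_nz: "w k \<noteq> 0" for k by (simp add: w_def)
  have cm: "cmod (w k) = 1" for k
    by (simp add: w_def)
  have orth: "(\<Sum>l<n. (w l) ^ k * inverse (w l) ^ j) = (if k = j then of_nat n else 0)" if k: "k < n" for k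
  proof -
    define z where "z = w k / w j"
    have "(\<Sum>l<n. (w l) ^ k * inverse (w l) ^ j) = (\<Sum>l<n. z ^ l)"
    proof (rule sum.cong)
      fix l
      have "w l ^ k * inverse (w l) ^ j = w k ^ l * inverse (w j ^ l)"
        by (simp add: w_mult[of l k] w_mult[of l j] power_inverse)
      also have "\<dots> = z ^ l" by (simp add: z_def divide_inverse power_mult_distrib power_inverse)
      finally show "w l ^ k * inverse (w l) ^ j = z ^ l" .
    qed simp
    also have "\<dots> = (if k = j then of_nat n else 0)"
    proof (cases "k = j")
      case False
      then have "z \<noteq> 1" using w_eq[OF k j] w_nz by (auto simp: z_def)
      moreover have "z ^ n = 1" by (simp add: z_def power_divide w_pow)
      ultimately show ?thesis using False by (simp add: sum_gp_strict)
    qed (simp add: z_def w_nz)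
    finally show ?thesis .
  qed
  define p where "p l = vpoly c n l" for l
  have p: "p l \<in> vecs Y" for l
    unfolding p_def using c by (intro vecs_sum vecs_scale Y) auto
  have "(\<Sum>l<n. (inverse (w l) ^ j) *\<^sub>C p (of_real r * w l))
      = (\<Sum>k<n. \<Sum>l<n. (of_real r ^ k * (w l ^ k * inverse (w l) ^ j)) *\<^sub>C c k)"
    unfolding p_def complex_vector.scale_sum_right
    by (subst sum.swap) (simp add: power_mult_distrib mult_ac)
  also have "\<dots> = (\<Sum>k<n. (of_real r ^ k * (if k = j then of_nat n else 0)) *\<^sub>C c k)"
    by (intro sum.cong refl) (simp add: orth complex_vector.scale_sum_left[symmetric]
        sum_distrib_left[symmetric])
  also have "\<dots> = (\<Sum>k<n. if k = j then (of_real r ^ k * of_nat n) *\<^sub>C c k else 0)"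
    by (intro sum.cong refl) simp
  also have "\<dots> = (of_real r ^ j * of_nat n) *\<^sub>C c j"
    using j by simp
  finally have eq: "(of_real r ^ j * of_nat n) *\<^sub>C c j
      = (\<Sum>l<n. (inverse (w l) ^ j) *\<^sub>C p (of_real r * w l))" by simp
  have "r ^ j * real n * nrm Y (c j) = nrm Y ((of_real r ^ j * of_nat n) *\<^sub>C c j)"
    using c[OF j] \<open>r \<ge> 0\<close> by (simp add: nrm_scale[OF Y] norm_mult norm_power)
  also have "\<dots> \<le> (\<Sum>l<n. nrm Y ((inverse (w l) ^ j) *\<^sub>C p (of_real r * w l)))"
    unfolding eq using p by (intro nrm_sum_le Y vecs_scale)
  also have "\<dots> \<le> (\<Sum>l<n. M)"
  proof (rule sum_mono)
    fix l
    have "cmod (of_real r * w l) = r" using \<open>r \<ge> 0\<close> by (simp add: norm_mult cm)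
    then show "nrm Y ((inverse (w l) ^ j) *\<^sub>C p (of_real r * w l)) \<le> M"
      using M[of "of_real r * w l"] p
      by (simp add: nrm_scale[OF Y] norm_power norm_inverse cm p_def)
  qed
  finally show ?thesis using n by (simp add: mult_ac)
qed

text \<open>Uniform approximation by polynomials whose low coefficients approach those of \<open>c\<close>. Such
  approximations are what the arguments below produce on discs of prescribed size; the series with
  coefficients \<open>c\<close> itself then converges on half of the disc.\<close>

definition approx_series ::
    "'v::complex_vector nspace \<Rightarrow> (complex \<Rightarrow> 'v) \<Rightarrow> (nat \<Rightarrow> 'v) \<Rightarrow> real \<Rightarrow> bool" where
  "approx_series Y g c r \<longleftrightarrow> (\<forall>k. c k \<in> vecs Y) \<and>
     (\<forall>n. \<forall>e>0. \<exists>N\<ge>n. \<exists>d. (\<forall>k. d k \<in> vecs Y) \<and> (\<forall>k<n. nrm Y (d k - c k) < e) \<and>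
        (\<forall>l. cmod l \<le> r \<longrightarrow> nrm Y (g l - vpoly d N l) < e))"

definition power_series ::
    "'v::complex_vector nspace \<Rightarrow> (complex \<Rightarrow> 'v) \<Rightarrow> (nat \<Rightarrow> 'v) \<Rightarrow> real \<Rightarrow> bool" where
  "power_series Y g c r \<longleftrightarrow> (\<forall>k. c k \<in> vecs Y) \<and>
     (\<forall>e>0. \<exists>N. \<forall>n\<ge>N. \<forall>l. cmod l < r \<longrightarrow> nrm Y (g l - vpoly c n l) < e)"

definition poly_approx :: "'v::complex_vector nspace \<Rightarrow> (complex \<Rightarrow> 'v) \<Rightarrow> real \<Rightarrow> bool" where
  "poly_approx Y g r \<longleftrightarrow> (\<forall>e>0. \<exists>N d. (\<forall>k. d k \<in> vecs Y) \<and>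
        (\<forall>l. cmod l \<le> r \<longrightarrow> nrm Y (g l - vpoly d N l) < e))"

lemma approx_seriesE:
  assumes "approx_series Y g c r" "e > 0"
  obtains N d where "N \<ge> n" "\<forall>k. d k \<in> vecs Y" "\<forall>k<n. nrm Y (d k - c k) < e"
    "\<forall>l. cmod l \<le> r \<longrightarrow> nrm Y (g l - vpoly d N l) < e"
proof -
  have "\<exists>N\<ge>n. \<exists>d. (\<forall>k. d k \<in> vecs Y) \<and> (\<forall>k<n. nrm Y (d k - c k) < e) \<and>
      (\<forall>l. cmod l \<le> r \<longrightarrow> nrm Y (g l - vpoly d N l) < e)"
    using assms(1)[unfolded approx_series_def, THEN conjunct2, rule_format, OF assms(2)] .
  then show ?thesis using that by blast
qed

lemma power_seriesE:
  assumes "power_series Y g c r" "e > 0"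
  obtains N where "\<forall>n\<ge>N. \<forall>l. cmod l < r \<longrightarrow> nrm Y (g l - vpoly c n l) < e"
  using assms unfolding power_series_def by blast

lemma poly_approxE:
  assumes "poly_approx Y g r" "e > 0"
  obtains N d where "\<forall>k. d k \<in> vecs Y" "\<forall>l. cmod l \<le> r \<longrightarrow> nrm Y (g l - vpoly d N l) < e"
  using assms unfolding poly_approx_def by blast

text \<open>Cauchy's estimate bounds all coefficients of the approximating polynomials by the same geometric
  sequence. Therefore only the coefficients below \<open>n\<close>, which converge, matter up to the tail of a
  geometric series, and for \<open>\<bar>l\<bar> \<le> r / 2\<close> that tail is at most twice its first term.\<close>

lemma approx_series_estimates:
  assumes Y: "normed_subspace Y" and A: "approx_series Y g c r" and r: "r > 0"
    and g: "\<And>l. cmod l \<le> r \<Longrightarrow> g l \<in> vecs Y"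
    and M: "\<And>l. cmod l \<le> r \<Longrightarrow> nrm Y (g l) \<le> M"
  shows "nrm Y (c j) * r ^ j \<le> M"
    and "cmod l \<le> r / 2 \<Longrightarrow> nrm Y (g l - vpoly c n l) \<le> 2 * M * (cmod l / r) ^ n"
proof -
  have c: "c k \<in> vecs Y" for k using A by (simp add: approx_series_def)
  have key: "\<exists>N\<ge>n. \<exists>d. (\<forall>k. d k \<in> vecs Y) \<and> (\<forall>k<n. nrm Y (d k - c k) < e) \<and>
      (\<forall>k<N. nrm Y (d k) * r ^ k \<le> M + e) \<and>
      (\<forall>l. cmod l \<le> r \<longrightarrow> nrm Y (g l - vpoly d N l) < e)" if e: "e > 0" for e n
  proof -
    obtain N d where N: "N \<ge> n" and d: "\<forall>k. d k \<in> vecs Y" and dc: "\<forall>k<n. nrm Y (d k - c k) < e"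
      and gd: "\<forall>l. cmod l \<le> r \<longrightarrow> nrm Y (g l - vpoly d N l) < e"
      by (rule approx_seriesE[OF A e])
    have "nrm Y (d k) * r ^ k \<le> M + e" if "k < N" for k
    proof (rule cauchy_estimate_polynomial[OF Y _ _ _ that])
      fix l assume l: "cmod l = r"
      have p: "vpoly d N l \<in> vecs Y" using d by (intro vecs_sum vecs_scale Y) auto
      have "nrm Y (vpoly d N l) \<le> nrm Y (g l) + nrm Y (vpoly d N l - g l)"
        using p g l by (intro nrm_diff_le Y) auto
      also have "nrm Y (vpoly d N l - g l) = nrm Y (g l - vpoly d N l)"
        using p g l by (intro nrm_minus_commute Y) auto
      finally show "nrm Y (vpoly d N l) \<le> M + e"
        using gd M[of l] l by fastforce
    qed (use d r in auto)
    then show ?thesis using N d dc gd by blast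
  qed
  have "nrm Y (c j) * r ^ j \<le> M + e" if e: "e > 0" for e
  proof -
    define e' where "e' = min (e/2) (e / (2 * r ^ j))"
    have e': "e' > 0" using e r by (simp add: e'_def)
    obtain N d where N: "N \<ge> Suc j" and d: "\<forall>k. d k \<in> vecs Y"
      and dc: "\<forall>k<Suc j. nrm Y (d k - c k) < e'"
      and dM: "\<forall>k<N. nrm Y (d k) * r ^ k \<le> M + e'"
      using key[OF e', of "Suc j"] by blast
    have "nrm Y (c j) \<le> nrm Y (d j) + nrm Y (c j - d j)"
      using c d by (intro nrm_diff_le Y) auto
    also have "nrm Y (c j - d j) = nrm Y (d j - c j)" using c d by (intro nrm_minus_commute Y) auto
    also have "\<dots> \<le> e'" using dc by (simp add: less_imp_le)
    finally have "nrm Y (c j) * r ^ j \<le> (nrm Y (d j) + e') * r ^ j"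
      using r by (intro mult_right_mono) auto
    also have "\<dots> \<le> (M + e') + e' * r ^ j" using dM N by (simp add: distrib_right)
    also have "e' * r ^ j \<le> e / (2 * r ^ j) * r ^ j" using r by (intro mult_right_mono) (auto simp: e'_def)
    also have "\<dots> = e / 2" using r by simp
    also have "e' \<le> e / 2" by (simp add: e'_def)
    finally show ?thesis by simp
  qed
  then show "nrm Y (c j) * r ^ j \<le> M" by (rule field_le_epsilon)
  assume l: "cmod l \<le> r / 2"
  define t where "t = cmod l / r"
  have t: "0 \<le> t" "t \<le> 1/2" using l r by (auto simp: t_def field_simps)
  have "nrm Y (g l - vpoly c n l) \<le> 2 * M * t ^ n + e" if e: "e > 0" for e
  proof -
    define S where "S = (\<Sum>k<n. cmod l ^ k)"
    have S: "S \<ge> 0" by (simp add: S_def sum_nonneg)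
    \<comment> \<open>The error consists of one \<open>e'\<close> for the approximation, \<open>S * e'\<close> for the coefficients below \<open>n\<close>,
      and \<open>2 * e'\<close> from the bound \<open>M + e'\<close> on the remaining ones.\<close>
    define e' where "e' = e / (3 + S)"
    have e': "e' > 0" using e S by (simp add: e'_def)
    obtain N d where N: "N \<ge> n" and d: "\<forall>k. d k \<in> vecs Y"
      and dc: "\<forall>k<n. nrm Y (d k - c k) < e'"
      and dM: "\<forall>k<N. nrm Y (d k) * r ^ k \<le> M + e'"
      and gd: "\<forall>l. cmod l \<le> r \<longrightarrow> nrm Y (g l - vpoly d N l) < e'"
      using key[OF e', of n] by blast
    have M0: "M + e' \<ge> 0" using M[of 0] g[of 0] nrm_nonneg[OF Y, of "g 0"] r e' by simp
    have gl: "g l \<in> vecs Y" using g l r by simp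
    have in1: "vpoly d m l \<in> vecs Y" "vpoly c m l \<in> vecs Y"
      "(\<Sum>k=m..<m'. l ^ k *\<^sub>C d k) \<in> vecs Y" for m m'
      using c d by (intro vecs_sum vecs_scale Y; auto)+
    have split: "vpoly d N l = vpoly d n l + (\<Sum>k=n..<N. l ^ k *\<^sub>C d k)"
      using N by (simp add: lessThan_atLeast0 sum.atLeastLessThan_concat)
    have "nrm Y (g l - vpoly c n l) \<le>
        nrm Y (g l - vpoly d N l) + nrm Y (vpoly d N l - vpoly c n l)"
      by (intro nrm_triangle_sub Y gl in1)
    also have "nrm Y (g l - vpoly d N l) \<le> e'" using gd l r by (simp add: less_imp_le)
    also have "vpoly d N l - vpoly c n l
        = (\<Sum>k<n. l ^ k *\<^sub>C (d k - c k)) + (\<Sum>k=n..<N. l ^ k *\<^sub>C d k)"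
      unfolding split sum_split_scale by simp
    also have "nrm Y \<dots> \<le> nrm Y (\<Sum>k<n. l ^ k *\<^sub>C (d k - c k)) + nrm Y (\<Sum>k=n..<N. l ^ k *\<^sub>C d k)"
      using c d in1 by (intro nrm_triangle Y vecs_sum vecs_scale vecs_diff) auto
    also have "nrm Y (\<Sum>k<n. l ^ k *\<^sub>C (d k - c k)) \<le> (\<Sum>k<n. nrm Y (l ^ k *\<^sub>C (d k - c k)))"
      using c d by (intro nrm_sum_le Y vecs_scale vecs_diff) auto
    also have "\<dots> \<le> (\<Sum>k<n. cmod l ^ k * e')"
      using c d less_imp_le[OF dc[rule_format]]
      by (intro sum_mono) (auto simp: nrm_scale[OF Y] vecs_diff[OF Y] norm_power intro!: mult_left_mono)
    also have "\<dots> = S * e'" by (simp add: S_def sum_distrib_right)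
    also have "nrm Y (\<Sum>k=n..<N. l ^ k *\<^sub>C d k) \<le> (\<Sum>k=n..<N. nrm Y (l ^ k *\<^sub>C d k))"
      using d by (intro nrm_sum_le Y vecs_scale) auto
    also have "\<dots> \<le> (\<Sum>k=n..<N. (M + e') * t ^ k)"
    proof (rule sum_mono)
      fix k assume k: "k \<in> {n..<N}"
      have "nrm Y (l ^ k *\<^sub>C d k) = (nrm Y (d k) * r ^ k) * t ^ k"
        using d r by (simp add: nrm_scale[OF Y] norm_power t_def power_divide)
      also have "\<dots> \<le> (M + e') * t ^ k" using dM k t by (intro mult_right_mono) auto
      finally show "nrm Y (l ^ k *\<^sub>C d k) \<le> (M + e') * t ^ k" .
    qed
    also have "\<dots> = (M + e') * (\<Sum>k=n..<N. t ^ k)" by (simp add: sum_distrib_left)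
    also have "\<dots> \<le> (M + e') * (2 * t ^ n)"
    proof (intro mult_left_mono M0)
      have "(1 - t) * (\<Sum>k=n..<N. t ^ k) = t ^ n - t ^ N"
      proof -
        have "(1 - t) * (\<Sum>k=n..<N. t ^ k) = (\<Sum>k=n..<N. t ^ k - t ^ Suc k)"
          by (simp add: sum_distrib_left algebra_simps sum_subtractf)
        also have "\<dots> = t ^ n - t ^ N" using sum_Suc_diff'[of n N "\<lambda>k. - (t ^ k)"] N by simp
        finally show ?thesis .
      qed
      also have "\<dots> \<le> t ^ n" using t by simp
      finally have "(1 - t) * (\<Sum>k=n..<N. t ^ k) \<le> t ^ n" .
      moreover have "1/2 * (\<Sum>k=n..<N. t ^ k) \<le> (1 - t) * (\<Sum>k=n..<N. t ^ k)"
        using t by (intro mult_right_mono sum_nonneg) auto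
      ultimately show "(\<Sum>k=n..<N. t ^ k) \<le> 2 * t ^ n" by simp
    qed
    also have "\<dots> \<le> 2 * M * t ^ n + 2 * e'"
    proof -
      have "t ^ n \<le> 1" using t by (intro power_le_one) auto
      then have "e' * t ^ n \<le> e'" using e' by (simp add: mult_left_le)
      then show ?thesis by (simp add: algebra_simps)
    qed
    finally have "nrm Y (g l - vpoly c n l) \<le> 2 * M * t ^ n + (3 + S) * e'"
      by (simp add: algebra_simps)
    also have "(3 + S) * e' = e" using S by (simp add: e'_def)
    finally show ?thesis .
  qed
  then show "nrm Y (g l - vpoly c n l) \<le> 2 * M * (cmod l / r) ^ n"
    unfolding t_def by (rule field_le_epsilon)
qed

lemma nrm_poly_le:
  assumes Y: "normed_subspace Y" and d: "\<And>k. k < N \<Longrightarrow> d k \<in> vecs Y" and l: "cmod l \<le> r"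
  shows "nrm Y (vpoly d N l) \<le> (\<Sum>k<N. r ^ k * nrm Y (d k))"
proof -
  have "nrm Y (vpoly d N l) \<le> (\<Sum>k<N. nrm Y (l ^ k *\<^sub>C d k))"
    using d by (intro nrm_sum_le Y vecs_scale) auto
  also have "\<dots> \<le> (\<Sum>k<N. r ^ k * nrm Y (d k))"
    using d l by (intro sum_mono)
      (auto simp: nrm_scale[OF Y] norm_power nrm_nonneg[OF Y] intro!: mult_right_mono power_mono)
  finally show ?thesis .
qed

lemma poly_approx_bounded:
  assumes Y: "normed_subspace Y" and A: "poly_approx Y g r"
    and g: "\<And>l. cmod l \<le> r \<Longrightarrow> g l \<in> vecs Y"
  shows "\<exists>M. \<forall>l. cmod l \<le> r \<longrightarrow> nrm Y (g l) \<le> M"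
proof -
  obtain N d where d: "\<forall>k. d k \<in> vecs Y"
    and gd: "\<forall>l. cmod l \<le> r \<longrightarrow> nrm Y (g l - vpoly d N l) < 1"
    by (rule poly_approxE[OF A zero_less_one])
  have "nrm Y (g l) \<le> (\<Sum>k<N. r ^ k * nrm Y (d k)) + 1" if l: "cmod l \<le> r" for l
  proof -
    have p: "vpoly d N l \<in> vecs Y" using d by (intro vecs_sum vecs_scale Y) auto
    show ?thesis
      using nrm_diff_le[OF Y g[OF l] p] gd l nrm_poly_le[OF Y _ l, of N d] d by fastforce
  qed
  then show ?thesis by blast
qed

lemma approx_series_imp_poly_approx:
  assumes A: "approx_series Y g c r"
  shows "poly_approx Y g r"
  unfolding poly_approx_def
proof (intro allI impI)
  fix e :: real assume e: "e > 0"
  show "\<exists>N d. (\<forall>k. d k \<in> vecs Y) \<and>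
      (\<forall>l. cmod l \<le> r \<longrightarrow> nrm Y (g l - vpoly d N l) < e)"
    by (rule approx_seriesE[OF A e, of 0]) blast
qed

lemma power_seriesI:
  assumes Y: "normed_subspace Y" and A: "approx_series Y g c r" and r: "r > 0"
    and g: "\<And>l. cmod l \<le> r \<Longrightarrow> g l \<in> vecs Y"
  shows "power_series Y g c (r / 2)"
  unfolding power_series_def
proof (intro conjI allI impI)
  fix e :: real assume e: "e > 0"
  obtain M where M: "\<And>l. cmod l \<le> r \<Longrightarrow> nrm Y (g l) \<le> M"
    using poly_approx_bounded[OF Y approx_series_imp_poly_approx[OF A] g] by blast
  have M0: "M \<ge> 0" using M[of 0] g[of 0] nrm_nonneg[OF Y, of "g 0"] r by simp
  have "(\<lambda>n. 2 * M * (1/2) ^ n) \<longlonglongrightarrow> 2 * M * 0"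
    by (intro tendsto_intros LIMSEQ_power_zero) auto
  then have "\<forall>\<^sub>F n in sequentially. 2 * M * (1/2) ^ n < e"
    using e by (intro order_tendstoD) auto
  then obtain N where N: "\<And>n. n \<ge> N \<Longrightarrow> 2 * M * (1/2) ^ n < e"
    by (auto simp: eventually_sequentially)
  have "nrm Y (g l - vpoly c n l) < e" if "n \<ge> N" "cmod l < r / 2" for n l
  proof -
    have "nrm Y (g l - vpoly c n l) \<le> 2 * M * (cmod l / r) ^ n"
      using that by (intro approx_series_estimates[OF Y A r g M]) auto
    also have "\<dots> \<le> 2 * M * (1/2) ^ n"
      using that r M0 by (intro mult_left_mono power_mono) (auto simp: field_simps)
    also have "\<dots> < e" using N that by auto
    finally show ?thesis .
  qed
  then show "\<exists>N. \<forall>n\<ge>N. \<forall>l. cmod l < r / 2 \<longrightarrow> nrm Y (g l - vpoly c n l) < e" by blast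
qed (use A in \<open>auto simp: approx_series_def\<close>)

lemma power_series_imp_approx_series:
  assumes "power_series Y g c r" "s < r" "normed_subspace Y"
  shows "approx_series Y g c s"
  unfolding approx_series_def
proof (intro conjI allI impI)
  have c: "\<forall>k. c k \<in> vecs Y" using assms by (simp add: power_series_def)
  fix n and e :: real assume e: "e > 0"
  then obtain N where N: "\<forall>n\<ge>N. \<forall>l. cmod l < r \<longrightarrow> nrm Y (g l - vpoly c n l) < e"
    by (rule power_seriesE[OF assms(1)])
  show "\<exists>N\<ge>n. \<exists>d. (\<forall>k. d k \<in> vecs Y) \<and> (\<forall>k<n. nrm Y (d k - c k) < e) \<and>
        (\<forall>l. cmod l \<le> s \<longrightarrow> nrm Y (g l - vpoly d N l) < e)"
    using N c e assms by (intro exI[of _ "max n N"] conjI exI[of _ c]) (auto simp: nrm_0)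
qed (use assms in \<open>auto simp: power_series_def\<close>)

text \<open>A power series that converges only on a tiny disc converges on half of any disc on which the
  function is a uniform limit of polynomials: Cauchy's estimate on the tiny disc forces the
  coefficients of these polynomials to converge to those of the series.\<close>

lemma poly_approx_imp_approx_series:
  assumes Y: "normed_subspace Y" and A: "poly_approx Y g r" and P: "power_series Y g c s"
    and s: "s > 0" and r: "r > 0" and g: "\<And>l. cmod l \<le> r \<Longrightarrow> g l \<in> vecs Y"
  shows "approx_series Y g c r"
  unfolding approx_series_def
proof (intro conjI allI impI)
  show c: "c k \<in> vecs Y" for k using P by (simp add: power_series_def)
  fix n and e :: real assume e: "e > 0"
  define t where "t = min (s / 2) r"
  have t: "t > 0" "t < s" "t \<le> r" using s r by (auto simp: t_def)
  \<comment> \<open>Cauchy's estimate on the circle of radius \<open>t\<close> loses a factor \<open>t ^ k\<close>; a single \<open>q\<close> bounds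
    the loss for all coefficients below \<open>n\<close>.\<close>
  define q where "q = Min (insert 1 ((\<lambda>k. t ^ k) ` {..<n}))"
  have q: "q > 0" "\<And>k. k < n \<Longrightarrow> q \<le> t ^ k" "q \<le> 1"
    unfolding q_def using t by (auto intro!: Min_le)
  define e' where "e' = e * q / 3"
  have e': "e' > 0" using e q by (simp add: e'_def)
  obtain N d where d: "\<forall>k. d k \<in> vecs Y"
    and gd: "\<forall>l. cmod l \<le> r \<longrightarrow> nrm Y (g l - vpoly d N l) < e'"
    by (rule poly_approxE[OF A e'])
  obtain K where K: "\<forall>n\<ge>K. \<forall>l. cmod l < s \<longrightarrow> nrm Y (g l - vpoly c n l) < e'"
    by (rule power_seriesE[OF P e'])
  define L where "L = max n (max N K)"
  define d' where "d' k = (if k < N then d k else 0)" for k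
  have d': "d' k \<in> vecs Y" for k using d by (simp add: d'_def vecs_0[OF Y])
  have eq: "vpoly d' L l = vpoly d N l" for l
    by (rule sum.mono_neutral_cong_right) (auto simp: L_def d'_def)
  have "nrm Y (d' k - c k) < e" if k: "k < n" for k
  proof -
    have "nrm Y (d' k - c k) * t ^ k \<le> 2 * e'"
    proof (rule cauchy_estimate_polynomial[where n = L and c = "\<lambda>k. d' k - c k"])
      fix l assume l: "cmod l = t"
      have in1: "vpoly d' L l \<in> vecs Y" "vpoly c L l \<in> vecs Y"
        using c d' by (intro vecs_sum vecs_scale Y; auto)+
      have gl: "g l \<in> vecs Y" using g l t by simp
      have "nrm Y (\<Sum>k<L. l ^ k *\<^sub>C (d' k - c k)) \<le>
          nrm Y (vpoly d' L l - g l) + nrm Y (g l - vpoly c L l)"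
        unfolding sum_split_scale by (intro nrm_triangle_sub Y gl in1)
      also have "nrm Y (vpoly d' L l - g l) = nrm Y (g l - vpoly d' L l)"
        by (intro nrm_minus_commute Y gl in1)
      also have "\<dots> \<le> e'" using gd l t by (simp add: eq less_imp_le)
      also have "nrm Y (g l - vpoly c L l) \<le> e'" using K l t by (simp add: L_def less_imp_le)
      finally show "nrm Y (\<Sum>k<L. l ^ k *\<^sub>C (d' k - c k)) \<le> 2 * e'" by simp
    qed (use k c d' t in \<open>auto simp: L_def intro: vecs_diff Y\<close>)
    moreover have "nrm Y (d' k - c k) * q \<le> nrm Y (d' k - c k) * t ^ k"
      using c d' by (intro mult_left_mono q k nrm_nonneg Y vecs_diff) auto
    ultimately have "nrm Y (d' k - c k) * q \<le> 2 * e'" by linarith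
    also have "\<dots> < e * q" using e q by (simp add: e'_def)
    finally show ?thesis using q by simp
  qed
  moreover have "e' \<le> e" 
  proof -
    have "e * q \<le> e * 1" using e q by (intro mult_left_mono) auto
    then show ?thesis using e by (simp add: e'_def)
  qed
  moreover have "\<forall>l. cmod l \<le> r \<longrightarrow> nrm Y (g l - vpoly d' L l) < e"
    unfolding eq using gd \<open>e' \<le> e\<close> by fastforce
  ultimately show "\<exists>N\<ge>n. \<exists>d. (\<forall>k. d k \<in> vecs Y) \<and> (\<forall>k<n. nrm Y (d k - c k) < e) \<and>
        (\<forall>l. cmod l \<le> r \<longrightarrow> nrm Y (g l - vpoly d N l) < e)"
    using d' by (intro exI[of _ L] conjI exI[of _ d']) (auto simp: L_def)
qed

lemma approx_series_diff:
  assumes Y: "normed_subspace Y" and A: "approx_series Y g c r" and B: "approx_series Y h d r"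
    and gh: "\<And>l. cmod l \<le> r \<Longrightarrow> g l \<in> vecs Y" "\<And>l. cmod l \<le> r \<Longrightarrow> h l \<in> vecs Y"
  shows "approx_series Y (\<lambda>l. g l - h l) (\<lambda>k. c k - d k) r"
  unfolding approx_series_def
proof (intro conjI allI impI)
  have cd: "c k \<in> vecs Y" "d k \<in> vecs Y" for k using A B by (auto simp: approx_series_def)
  then show "c k - d k \<in> vecs Y" for k by (intro vecs_diff Y)
  fix n and e :: real assume "e > 0"
  then have e2: "e / 2 > 0" by simp
  obtain N p where N: "N \<ge> n" and p: "\<forall>k. p k \<in> vecs Y" "\<forall>k<n. nrm Y (p k - c k) < e / 2"
    "\<forall>l. cmod l \<le> r \<longrightarrow> nrm Y (g l - vpoly p N l) < e / 2"
    by (rule approx_seriesE[OF A e2])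
  obtain K q where K: "K \<ge> n" and q: "\<forall>k. q k \<in> vecs Y" "\<forall>k<n. nrm Y (q k - d k) < e / 2"
    "\<forall>l. cmod l \<le> r \<longrightarrow> nrm Y (h l - vpoly q K l) < e / 2"
    by (rule approx_seriesE[OF B e2])
  define L where "L = max N K"
  define p' where "p' k = (if k < N then p k else 0)" for k
  define q' where "q' k = (if k < K then q k else 0)" for k
  have in1: "p' k \<in> vecs Y" "q' k \<in> vecs Y" for k using p q by (auto simp: p'_def q'_def vecs_0[OF Y])
  have P: "vpoly p' L l = vpoly p N l" for l
    by (rule sum.mono_neutral_cong_right) (auto simp: L_def p'_def)
  have Q: "vpoly q' L l = vpoly q K l" for l
    by (rule sum.mono_neutral_cong_right) (auto simp: L_def q'_def)
  have "nrm Y (p' k - q' k - (c k - d k)) < e" if "k < n" for k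
  proof -
    have "nrm Y ((p k - c k) - (q k - d k)) \<le> nrm Y (p k - c k) + nrm Y (q k - d k)"
      using p q cd by (intro nrm_triangle_diff Y vecs_diff) auto
    also have "\<dots> < e / 2 + e / 2" using p q that by (intro add_strict_mono) auto
    finally show ?thesis using that N K by (simp add: p'_def q'_def algebra_simps)
  qed
  moreover have "nrm Y (g l - h l - (\<Sum>k<L. l ^ k *\<^sub>C (p' k - q' k))) < e" if l: "cmod l \<le> r" for l
  proof -
    have "vpoly p N l \<in> vecs Y" "vpoly q K l \<in> vecs Y"
      using p q by (intro vecs_sum vecs_scale Y; auto)+
    then have "nrm Y ((g l - vpoly p N l) - (h l - vpoly q K l))
        \<le> nrm Y (g l - vpoly p N l) + nrm Y (h l - vpoly q K l)"
      using gh l by (intro nrm_triangle_diff Y vecs_diff) auto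
    also have "\<dots> < e / 2 + e / 2" using p q l by (intro add_strict_mono) auto
    finally show ?thesis unfolding sum_split_scale P Q by (simp add: algebra_simps)
  qed
  ultimately show "\<exists>N\<ge>n. \<exists>da. (\<forall>k. da k \<in> vecs Y) \<and> (\<forall>k<n. nrm Y (da k - (c k - d k)) < e) \<and>
      (\<forall>l. cmod l \<le> r \<longrightarrow> nrm Y (g l - h l - vpoly da N l) < e)"
    using N in1 by (intro exI[of _ L] conjI exI[of _ "\<lambda>k. p' k - q' k"])
      (auto simp: L_def intro: vecs_diff Y)
qed

lemma power_series_unique:
  assumes Y: "normed_subspace Y" and "power_series Y g c r" "power_series Y g d s" "r > 0" "s > 0"
    and g: "\<And>l. g l \<in> vecs Y"
  shows "c k = d k"
proof -
  have c: "c k \<in> vecs Y" "d k \<in> vecs Y" using assms by (auto simp: power_series_def)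
  define t where "t = min r s / 2"
  have t: "t > 0" "t < r" "t < s" using assms by (auto simp: t_def)
  have "approx_series Y g c t" "approx_series Y g d t"
    using assms t by (auto intro!: power_series_imp_approx_series)
  from approx_series_diff[OF Y this g g]
  have "nrm Y (c k - d k) * t ^ k \<le> 0"
    by (rule approx_series_estimates(1)[OF Y _ t(1)]) (auto simp: vecs_0 nrm_0 Y)
  then have "nrm Y (c k - d k) \<le> 0"
    using zero_less_power[OF t(1), of k] by (auto simp: mult_le_0_iff)
  then have "nrm Y (c k - d k) = 0" using nrm_nonneg[OF Y vecs_diff[OF Y c]] by simp
  then show ?thesis using nrm_eq_0[OF Y vecs_diff[OF Y c]] by simp
qed

lemma power_series_at_0:
  assumes Y: "normed_subspace Y" and P: "power_series Y g c r" and r: "r > 0" and g: "g 0 \<in> vecs Y"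
  shows "g 0 = c 0"
proof -
  have c: "c 0 \<in> vecs Y" using P by (simp add: power_series_def)
  have "nrm Y (g 0 - c 0) \<le> e" if e: "e > 0" for e
  proof -
    obtain N where N: "\<forall>n\<ge>N. \<forall>l. cmod l < r \<longrightarrow> nrm Y (g l - vpoly c n l) < e"
      by (rule power_seriesE[OF P e])
    have "nrm Y (g 0 - (\<Sum>k<Suc N. 0 ^ k *\<^sub>C c k)) < e"
      using N r by (simp del: sum.lessThan_Suc)
    then show ?thesis by (simp add: sum.lessThan_Suc_shift del: sum.lessThan_Suc)
  qed
  then have "nrm Y (g 0 - c 0) \<le> 0" by (rule field_le_epsilon) simp
  then have "nrm Y (g 0 - c 0) = 0" using nrm_nonneg[OF Y vecs_diff[OF Y g c]] by simp
  then show ?thesis using nrm_eq_0[OF Y vecs_diff[OF Y g c]] by simp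
qed

lemma approx_series_polynomial:
  assumes Y: "normed_subspace Y" and d: "\<And>k. d k \<in> vecs Y"
  shows "approx_series Y (\<lambda>l. \<Sum>k<n. l ^ k *\<^sub>C d k) (\<lambda>k. if k < n then d k else 0) r"
  unfolding approx_series_def
proof (intro conjI allI impI)
  fix m and e :: real assume e: "e > 0"
  have "(\<Sum>k<max m n. l ^ k *\<^sub>C (if k < n then d k else 0)) = vpoly d n l" for l
    by (rule sum.mono_neutral_cong_right) auto
  then show "\<exists>N\<ge>m. \<exists>da. (\<forall>k. da k \<in> vecs Y) \<and>
      (\<forall>k<m. nrm Y (da k - (if k < n then d k else 0)) < e) \<and>
      (\<forall>l. cmod l \<le> r \<longrightarrow> nrm Y (vpoly d n l - vpoly da N l) < e)"
    using e d by (intro exI[of _ "max m n"] conjI exI[of _ "\<lambda>k. if k < n then d k else 0"])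
      (auto simp: nrm_0 vecs_0 Y)
qed (use d in \<open>auto simp: vecs_0 Y\<close>)

section \<open>Homogeneous polynomials\<close>

lemma multilinear_in:
  "multilinear m X Y A \<Longrightarrow> a \<in> {..<m} \<rightarrow>\<^sub>E vecs X \<Longrightarrow> A a \<in> vecs Y"
  by (auto simp: multilinear_def)

lemma multilinear_sum:
  assumes A: "multilinear m X Y A" and X: "normed_subspace X" and a: "a \<in> {..<m} \<rightarrow>\<^sub>E vecs X"
    and i: "i < m" and w: "\<And>j. j \<in> J \<Longrightarrow> w j \<in> vecs X" and J: "finite J"
  shows "A (a(i := (\<Sum>j\<in>J. t j *\<^sub>C w j))) = (\<Sum>j\<in>J. t j *\<^sub>C A (a(i := w j)))"
  using J w
proof (induction J)
  case empty
  have "A (a(i := 0 *\<^sub>C 0)) = 0 *\<^sub>C A (a(i := 0))"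
    using A a i vecs_0[OF X] unfolding multilinear_def by blast
  then show ?case by (simp only: sum.empty complex_vector.scale_zero_left)
next
  case (insert j J)
  have "t j *\<^sub>C w j \<in> vecs X" "(\<Sum>j\<in>J. t j *\<^sub>C w j) \<in> vecs X"
    using insert.prems by (auto intro!: vecs_scale vecs_sum X)
  then have "A (a(i := t j *\<^sub>C w j + (\<Sum>j\<in>J. t j *\<^sub>C w j)))
      = A (a(i := t j *\<^sub>C w j)) + A (a(i := (\<Sum>j\<in>J. t j *\<^sub>C w j)))"
    using A a i unfolding multilinear_def by blast
  also have "A (a(i := t j *\<^sub>C w j)) = t j *\<^sub>C A (a(i := w j))"
    using A a i insert.prems unfolding multilinear_def by blast
  also have "A (a(i := (\<Sum>j\<in>J. t j *\<^sub>C w j))) = (\<Sum>j\<in>J. t j *\<^sub>C A (a(i := w j)))"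
    using insert.prems by (intro insert.IH) auto
  finally show ?case by (simp only: sum.insert[OF insert.hyps(1,2)])
qed

text \<open>Sums of vectors are expanded in all slots at once; the terms are indexed by the functions that
  choose a summand for each slot. All expansions of homogeneous polynomials below are instances.\<close>

lemma multilinear_expand:
  assumes A: "multilinear m X Y A" and X: "normed_subspace X"
    and w: "\<And>i. i \<in> I \<Longrightarrow> w i \<in> vecs X" and I: "finite I"
  shows "A (\<lambda>l\<in>{..<m}. \<Sum>i\<in>I. t i *\<^sub>C w i)
    = (\<Sum>g\<in>{..<m} \<rightarrow>\<^sub>E I. (\<Prod>l<m. t (g l)) *\<^sub>C A (\<lambda>l\<in>{..<m}. w (g l)))"
proof -
  define v where "v = (\<Sum>i\<in>I. t i *\<^sub>C w i)"
  have v: "v \<in> vecs X" unfolding v_def using w by (intro vecs_sum vecs_scale X)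
  \<comment> \<open>Expand the first \<open>k\<close> slots and keep arbitrary vectors \<open>b\<close> in the remaining ones.\<close>
  have step: "A (\<lambda>l\<in>{..<m}. if l < k then v else b l)
    = (\<Sum>g\<in>{..<k} \<rightarrow>\<^sub>E I. (\<Prod>l<k. t (g l)) *\<^sub>C A (\<lambda>l\<in>{..<m}. if l < k then w (g l) else b l))"
    if "k \<le> m" "\<And>l. l < m \<Longrightarrow> b l \<in> vecs X" for k b
    using that
  proof (induction k arbitrary: b)
    case 0
    then show ?case by simp
  next
    case (Suc k)
    let ?B = "\<lambda>g. \<lambda>l\<in>{..<m}. if l < k then w (g l) else b l"
    have "A (\<lambda>l\<in>{..<m}. if l < Suc k then v else b l)
        = A (\<lambda>l\<in>{..<m}. if l < k then v else (b(k := v)) l)"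
      by (intro arg_cong[of _ _ A]) (auto simp: restrict_def less_Suc_eq)
    also have "\<dots> = (\<Sum>g\<in>{..<k} \<rightarrow>\<^sub>E I. (\<Prod>l<k. t (g l)) *\<^sub>C
        A (\<lambda>l\<in>{..<m}. if l < k then w (g l) else (b(k := v)) l))"
      using Suc.prems v by (intro Suc.IH) auto
    also have "\<dots> = (\<Sum>g\<in>{..<k} \<rightarrow>\<^sub>E I. \<Sum>i\<in>I. ((\<Prod>l<k. t (g l)) * t i) *\<^sub>C A ((?B g)(k := w i)))"
    proof (intro sum.cong refl)
      fix g assume g: "g \<in> {..<k} \<rightarrow>\<^sub>E I"
      have "(\<lambda>l\<in>{..<m}. if l < k then w (g l) else (b(k := v)) l) = (?B g)(k := v)"
        using Suc.prems by (auto simp: restrict_def fun_eq_iff)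
      moreover have "?B g \<in> {..<m} \<rightarrow>\<^sub>E vecs X" using g Suc.prems w by (auto simp: PiE_iff)
      ultimately have "A (\<lambda>l\<in>{..<m}. if l < k then w (g l) else (b(k := v)) l)
          = (\<Sum>i\<in>I. t i *\<^sub>C A ((?B g)(k := w i)))"
        unfolding v_def using Suc.prems by (simp only:) (intro multilinear_sum[OF A X] w I; simp)
      then show "(\<Prod>l<k. t (g l)) *\<^sub>C A (\<lambda>l\<in>{..<m}. if l < k then w (g l) else (b(k := v)) l)
          = (\<Sum>i\<in>I. ((\<Prod>l<k. t (g l)) * t i) *\<^sub>C A ((?B g)(k := w i)))"
        by (simp only: complex_vector.scale_sum_right complex_vector.scale_scale)
    qed
    also have "\<dots> = (\<Sum>i\<in>I. \<Sum>g\<in>{..<k} \<rightarrow>\<^sub>E I. ((\<Prod>l<k. t (g l)) * t i) *\<^sub>C A ((?B g)(k := w i)))"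
      by (rule sum.swap)
    also have "\<dots> = (\<Sum>(i, g)\<in>I \<times> ({..<k} \<rightarrow>\<^sub>E I). ((\<Prod>l<k. t (g l)) * t i) *\<^sub>C A ((?B g)(k := w i)))"
      by (rule sum.cartesian_product)
    also have "\<dots> = (\<Sum>p\<in>I \<times> ({..<k} \<rightarrow>\<^sub>E I). (\<lambda>g. (\<Prod>l<Suc k. t (g l)) *\<^sub>C
        A (\<lambda>l\<in>{..<m}. if l < Suc k then w (g l) else b l)) ((\<lambda>(i, g). g(k := i)) p))"
    proof (intro sum.cong refl, clarify)
      fix i g assume "i \<in> I" "g \<in> {..<k} \<rightarrow>\<^sub>E I"
      have "(\<lambda>l\<in>{..<m}. if l < Suc k then w ((g(k := i)) l) else b l) = (?B g)(k := w i)"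
        using Suc.prems by (auto simp: restrict_def fun_eq_iff less_Suc_eq)
      then show "((\<Prod>l<k. t (g l)) * t i) *\<^sub>C A ((?B g)(k := w i)) =
          (\<Prod>l<Suc k. t ((g(k := i)) l)) *\<^sub>C
          A (\<lambda>l\<in>{..<m}. if l < Suc k then w ((g(k := i)) l) else b l)"
        by (simp add: lessThan_Suc)
    qed
    also have "\<dots> = (\<Sum>g\<in>(\<lambda>(i, g). g(k := i)) ` (I \<times> ({..<k} \<rightarrow>\<^sub>E I)). (\<Prod>l<Suc k. t (g l)) *\<^sub>C
        A (\<lambda>l\<in>{..<m}. if l < Suc k then w (g l) else b l))"
      using inj_combinator[of k "{..<k}" "\<lambda>_. I"] by (subst sum.reindex) auto
    also have "(\<lambda>(i, g). g(k := i)) ` (I \<times> ({..<k} \<rightarrow>\<^sub>E I)) = {..<Suc k} \<rightarrow>\<^sub>E I"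
      using PiE_insert_eq[of k "{..<k}" "\<lambda>_. I"] by (simp add: lessThan_Suc)
    finally show ?case .
  qed
  have r: "(\<lambda>l\<in>{..<m}. if l < m then u l else z) = (\<lambda>l\<in>{..<m}. u l)" for u :: "nat \<Rightarrow> 'a" and z
    by (auto simp: restrict_def)
  show ?thesis
    using step[of m "\<lambda>_. v"] v unfolding r by (simp add: v_def)
qed

text \<open>If \<open>T \<noteq> S\<close>, adding or removing a fixed \<open>i \<in> S - T\<close> pairs the sets \<open>R\<close> with opposite signs.\<close>

lemma alternating_sum_supersets:
  assumes "finite S" "T \<subseteq> S"
  shows "(\<Sum>R | T \<subseteq> R \<and> R \<subseteq> S. (- 1) ^ card (S - R)) = (if T = S then 1 else 0 :: complex)"
proof (cases "T = S")
  case True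
  then have "{R. T \<subseteq> R \<and> R \<subseteq> S} = {S}" by auto
  then show ?thesis using True by simp
next
  case False
  then obtain i where i: "i \<in> S" "i \<notin> T" using assms by auto
  define flip where "flip R = (if i \<in> R then R - {i} else insert i R)" for R
  have "(\<Sum>R | T \<subseteq> R \<and> R \<subseteq> S. (- 1) ^ card (S - R)) =
      (\<Sum>R | T \<subseteq> R \<and> R \<subseteq> S. - ((- 1) ^ card (S - R)) :: complex)"
  proof (rule sum.reindex_bij_witness[of _ flip flip])
    fix R assume R: "R \<in> {R. T \<subseteq> R \<and> R \<subseteq> S}"
    show "flip (flip R) = R" "flip (flip R) = R" by (auto simp: flip_def)
    show "flip R \<in> {R. T \<subseteq> R \<and> R \<subseteq> S}" "flip R \<in> {R. T \<subseteq> R \<and> R \<subseteq> S}"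
      using R i by (auto simp: flip_def)
    show "- ((- 1) ^ card (S - flip R)) = (- 1 :: complex) ^ card (S - R)"
    proof (cases "i \<in> R")
      case True
      then have "S - flip R = insert i (S - R)" using i by (auto simp: flip_def)
      then show ?thesis using True assms by simp
    next
      case False
      then have "S - R = insert i (S - flip R)" "i \<notin> S - flip R" using i by (auto simp: flip_def)
      then show ?thesis using assms by simp
    qed
  qed
  then show ?thesis using False by (simp add: sum_negf)
qed

text \<open>The symmetrization of \<open>A\<close> is recovered from the values of \<open>P\<close>: expanding \<open>P\<close> at all partial sums
  with alternating signs, the choice functions that miss some index cancel by inclusion-exclusion.\<close>

lemma polarization:
  assumes A: "multilinear m X Y A" and X: "normed_subspace X"
    and P: "\<And>x. x \<in> vecs X \<Longrightarrow> P x = A (\<lambda>l\<in>{..<m}. x)"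
    and a: "\<And>i. i < m \<Longrightarrow> a i \<in> vecs X"
  shows "(\<Sum>S\<in>Pow {..<m}. (- 1) ^ card ({..<m} - S) *\<^sub>C P (\<Sum>i\<in>S. a i))
    = (\<Sum>g | g \<in> {..<m} \<rightarrow>\<^sub>E {..<m} \<and> g ` {..<m} = {..<m}. A (\<lambda>l\<in>{..<m}. a (g l)))"
proof -
  let ?G = "{..<m} \<rightarrow>\<^sub>E {..<m}"
  have fin: "finite ?G" by (intro finite_PiE) auto
  have "(\<Sum>S\<in>Pow {..<m}. (- 1) ^ card ({..<m} - S) *\<^sub>C P (\<Sum>i\<in>S. a i))
    = (\<Sum>S\<in>Pow {..<m}. \<Sum>g | g \<in> ?G \<and> g ` {..<m} \<subseteq> S.
        (- 1) ^ card ({..<m} - S) *\<^sub>C A (\<lambda>l\<in>{..<m}. a (g l)))"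
  proof (intro sum.cong refl)
    fix S assume S: "S \<in> Pow {..<m}"
    have "P (\<Sum>i\<in>S. a i) = A (\<lambda>l\<in>{..<m}. \<Sum>i\<in>S. 1 *\<^sub>C a i)"
      using S a by (simp add: P vecs_sum[OF X] subset_eq)
    also have "\<dots> = (\<Sum>g\<in>{..<m} \<rightarrow>\<^sub>E S. (\<Prod>l<m. 1) *\<^sub>C A (\<lambda>l\<in>{..<m}. a (g l)))"
      using S a by (intro multilinear_expand[OF A X]) (auto intro: finite_subset)
    also have "{..<m} \<rightarrow>\<^sub>E S = {g \<in> ?G. g ` {..<m} \<subseteq> S}"
      using S by (simp add: set_eq_iff PiE_iff image_subset_iff subset_eq) blast
    finally show "(- 1) ^ card ({..<m} - S) *\<^sub>C P (\<Sum>i\<in>S. a i) = (\<Sum>g | g \<in> ?G \<and> g ` {..<m} \<subseteq> S.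
        (- 1) ^ card ({..<m} - S) *\<^sub>C A (\<lambda>l\<in>{..<m}. a (g l)))"
      by (simp only: complex_vector.scale_sum_right prod.neutral_const complex_vector.scale_one)
  qed
  also have "\<dots> = (\<Sum>g\<in>?G. \<Sum>S | S \<in> Pow {..<m} \<and> g ` {..<m} \<subseteq> S.
        (- 1) ^ card ({..<m} - S) *\<^sub>C A (\<lambda>l\<in>{..<m}. a (g l)))"
    using fin by (intro sum.swap_restrict) auto
  also have "\<dots> = (\<Sum>g\<in>?G. if g ` {..<m} = {..<m} then A (\<lambda>l\<in>{..<m}. a (g l)) else 0)"
  proof (intro sum.cong refl)
    fix g assume "g \<in> ?G"
    then have "g ` {..<m} \<subseteq> {..<m}" by auto
    from alternating_sum_supersets[OF _ this]
    have "(\<Sum>S | S \<in> Pow {..<m} \<and> g ` {..<m} \<subseteq> S. (- 1) ^ card ({..<m} - S))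
        = (if g ` {..<m} = {..<m} then 1 else 0 :: complex)" by (simp add: conj_commute)
    then show "(\<Sum>S | S \<in> Pow {..<m} \<and> g ` {..<m} \<subseteq> S.
        (- 1) ^ card ({..<m} - S) *\<^sub>C A (\<lambda>l\<in>{..<m}. a (g l)))
      = (if g ` {..<m} = {..<m} then A (\<lambda>l\<in>{..<m}. a (g l)) else 0)"
      by (simp only: complex_vector.scale_sum_left[symmetric]) simp
  qed
  also have "\<dots> = (\<Sum>g | g \<in> ?G \<and> g ` {..<m} = {..<m}. A (\<lambda>l\<in>{..<m}. a (g l)))"
    using fin by (simp add: sum.inter_filter)
  finally show ?thesis .
qed

text \<open>A multilinear map that represents \<open>P\<close> need not map the smaller space \<open>X'\<close> into \<open>Y'\<close>, since its
  non-symmetric part is invisible to \<open>P\<close>. Its symmetrization does, because polarization expresses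
  it by values of \<open>P\<close> on \<open>X'\<close>.\<close>

lemma homogeneous_polynomial_restrict:
  assumes P: "homogeneous_polynomial m X Y P" and X: "normed_subspace X"
    and X': "normed_subspace X'" and sub: "vecs X' \<subseteq> vecs X"
    and Y': "normed_subspace Y'" and PX': "\<And>x. x \<in> vecs X' \<Longrightarrow> P x \<in> vecs Y'"
  shows "homogeneous_polynomial m X' Y' P"
proof -
  obtain A where A: "multilinear m X Y A" and PA: "\<And>x. x \<in> vecs X \<Longrightarrow> P x = A (\<lambda>l\<in>{..<m}. x)"
    using P by (auto simp: homogeneous_polynomial_def)
  define G where "G = {g. g \<in> {..<m} \<rightarrow>\<^sub>E {..<m} \<and> g ` {..<m} = {..<m}}"
  have "G \<subseteq> {..<m} \<rightarrow>\<^sub>E {..<m}" by (auto simp: G_def)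
  then have finG: "finite G" by (rule finite_subset) (intro finite_PiE; simp)
  have "(\<lambda>l\<in>{..<m}. l) \<in> G" by (auto simp: G_def)
  then have cG: "card G \<noteq> 0" using finG by auto
  define B where "B a = inverse (of_nat (card G)) *\<^sub>C (\<Sum>g\<in>G. A (\<lambda>l\<in>{..<m}. a (g l)))" for a
  \<comment> \<open>A surjection of \<open>{..<m}\<close> is a permutation, so it moves slot \<open>i\<close> to a unique slot \<open>j\<close>.\<close>
  have slot: "\<exists>j<m. \<exists>b\<in>{..<m} \<rightarrow>\<^sub>E vecs X. \<forall>x. (\<lambda>l\<in>{..<m}. (a(i := x)) (g l)) = b(j := x)"
    if g: "g \<in> G" and i: "i < m" and a: "a \<in> {..<m} \<rightarrow>\<^sub>E vecs X'" for g a i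
  proof -
    have img: "g ` {..<m} = {..<m}" using g by (simp add: G_def)
    then have inj: "inj_on g {..<m}" by (intro eq_card_imp_inj_on) auto
    obtain j where j: "j < m" "g j = i" using img i by (metis imageE lessThan_iff)
    have "g l = i \<longleftrightarrow> l = j" if "l < m" for l
      using inj that j by (auto simp: inj_on_def)
    then have "(\<lambda>l\<in>{..<m}. (a(i := x)) (g l)) = (\<lambda>l\<in>{..<m}. a (g l))(j := x)" for x
      using j by (auto simp: restrict_def fun_eq_iff)
    moreover have "(\<lambda>l\<in>{..<m}. a (g l)) \<in> {..<m} \<rightarrow>\<^sub>E vecs X"
      using a sub img by (auto simp: PiE_iff)
    ultimately show ?thesis using j by blast
  qed
  have "multilinear m X' Y' B"
    unfolding multilinear_def
  proof (intro conjI ballI allI impI)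
    show "B \<in> ({..<m} \<rightarrow>\<^sub>E vecs X') \<rightarrow> vecs Y'"
    proof
      fix a assume a: "a \<in> {..<m} \<rightarrow>\<^sub>E vecs X'"
      have "(\<Sum>S\<in>Pow {..<m}. (- 1) ^ card ({..<m} - S) *\<^sub>C P (\<Sum>i\<in>S. a i))
          = (\<Sum>g\<in>G. A (\<lambda>l\<in>{..<m}. a (g l)))"
        unfolding G_def using a sub by (intro polarization[OF A X PA]) auto
      moreover have "(\<Sum>S\<in>Pow {..<m}. (- 1) ^ card ({..<m} - S) *\<^sub>C P (\<Sum>i\<in>S. a i)) \<in> vecs Y'"
        using a by (intro vecs_sum[OF Y'] vecs_scale[OF Y'] PX' vecs_sum[OF X']) auto
      ultimately show "B a \<in> vecs Y'"
        unfolding B_def by (intro vecs_scale[OF Y']) simp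
    qed
  next
    fix a i x y assume a: "a \<in> {..<m} \<rightarrow>\<^sub>E vecs X'" and i: "i < m" and x: "x \<in> vecs X'" "y \<in> vecs X'"
    have "A (\<lambda>l\<in>{..<m}. (a(i := x + y)) (g l))
        = A (\<lambda>l\<in>{..<m}. (a(i := x)) (g l)) + A (\<lambda>l\<in>{..<m}. (a(i := y)) (g l))" if g: "g \<in> G" for g
    proof -
      obtain j b where "j < m" "b \<in> {..<m} \<rightarrow>\<^sub>E vecs X"
        and eq: "\<And>x. (\<lambda>l\<in>{..<m}. (a(i := x)) (g l)) = b(j := x)"
        using slot[OF g i a] by blast
      then show ?thesis using A x sub unfolding multilinear_def eq by blast
    qed
    then show "B (a(i := x + y)) = B (a(i := x)) + B (a(i := y))"
      by (simp add: B_def sum.distrib complex_vector.scale_right_distrib)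
  next
    fix a i c x assume a: "a \<in> {..<m} \<rightarrow>\<^sub>E vecs X'" and i: "i < m" and x: "x \<in> vecs X'"
    have "A (\<lambda>l\<in>{..<m}. (a(i := c *\<^sub>C x)) (g l)) = c *\<^sub>C A (\<lambda>l\<in>{..<m}. (a(i := x)) (g l))"
      if g: "g \<in> G" for g
    proof -
      obtain j b where "j < m" "b \<in> {..<m} \<rightarrow>\<^sub>E vecs X"
        and eq: "\<And>x. (\<lambda>l\<in>{..<m}. (a(i := x)) (g l)) = b(j := x)"
        using slot[OF g i a] by blast
      then show ?thesis using A x sub unfolding multilinear_def eq by blast
    qed
    then show "B (a(i := c *\<^sub>C x)) = c *\<^sub>C B (a(i := x))"
      by (simp add: B_def complex_vector.scale_sum_right mult.commute)
  qed
  moreover have "P x = B (\<lambda>l\<in>{..<m}. x)" if x: "x \<in> vecs X'" for x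
  proof -
    have "A (\<lambda>l\<in>{..<m}. (\<lambda>l\<in>{..<m}. x) (g l)) = P x" if "g \<in> G" for g
    proof -
      have "(\<lambda>l\<in>{..<m}. (\<lambda>l\<in>{..<m}. x) (g l)) = (\<lambda>l\<in>{..<m}. x)"
        using that by (auto simp: G_def restrict_def fun_eq_iff PiE_iff)
      then show ?thesis using PA x sub by auto
    qed
    then have "B (\<lambda>l\<in>{..<m}. x) = inverse (of_nat (card G)) *\<^sub>C (\<Sum>g\<in>G. 1 *\<^sub>C P x)"
      by (simp add: B_def)
    also have "\<dots> = P x"
      using cG by (simp only: complex_vector.scale_sum_left[symmetric]) simp
    finally show ?thesis by simp
  qed
  ultimately show ?thesis unfolding homogeneous_polynomial_def by blast
qed

lemma homogeneous_polynomial_in: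
  assumes "homogeneous_polynomial m X Y P" "x \<in> vecs X"
  shows "P x \<in> vecs Y"
proof -
  obtain A where A: "multilinear m X Y A" and PA: "\<And>x. x \<in> vecs X \<Longrightarrow> P x = A (\<lambda>l\<in>{..<m}. x)"
    using assms(1) by (auto simp: homogeneous_polynomial_def)
  have "(\<lambda>l\<in>{..<m}. x) \<in> {..<m} \<rightarrow>\<^sub>E vecs X" using assms(2) by auto
  from multilinear_in[OF A this] show ?thesis using PA assms(2) by simp
qed

lemma homogeneous_polynomial_scale:
  assumes P: "homogeneous_polynomial m X Y P" and X: "normed_subspace X" and x: "x \<in> vecs X"
  shows "P (c *\<^sub>C x) = c ^ m *\<^sub>C P x"
proof -
  obtain A where A: "multilinear m X Y A" and PA: "\<And>x. x \<in> vecs X \<Longrightarrow> P x = A (\<lambda>l\<in>{..<m}. x)"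
    using P by (auto simp: homogeneous_polynomial_def)
  have "P (c *\<^sub>C x) = A (\<lambda>l\<in>{..<m}. \<Sum>i\<in>{()}. c *\<^sub>C x)" using x by (simp add: PA vecs_scale X)
  also have "\<dots> = (\<Sum>g\<in>{..<m} \<rightarrow>\<^sub>E {()}. (\<Prod>l<m. c) *\<^sub>C A (\<lambda>l\<in>{..<m}. x))"
    using x by (intro multilinear_expand[OF A X]) auto
  also have "\<dots> = c ^ m *\<^sub>C P x" using x by (simp add: PA PiE_singleton)
  finally show ?thesis .
qed

lemma homogeneous_polynomial_line:
  assumes P: "homogeneous_polynomial m X Y P" and X: "normed_subspace X" and Y: "normed_subspace Y"
    and x: "u \<in> vecs X" "v \<in> vecs X"
  shows "\<exists>d. (\<forall>k. d k \<in> vecs Y) \<and> (\<forall>n>m. \<forall>l. P (u + l *\<^sub>C v) = vpoly d n l)"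
proof -
  obtain A where A: "multilinear m X Y A" and PA: "\<And>x. x \<in> vecs X \<Longrightarrow> P x = A (\<lambda>l\<in>{..<m}. x)"
    using P by (auto simp: homogeneous_polynomial_def)
  define w where "w i = (if i = 0 then u else v)" for i :: nat
  define G where "G = ({..<m} \<rightarrow>\<^sub>E {0, 1::nat})"
  define E where "E g = (\<Sum>l<m. g l)" for g :: "nat \<Rightarrow> nat"
  have w: "w i \<in> vecs X" for i using x by (simp add: w_def)
  have Ain: "A (\<lambda>l\<in>{..<m}. w (g l)) \<in> vecs Y" for g :: "nat \<Rightarrow> nat"
    using w by (intro multilinear_in[OF A]) auto
  have finG: "finite G" unfolding G_def by (intro finite_PiE) auto
  have E: "E g \<le> m" if "g \<in> G" for g
  proof -
    have "E g \<le> (\<Sum>l<m. 1)" unfolding E_def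
    proof (rule sum_mono)
      fix l assume "l \<in> {..<m}"
      then have "g l \<in> {0, 1}" using that unfolding G_def by (meson PiE_mem)
      then show "g l \<le> 1" by auto
    qed
    then show ?thesis by simp
  qed
  define d where "d k = (\<Sum>g | g \<in> G \<and> E g = k. A (\<lambda>l\<in>{..<m}. w (g l)))" for k
  have "P (u + l *\<^sub>C v) = vpoly d n l" if n: "n > m" for l n
  proof -
    have "P (u + l *\<^sub>C v) = A (\<lambda>j\<in>{..<m}. \<Sum>i\<in>{0,1::nat}. l ^ i *\<^sub>C w i)"
      using x by (simp add: PA vecs_closed X w_def)
    also have "\<dots> = (\<Sum>g\<in>G. (\<Prod>j<m. l ^ g j) *\<^sub>C A (\<lambda>j\<in>{..<m}. w (g j)))"
      unfolding G_def using w by (intro multilinear_expand[OF A X]) auto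
    also have "\<dots> = (\<Sum>g\<in>G. l ^ E g *\<^sub>C A (\<lambda>j\<in>{..<m}. w (g j)))"
      by (simp add: E_def power_sum)
    also have "\<dots> = (\<Sum>k<n. \<Sum>g | g \<in> G \<and> E g = k. l ^ E g *\<^sub>C A (\<lambda>j\<in>{..<m}. w (g j)))"
      using E n by (intro sum.group[symmetric] finG) (auto intro: le_less_trans)
    also have "\<dots> = vpoly d n l"
      by (simp add: d_def complex_vector.scale_sum_right)
    finally show ?thesis .
  qed
  moreover have "d k \<in> vecs Y" for k unfolding d_def using Ain by (intro vecs_sum Y)
  ultimately show ?thesis by blast
qed

text \<open>For homogeneous polynomials this is equivalent to continuity, and it is the form in which
  continuity is used and established.\<close>

definition bounded_near_0 :: "'v::complex_vector nspace \<Rightarrow> 'w::complex_vector nspace \<Rightarrow> ('v \<Rightarrow> 'w) \<Rightarrow> bool" where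
  "bounded_near_0 X Y P \<longleftrightarrow> (\<exists>r>0. \<exists>C. \<forall>x\<in>vecs X. nrm X x < r \<longrightarrow> nrm Y (P x) \<le> C)"

lemma homogeneous_polynomial_bounded:
  assumes P: "homogeneous_polynomial m X Y P" and X: "normed_subspace X" and Y: "normed_subspace Y"
    and b: "bounded_near_0 X Y P"
  shows "\<exists>C\<ge>0. \<forall>x\<in>vecs X. nrm X x \<le> R \<longrightarrow> nrm Y (P x) \<le> C"
proof -
  obtain r C where r: "r > 0" and C: "\<And>x. x \<in> vecs X \<Longrightarrow> nrm X x < r \<Longrightarrow> nrm Y (P x) \<le> C"
    using b by (auto simp: bounded_near_0_def)
  have C0: "C \<ge> 0"
    using C[of 0] nrm_nonneg[OF Y homogeneous_polynomial_in[OF P vecs_0[OF X]]] r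
    by (simp add: vecs_0 nrm_0 X)
  define s where "s = (\<bar>R\<bar> + 1) / r"
  have s: "s > 0" using r by (simp add: s_def)
  have "nrm Y (P x) \<le> s ^ m * C" if x: "x \<in> vecs X" "nrm X x \<le> R" for x
  proof -
    define y where "y = of_real (inverse s) *\<^sub>C x"
    have y: "y \<in> vecs X" using x by (simp add: y_def vecs_scale X)
    have "nrm X y = nrm X x / s" using x s by (simp add: y_def nrm_scale X divide_inverse mult.commute norm_inverse)
    also have "\<dots> < r"
    proof -
      have "nrm X x < \<bar>R\<bar> + 1" "\<bar>R\<bar> + 1 > 0" using x by linarith+
      then show ?thesis using r by (simp add: s_def divide_less_eq mult.commute)
    qed
    finally have yr: "nrm X y < r" .
    have "x = of_real s *\<^sub>C y" using s by (simp add: y_def flip: of_real_mult)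
    then have "P x = of_real s ^ m *\<^sub>C P y" using homogeneous_polynomial_scale[OF P X y] by metis
    then have "nrm Y (P x) = s ^ m * nrm Y (P y)"
      using s homogeneous_polynomial_in[OF P y] by (simp add: nrm_scale Y norm_power)
    also have "\<dots> \<le> s ^ m * C" using s C[OF y yr] by (intro mult_left_mono) auto
    finally show ?thesis .
  qed
  then show ?thesis using s C0 by (intro exI[of _ "s ^ m * C"]) auto
qed

text \<open>Along a line the polynomial has degree at most \<open>m\<close>; Cauchy's estimate on the large
  circle \<open>\<bar>l\<bar> = 1 / \<parallel>v\<parallel>\<close> makes every non-constant coefficient of order \<open>\<parallel>v\<parallel>\<close>.\<close>

lemma homogeneous_polynomial_Lipschitz:
  assumes P: "homogeneous_polynomial m X Y P" and X: "normed_subspace X" and Y: "normed_subspace Y"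
    and b: "bounded_near_0 X Y P"
  shows "\<exists>L\<ge>0. \<forall>u\<in>vecs X. \<forall>v\<in>vecs X. nrm X u \<le> R \<longrightarrow> nrm X v \<le> 1 \<longrightarrow>
    nrm Y (P (u + v) - P u) \<le> L * nrm X v"
proof -
  obtain C where C0: "C \<ge> 0" and C: "\<And>x. x \<in> vecs X \<Longrightarrow> nrm X x \<le> R + 1 \<Longrightarrow> nrm Y (P x) \<le> C"
    using homogeneous_polynomial_bounded[OF P X Y b, of "R + 1"] by blast
  have "nrm Y (P (u + v) - P u) \<le> (real m * C) * nrm X v"
    if u: "u \<in> vecs X" "v \<in> vecs X" "nrm X u \<le> R" "nrm X v \<le> 1" for u v
  proof (cases "v = 0")
    case True
    then show ?thesis by (simp add: nrm_0 X Y)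
  next
    case False
    then have pos: "nrm X v > 0" using u nrm_nonneg[OF X, of v] nrm_eq_0[OF X, of v] by linarith
    define r where "r = 1 / nrm X v"
    have r: "r \<ge> 1" "r > 0" using pos u by (auto simp: r_def)
    obtain d where d: "\<And>k. d k \<in> vecs Y"
      and Pd: "\<And>l. P (u + l *\<^sub>C v) = (\<Sum>k<Suc m. l ^ k *\<^sub>C d k)"
      using homogeneous_polynomial_line[OF P X Y u(1,2)] by (metis lessI)
    have est: "nrm Y (d k) \<le> C * nrm X v" if k: "k < Suc m" "k \<ge> 1" for k
    proof -
      have "nrm Y (d k) * r ^ k \<le> C"
      proof (rule cauchy_estimate_polynomial[OF Y _ _ _ k(1)])
        fix l assume l: "cmod l = r"
        have "nrm X (u + l *\<^sub>C v) \<le> nrm X u + nrm X (l *\<^sub>C v)"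
          using u by (intro nrm_triangle X vecs_scale)
        also have "\<dots> \<le> R + 1" using u l pos by (simp add: nrm_scale X r_def)
        finally show "nrm Y (\<Sum>k<Suc m. l ^ k *\<^sub>C d k) \<le> C"
          unfolding Pd[symmetric] using u by (intro C vecs_add vecs_scale X)
      qed (use d r in auto)
      moreover have "nrm Y (d k) * r \<le> nrm Y (d k) * r ^ k"
        using r k d self_le_power[of r k] by (intro mult_left_mono nrm_nonneg Y) auto
      ultimately have "nrm Y (d k) * r \<le> C" by linarith
      then show ?thesis using pos by (simp add: r_def divide_simps)
    qed
    have "P u = d 0"
      using Pd[of 0] by (simp add: sum.lessThan_Suc_shift del: sum.lessThan_Suc)
    moreover have "P (u + v) = (\<Sum>k<Suc m. d k)"
      using Pd[of 1] by (simp del: sum.lessThan_Suc)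
    ultimately have "P (u + v) - P u = (\<Sum>k<Suc m. d k) - d 0" by simp
    also have "\<dots> = (\<Sum>k=1..m. d k)"
    proof -
      have "{..<Suc m} = insert 0 {1..m}" by auto
      then show ?thesis by simp
    qed
    finally have "nrm Y (P (u + v) - P u) \<le> (\<Sum>k=1..m. nrm Y (d k))"
      using d by (simp add: nrm_sum_le Y)
    also have "\<dots> \<le> (\<Sum>k=1..m. C * nrm X v)" using est by (intro sum_mono) auto
    finally show ?thesis by simp
  qed
  then show ?thesis using C0 by (intro exI[of _ "real m * C"]) auto
qed

lemma continuous_map_homogeneous_polynomial_iff:
  assumes P: "homogeneous_polynomial m X Y P" and X: "normed_subspace X" and Y: "normed_subspace Y"
  shows "continuous_map (nrm_topology X) (nrm_topology Y) P \<longleftrightarrow> bounded_near_0 X Y P"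
proof
  assume "continuous_map (nrm_topology X) (nrm_topology Y) P"
  then obtain d where d: "d > 0" "\<And>y. y \<in> vecs X \<Longrightarrow> nrm X (y - 0) < d \<Longrightarrow> nrm Y (P y - P 0) < 1"
    unfolding continuous_map_nrm_iff[OF X Y] using vecs_0[OF X] by (meson zero_less_one)
  have "nrm Y (P y) \<le> nrm Y (P 0) + 1" if "y \<in> vecs X" "nrm X y < d" for y
    using nrm_diff_le[OF Y, of "P y" "P 0"] homogeneous_polynomial_in[OF P] that d(2)[of y] vecs_0[OF X]
    by fastforce
  then show "bounded_near_0 X Y P" using d(1) by (auto simp: bounded_near_0_def)
next
  assume b: "bounded_near_0 X Y P"
  have "\<exists>d>0. \<forall>y\<in>vecs X. nrm X (y - x) < d \<longrightarrow> nrm Y (P y - P x) < e" if x: "x \<in> vecs X" and e: "e > 0" for x e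
  proof -
    obtain L where L: "L \<ge> 0" "\<And>v. v \<in> vecs X \<Longrightarrow> nrm X v \<le> 1 \<Longrightarrow> nrm Y (P (x + v) - P x) \<le> L * nrm X v"
      using homogeneous_polynomial_Lipschitz[OF P X Y b, of "nrm X x"] x by blast
    have "nrm Y (P y - P x) < e" if y: "y \<in> vecs X" "nrm X (y - x) < min 1 (e / (L + 1))" for y
    proof -
      have v: "y - x \<in> vecs X" using x y by (intro vecs_diff X)
      have "nrm Y (P y - P x) \<le> L * nrm X (y - x)" using L(2)[OF v] y by simp
      also have "\<dots> \<le> (L + 1) * nrm X (y - x)" using nrm_nonneg[OF X v] by (intro mult_right_mono) auto
      also have "\<dots> < e" using y L by (simp add: field_simps)
      finally show ?thesis .
    qed
    then show ?thesis using L e by (intro exI[of _ "min 1 (e / (L + 1))"]) auto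
  qed
  then show "continuous_map (nrm_topology X) (nrm_topology Y) P"
    unfolding continuous_map_nrm_iff[OF X Y] using homogeneous_polynomial_in[OF P] by blast
qed

section \<open>Taylor expansions of holomorphic functions\<close>

definition taylor_expansion ::
    "'v::complex_vector nspace \<Rightarrow> 'w::complex_vector nspace \<Rightarrow> ('v \<Rightarrow> 'w) \<Rightarrow> 'v \<Rightarrow>
      (nat \<Rightarrow> 'v \<Rightarrow> 'w) \<Rightarrow> real \<Rightarrow> bool" where
  "taylor_expansion X Y f x P s \<longleftrightarrow> s > 0 \<and>
     (\<forall>m. homogeneous_polynomial m X Y (P m) \<and> bounded_near_0 X Y (P m)) \<and>
     (\<forall>e>0. \<exists>N. \<forall>n\<ge>N. \<forall>v\<in>vecs X. nrm X v < s \<longrightarrow> nrm Y (f (x + v) - (\<Sum>m<n. P m v)) < e)"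

text \<open>The choice is harmless: on \<open>vecs X\<close> the polynomials are determined by \<open>f\<close> and \<open>x\<close>, because
  restricting an expansion to a complex line gives a power series.\<close>

definition taylor ::
    "'v::complex_vector nspace \<Rightarrow> 'w::complex_vector nspace \<Rightarrow> ('v \<Rightarrow> 'w) \<Rightarrow> 'v \<Rightarrow> nat \<Rightarrow> 'v \<Rightarrow> 'w" where
  "taylor X Y f x = (SOME P. \<exists>s. taylor_expansion X Y f x P s)"

lemma nholomorphic_in: "nholomorphic X Y f \<Longrightarrow> x \<in> vecs X \<Longrightarrow> f x \<in> vecs Y"
  by (auto simp: nholomorphic_on_def)

lemma taylor_expansion_taylor:
  assumes f: "nholomorphic X Y f" and X: "normed_subspace X" and Y: "normed_subspace Y"
    and x: "x \<in> vecs X"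
  shows "\<exists>s. taylor_expansion X Y f x (taylor X Y f x) s"
proof -
  obtain r P where P: "\<forall>m. homogeneous_polynomial m X Y (P m) \<and>
      continuous_map (nrm_topology X) (nrm_topology Y) (P m)"
    and s: "\<exists>s>0. s \<le> r \<and> (\<forall>e>0. \<exists>N. \<forall>n\<ge>N. \<forall>y\<in>vecs X. nrm X (y - x) < s \<longrightarrow>
              nrm Y ((\<Sum>m<n. P m (y - x)) - f y) < e)"
    using f x unfolding nholomorphic_on_def by blast
  obtain s where s0: "s > 0" and unif: "\<forall>e>0. \<exists>N. \<forall>n\<ge>N. \<forall>y\<in>vecs X. nrm X (y - x) < s \<longrightarrow>
              nrm Y ((\<Sum>m<n. P m (y - x)) - f y) < e"
    using s by blast
  have "taylor_expansion X Y f x P s"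
    unfolding taylor_expansion_def
  proof (intro conjI allI impI)
    show "s > 0" by fact
    show "homogeneous_polynomial m X Y (P m)" for m using P by blast
    then show "bounded_near_0 X Y (P m)" for m
      using P continuous_map_homogeneous_polynomial_iff[OF _ X Y] by blast
    fix e :: real assume "e > 0"
    then obtain N where N: "\<forall>n\<ge>N. \<forall>y\<in>vecs X. nrm X (y - x) < s \<longrightarrow>
              nrm Y ((\<Sum>m<n. P m (y - x)) - f y) < e"
      using unif by blast
    have "nrm Y (f (x + v) - (\<Sum>m<n. P m v)) < e" if "n \<ge> N" "v \<in> vecs X" "nrm X v < s" for n v
    proof -
      have xv: "x + v \<in> vecs X" using x that by (intro vecs_add X)
      have "P m v \<in> vecs Y" for m using P that homogeneous_polynomial_in by blast
      then have "nrm Y (f (x + v) - (\<Sum>m<n. P m v)) = nrm Y ((\<Sum>m<n. P m v) - f (x + v))"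
        by (intro nrm_minus_commute Y vecs_sum nholomorphic_in[OF f xv])
      then show ?thesis using N[rule_format, OF that(1) xv] that(3) by simp
    qed
    then show "\<exists>N. \<forall>n\<ge>N. \<forall>v\<in>vecs X. nrm X v < s \<longrightarrow> nrm Y (f (x + v) - (\<Sum>m<n. P m v)) < e"
      by blast
  qed
  then have "\<exists>P s. taylor_expansion X Y f x P s" by blast
  then show ?thesis unfolding taylor_def by (rule someI_ex)
qed

lemma taylor_homogeneous_polynomial:
  assumes "nholomorphic X Y f" "normed_subspace X" "normed_subspace Y" "x \<in> vecs X"
  shows "homogeneous_polynomial m X Y (taylor X Y f x m)"
  using taylor_expansion_taylor[OF assms] by (auto simp: taylor_expansion_def)

lemma taylor_in:
  assumes "nholomorphic X Y f" "normed_subspace X" "normed_subspace Y" "x \<in> vecs X" "v \<in> vecs X"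
  shows "taylor X Y f x m v \<in> vecs Y"
  using homogeneous_polynomial_in[OF taylor_homogeneous_polynomial[OF assms(1-4)] assms(5)] .

lemma taylor_expansion_power_series:
  assumes T: "taylor_expansion X Y f x P s" and X: "normed_subspace X" and v: "v \<in> vecs X"
  shows "\<exists>r>0. power_series Y (\<lambda>l. f (x + l *\<^sub>C v)) (\<lambda>m. P m v) r"
proof -
  define r where "r = s / (nrm X v + 1)"
  have nv: "nrm X v + 1 > 0" using nrm_nonneg[OF X v] by simp
  have s: "s > 0" and P: "\<And>m. homogeneous_polynomial m X Y (P m)"
    using T by (auto simp: taylor_expansion_def)
  have r: "r > 0" using s nv by (simp add: r_def)
  have "power_series Y (\<lambda>l. f (x + l *\<^sub>C v)) (\<lambda>m. P m v) r"
    unfolding power_series_def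
  proof (intro conjI allI impI)
    show "P k v \<in> vecs Y" for k using homogeneous_polynomial_in[OF P v] .
    fix e :: real assume "e > 0"
    then obtain N where N: "\<forall>n\<ge>N. \<forall>v\<in>vecs X. nrm X v < s \<longrightarrow> nrm Y (f (x + v) - (\<Sum>m<n. P m v)) < e"
      using T unfolding taylor_expansion_def by blast
    have "nrm Y (f (x + l *\<^sub>C v) - (\<Sum>k<n. l ^ k *\<^sub>C P k v)) < e" if "n \<ge> N" "cmod l < r" for n l
    proof -
      have "nrm X (l *\<^sub>C v) = cmod l * nrm X v" using v by (simp add: nrm_scale X)
      also have "\<dots> \<le> cmod l * (nrm X v + 1)" by (intro mult_left_mono) auto
      also have "\<dots> < s" using that nv by (simp add: r_def field_simps)
      finally have "nrm X (l *\<^sub>C v) < s" .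
      with N that v have "nrm Y (f (x + l *\<^sub>C v) - (\<Sum>m<n. P m (l *\<^sub>C v))) < e"
        by (simp add: vecs_scale X)
      then show ?thesis using homogeneous_polynomial_scale[OF P X v] by simp
    qed
    then show "\<exists>N. \<forall>n\<ge>N. \<forall>l. cmod l < r \<longrightarrow> nrm Y (f (x + l *\<^sub>C v) - (\<Sum>k<n. l ^ k *\<^sub>C P k v)) < e"
      by blast
  qed
  with r show ?thesis by blast
qed

lemma taylor_power_series:
  assumes "nholomorphic X Y f" "normed_subspace X" "normed_subspace Y" "x \<in> vecs X" "v \<in> vecs X"
  shows "\<exists>r>0. power_series Y (\<lambda>l. f (x + l *\<^sub>C v)) (\<lambda>m. taylor X Y f x m v) r"
  using taylor_expansion_taylor[OF assms(1-4)] taylor_expansion_power_series[OF _ assms(2,5)] by blast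

lemma taylor_0:
  assumes f: "nholomorphic X Y f" and XY: "normed_subspace X" "normed_subspace Y"
    and x: "x \<in> vecs X" "v \<in> vecs X"
  shows "taylor X Y f x 0 v = f x"
proof -
  obtain r where "r > 0" "power_series Y (\<lambda>l. f (x + l *\<^sub>C v)) (\<lambda>m. taylor X Y f x m v) r"
    using taylor_power_series[OF assms] by blast
  from power_series_at_0[OF XY(2) this(2,1)] nholomorphic_in[OF f x(1)] show ?thesis by simp
qed

lemma poly_sum_Lipschitz:
  assumes P: "\<And>m. homogeneous_polynomial m X Y (P m)" "\<And>m. bounded_near_0 X Y (P m)"
    and X: "normed_subspace X" and Y: "normed_subspace Y"
  shows "\<exists>L\<ge>0. \<forall>u\<in>vecs X. \<forall>v\<in>vecs X. nrm X u \<le> R \<longrightarrow> nrm X v \<le> 1 \<longrightarrow>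
    nrm Y ((\<Sum>m<n. P m (u + v)) - (\<Sum>m<n. P m u)) \<le> L * nrm X v"
proof -
  have "\<forall>m. \<exists>L\<ge>0. \<forall>u\<in>vecs X. \<forall>v\<in>vecs X. nrm X u \<le> R \<longrightarrow> nrm X v \<le> 1 \<longrightarrow>
    nrm Y (P m (u + v) - P m u) \<le> L * nrm X v"
    using homogeneous_polynomial_Lipschitz[OF P(1) X Y P(2)] by blast
  then obtain L where L: "\<And>m. L m \<ge> 0" "\<And>m u v. u \<in> vecs X \<Longrightarrow> v \<in> vecs X \<Longrightarrow> nrm X u \<le> R \<Longrightarrow>
    nrm X v \<le> 1 \<Longrightarrow> nrm Y (P m (u + v) - P m u) \<le> L m * nrm X v" by metis
  have "nrm Y ((\<Sum>m<n. P m (u + v)) - (\<Sum>m<n. P m u)) \<le> (\<Sum>m<n. L m) * nrm X v"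
    if u: "u \<in> vecs X" "v \<in> vecs X" "nrm X u \<le> R" "nrm X v \<le> 1" for u v
  proof -
    have "nrm Y (\<Sum>m<n. P m (u + v) - P m u) \<le> (\<Sum>m<n. nrm Y (P m (u + v) - P m u))"
      using u by (intro nrm_sum_le Y vecs_diff homogeneous_polynomial_in[OF P(1)] vecs_add X)
    also have "\<dots> \<le> (\<Sum>m<n. L m * nrm X v)" using L u by (intro sum_mono) auto
    finally show ?thesis by (simp add: sum_subtractf sum_distrib_right)
  qed
  then show ?thesis using L by (intro exI[of _ "\<Sum>m<n. L m"]) (auto intro: sum_nonneg)
qed

lemma poly_sum_bounded:
  assumes P: "\<And>m. homogeneous_polynomial m X Y (P m)" "\<And>m. bounded_near_0 X Y (P m)"
    and X: "normed_subspace X" and Y: "normed_subspace Y"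
  shows "\<exists>C. \<forall>u\<in>vecs X. nrm X u \<le> R \<longrightarrow> nrm Y (\<Sum>m<n. P m u) \<le> C"
proof -
  have "\<forall>m. \<exists>C. \<forall>u\<in>vecs X. nrm X u \<le> R \<longrightarrow> nrm Y (P m u) \<le> C"
    using homogeneous_polynomial_bounded[OF P(1) X Y P(2)] by blast
  then obtain C where C: "\<And>m u. u \<in> vecs X \<Longrightarrow> nrm X u \<le> R \<Longrightarrow> nrm Y (P m u) \<le> C m" by metis
  have "nrm Y (\<Sum>m<n. P m u) \<le> (\<Sum>m<n. C m)" if u: "u \<in> vecs X" "nrm X u \<le> R" for u
    using nrm_sum_le[OF Y, of "{..<n}" "\<lambda>m. P m u"] homogeneous_polynomial_in[OF P(1) u(1)]
      sum_mono[of "{..<n}" "\<lambda>m. nrm Y (P m u)" C] C u by fastforce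
  then show ?thesis by blast
qed

context
  fixes X :: "'v::complex_vector nspace" and Y :: "'w::complex_vector nspace" and f x P s
  assumes T: "taylor_expansion X Y f x P s" and X: "normed_subspace X" and Y: "normed_subspace Y"
    and f: "nholomorphic X Y f" and x: "x \<in> vecs X"
begin

lemma taylor_expansionD:
  shows "s > 0" and "homogeneous_polynomial m X Y (P m)" and "bounded_near_0 X Y (P m)"
    and "e > 0 \<Longrightarrow> \<exists>N. \<forall>n\<ge>N. \<forall>v\<in>vecs X. nrm X v < s \<longrightarrow> nrm Y (f (x + v) - (\<Sum>m<n. P m v)) < e"
  using T unfolding taylor_expansion_def by blast+

lemma taylor_expansion_sum_in: "v \<in> vecs X \<Longrightarrow> (\<Sum>m<n. P m v) \<in> vecs Y"
  using homogeneous_polynomial_in[OF taylor_expansionD(2)] by (intro vecs_sum Y)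

lemma taylor_expansion_f_in: "v \<in> vecs X \<Longrightarrow> f (x + v) \<in> vecs Y"
  using x by (intro nholomorphic_in[OF f] vecs_add X)

lemma taylor_expansion_uniformly_continuous:
  assumes e: "e > 0"
  shows "\<exists>d>0. \<forall>u\<in>vecs X. \<forall>w\<in>vecs X. nrm X u < s \<longrightarrow> nrm X w < s \<longrightarrow> nrm X (u - w) < d \<longrightarrow>
    nrm Y (f (x + u) - f (x + w)) < e"
proof -
  have e4: "e / 4 > 0" using e by simp
  obtain n where n: "\<forall>v\<in>vecs X. nrm X v < s \<longrightarrow> nrm Y (f (x + v) - (\<Sum>m<n. P m v)) < e / 4"
    using taylor_expansionD(4)[OF e4] by blast
  obtain L where L: "L \<ge> 0" "\<And>u v. u \<in> vecs X \<Longrightarrow> v \<in> vecs X \<Longrightarrow> nrm X u \<le> s \<Longrightarrow> nrm X v \<le> 1 \<Longrightarrow>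
    nrm Y ((\<Sum>m<n. P m (u + v)) - (\<Sum>m<n. P m u)) \<le> L * nrm X v"
    using poly_sum_Lipschitz[OF taylor_expansionD(2,3) X Y, of s n] by blast
  define d where "d = min 1 (e / (4 * (L + 1)))"
  have d: "d > 0" using e L by (simp add: d_def)
  have "nrm Y (f (x + u) - f (x + w)) < e"
    if u: "u \<in> vecs X" "w \<in> vecs X" "nrm X u < s" "nrm X w < s" "nrm X (u - w) < d" for u w
  proof -
    let ?Q = "\<lambda>u. \<Sum>m<n. P m u"
    note i = taylor_expansion_sum_in taylor_expansion_f_in u
    have "nrm Y (?Q (w + (u - w)) - ?Q w) \<le> L * nrm X (u - w)"
      using u by (intro L vecs_diff X) (auto simp: d_def)
    also have "\<dots> \<le> L * (e / (4 * (L + 1)))"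
      using u L by (intro mult_left_mono) (auto simp: d_def)
    also have "\<dots> \<le> e / 4" using L e by (simp add: field_simps)
    finally have 1: "nrm Y (?Q u - ?Q w) \<le> e / 4" by simp
    have "nrm Y (f (x + u) - f (x + w)) \<le> nrm Y (f (x + u) - ?Q u) + nrm Y (?Q u - f (x + w))"
      by (intro nrm_triangle_sub Y i)
    also have "nrm Y (?Q u - f (x + w)) \<le> nrm Y (?Q u - ?Q w) + nrm Y (?Q w - f (x + w))"
      by (intro nrm_triangle_sub Y i)
    also have "nrm Y (?Q w - f (x + w)) = nrm Y (f (x + w) - ?Q w)"
      by (intro nrm_minus_commute Y i)
    also have "\<dots> < e / 4" using n u by blast
    also have "nrm Y (f (x + u) - ?Q u) < e / 4" using n u by blast
    finally show ?thesis using 1 e by simp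
  qed
  with d show ?thesis by blast
qed

lemma taylor_expansion_bounded:
  "\<exists>M. \<forall>u\<in>vecs X. nrm X u < s \<longrightarrow> nrm Y (f (x + u)) \<le> M"
proof -
  obtain n where n: "\<forall>v\<in>vecs X. nrm X v < s \<longrightarrow> nrm Y (f (x + v) - (\<Sum>m<n. P m v)) < 1"
    using taylor_expansionD(4)[OF zero_less_one] by blast
  obtain C where C: "\<And>u. u \<in> vecs X \<Longrightarrow> nrm X u \<le> s \<Longrightarrow> nrm Y (\<Sum>m<n. P m u) \<le> C"
    using poly_sum_bounded[OF taylor_expansionD(2,3) X Y, of s n] by blast
  have "nrm Y (f (x + u)) \<le> C + 1" if u: "u \<in> vecs X" "nrm X u < s" for u
    using nrm_diff_le[OF Y taylor_expansion_f_in taylor_expansion_sum_in, of u u n] C[of u] n u by fastforce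
  then show ?thesis by blast
qed

lemma taylor_expansion_poly_approx:
  assumes u: "u \<in> vecs X" "v \<in> vecs X" and small: "\<And>l. cmod l \<le> r \<Longrightarrow> nrm X (u + l *\<^sub>C v) < s"
  shows "poly_approx Y (\<lambda>l. f (x + (u + l *\<^sub>C v))) r"
  unfolding poly_approx_def
proof (intro allI impI)
  fix e :: real assume e: "e > 0"
  obtain n where n: "\<forall>v\<in>vecs X. nrm X v < s \<longrightarrow> nrm Y (f (x + v) - (\<Sum>m<n. P m v)) < e"
    using taylor_expansionD(4)[OF e] by blast
  have "\<forall>m. \<exists>d. (\<forall>k. d k \<in> vecs Y) \<and> (\<forall>n>m. \<forall>l. P m (u + l *\<^sub>C v) = vpoly d n l)"
    using homogeneous_polynomial_line[OF taylor_expansionD(2) X Y u] by blast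
  then obtain d where d: "\<And>m k. d m k \<in> vecs Y"
    "\<And>m n l. m < n \<Longrightarrow> P m (u + l *\<^sub>C v) = (\<Sum>k<n. l ^ k *\<^sub>C d m k)" by metis
  have "(\<Sum>m<n. P m (u + l *\<^sub>C v)) = (\<Sum>k<n. l ^ k *\<^sub>C (\<Sum>m<n. d m k))" for l
  proof -
    have "(\<Sum>m<n. P m (u + l *\<^sub>C v)) = (\<Sum>m<n. \<Sum>k<n. l ^ k *\<^sub>C d m k)"
      using d(2) by (intro sum.cong) auto
    also have "\<dots> = (\<Sum>k<n. \<Sum>m<n. l ^ k *\<^sub>C d m k)" by (rule sum.swap)
    finally show ?thesis by (simp add: complex_vector.scale_sum_right)
  qed
  moreover have "nrm Y (f (x + (u + l *\<^sub>C v)) - (\<Sum>m<n. P m (u + l *\<^sub>C v))) < e" if "cmod l \<le> r" for l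
    using n u small[OF that] by (simp add: vecs_add vecs_scale X)
  moreover have "(\<Sum>m<n. d m k) \<in> vecs Y" for k using d by (intro vecs_sum Y)
  ultimately show "\<exists>N d. (\<forall>k. d k \<in> vecs Y) \<and>
      (\<forall>l. cmod l \<le> r \<longrightarrow> nrm Y (f (x + (u + l *\<^sub>C v)) - vpoly d N l) < e)"
    by (intro exI[of _ n] exI[of _ "\<lambda>k. \<Sum>m<n. d m k"]) auto
qed

text \<open>The definition of holomorphy grants each point its own radius of convergence. Near \<open>x\<close> the radii
  are nevertheless bounded below, because there \<open>f\<close> is a uniform limit of polynomials, whatever point
  they are expanded around.\<close>

lemma taylor_expansion_recentre:
  assumes u: "u \<in> vecs X" "v \<in> vecs X" and small: "\<And>l. cmod l \<le> r \<Longrightarrow> nrm X (u + l *\<^sub>C v) < s"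
    and r: "r > 0"
  shows "approx_series Y (\<lambda>l. f (x + u + l *\<^sub>C v)) (\<lambda>m. taylor X Y f (x + u) m v) r"
proof -
  have xu: "x + u \<in> vecs X" using x u by (intro vecs_add X)
  obtain r' where r': "r' > 0"
    "power_series Y (\<lambda>l. f (x + u + l *\<^sub>C v)) (\<lambda>m. taylor X Y f (x + u) m v) r'"
    using taylor_power_series[OF f X Y xu u(2)] by blast
  have "poly_approx Y (\<lambda>l. f (x + u + l *\<^sub>C v)) r"
    using taylor_expansion_poly_approx[OF u small] by (simp add: add.assoc)
  then show ?thesis
    by (rule poly_approx_imp_approx_series[OF Y _ r'(2,1) r])
      (use xu u in \<open>auto intro!: nholomorphic_in[OF f] vecs_add vecs_scale X\<close>)
qed

end

lemma compact_uniform_bounds: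
  fixes T :: "'a::metric_space set" and \<Phi> :: "'a \<Rightarrow> real \<Rightarrow> real \<Rightarrow> bool"
  assumes T: "compact T"
    and loc: "\<And>z. z \<in> T \<Longrightarrow> \<exists>e>0. \<exists>d>0. \<exists>M. \<forall>y\<in>T. dist y z < e \<longrightarrow> \<Phi> y d M"
    and mono: "\<And>z d M d' M'. \<Phi> z d M \<Longrightarrow> d' \<le> d \<Longrightarrow> M \<le> M' \<Longrightarrow> \<Phi> z d' M'"
  shows "\<exists>d>0. \<exists>M. \<forall>z\<in>T. \<Phi> z d M"
proof -
  obtain e d M where e: "\<And>z. z \<in> T \<Longrightarrow> e z > 0" "\<And>z. z \<in> T \<Longrightarrow> d z > (0::real)"
    and \<Phi>: "\<And>z y. z \<in> T \<Longrightarrow> y \<in> T \<Longrightarrow> dist y z < e z \<Longrightarrow> \<Phi> y (d z) (M z)"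
    using loc by metis
  have "T \<subseteq> (\<Union>z\<in>T. ball z (e z))" using e by force
  then obtain F where F: "F \<subseteq> T" "finite F" "T \<subseteq> (\<Union>z\<in>F. ball z (e z))"
    using compactE_image[OF T, of T "\<lambda>z. ball z (e z)"] by (metis open_ball)
  define d' where "d' = Min (insert 1 (d ` F))"
  define M' where "M' = Max (insert 0 (M ` F))"
  have "d' > 0" unfolding d'_def using F e by (subst Min_gr_iff) auto
  moreover have "\<Phi> y d' M'" if y: "y \<in> T" for y
  proof -
    obtain z where z: "z \<in> F" "dist y z < e z" using F y by (auto simp: dist_commute)
    have "d' \<le> d z" "M z \<le> M'" unfolding d'_def M'_def using F z by (auto intro!: Min_le Max_ge)
    then show ?thesis using \<Phi>[of z y] z F y mono by blast
  qed
  ultimately show ?thesis by blast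
qed

text \<open>Recentring gives a common radius and a common bound for \<open>f\<close> near each point of the image of
  \<open>\<phi>\<close>, and compactness makes both global; the rate of convergence is then Cauchy's estimate.\<close>

lemma taylor_uniform_on_compact:
  fixes T :: "complex set"
  assumes f: "nholomorphic X Y f" and X: "normed_subspace X" and Y: "normed_subspace Y"
    and T: "compact T" and \<phi>: "continuous_map (top_of_set T) (nrm_topology X) \<phi>"
  shows "\<exists>d>0. \<exists>M. \<forall>z\<in>T. \<forall>v\<in>vecs X. nrm X v \<le> d \<longrightarrow>
    (\<forall>m. nrm Y (taylor X Y f (\<phi> z) m v) \<le> M) \<and>
    (\<forall>n. \<forall>l. cmod l \<le> 1/2 \<longrightarrow>
       nrm Y (f (\<phi> z + l *\<^sub>C v) - (\<Sum>k<n. l ^ k *\<^sub>C taylor X Y f (\<phi> z) k v)) \<le> 2 * M * cmod l ^ n)"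
proof -
  have \<phi>_in: "\<phi> z \<in> vecs X" if "z \<in> T" for z
    using \<phi> that unfolding continuous_map_set_nrm_iff[OF X] by auto
  define \<Phi> where "\<Phi> z d M \<longleftrightarrow> (\<forall>v\<in>vecs X. nrm X v \<le> d \<longrightarrow>
      approx_series Y (\<lambda>l. f (\<phi> z + l *\<^sub>C v)) (\<lambda>m. taylor X Y f (\<phi> z) m v) 1 \<and>
      (\<forall>l. cmod l \<le> 1 \<longrightarrow> nrm Y (f (\<phi> z + l *\<^sub>C v)) \<le> M))" for z d M
  have "\<exists>d>0. \<exists>M. \<forall>z\<in>T. \<Phi> z d M"
  proof (rule compact_uniform_bounds[OF T])
    show "\<Phi> z d' M'" if "\<Phi> z d M" "d' \<le> d" "M \<le> M'" for z d M d' M'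
      using that unfolding \<Phi>_def by fastforce
    fix z assume z: "z \<in> T"
    obtain s where s: "taylor_expansion X Y f (\<phi> z) (taylor X Y f (\<phi> z)) s"
      using taylor_expansion_taylor[OF f X Y \<phi>_in[OF z]] by blast
    note TE = s X Y f \<phi>_in[OF z]
    have s0: "s > 0" using taylor_expansionD(1)[OF TE] .
    obtain M where M: "\<And>u. u \<in> vecs X \<Longrightarrow> nrm X u < s \<Longrightarrow> nrm Y (f (\<phi> z + u)) \<le> M"
      using taylor_expansion_bounded[OF TE] by blast
    have "s / 2 > 0" using s0 by simp
    then obtain e where e: "e > 0" "\<And>y. y \<in> T \<Longrightarrow> dist y z < e \<Longrightarrow> nrm X (\<phi> y - \<phi> z) < s / 2"
      using \<phi> z unfolding continuous_map_set_nrm_iff[OF X] by meson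
    have "\<Phi> y (s / 3) M" if y: "y \<in> T" "dist y z < e" for y
      unfolding \<Phi>_def
    proof (intro ballI impI)
      fix v assume v: "v \<in> vecs X" "nrm X v \<le> s / 3"
      define u where "u = \<phi> y - \<phi> z"
      have u: "u \<in> vecs X" "nrm X u < s / 2"
        using y e \<phi>_in z by (auto simp: u_def vecs_diff X)
      have small: "nrm X (u + l *\<^sub>C v) < s" if "cmod l \<le> 1" for l
      proof -
        have "nrm X (u + l *\<^sub>C v) \<le> nrm X u + cmod l * nrm X v"
          using nrm_triangle[OF X u(1) vecs_scale[OF X v(1)], of l] v by (simp add: nrm_scale X)
        also have "cmod l * nrm X v \<le> 1 * nrm X v"
          using that v by (intro mult_right_mono nrm_nonneg X)
        finally show ?thesis using u v s0 by simp
      qed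
      have eq: "\<phi> y = \<phi> z + u" by (simp add: u_def)
      show "approx_series Y (\<lambda>l. f (\<phi> y + l *\<^sub>C v)) (\<lambda>m. taylor X Y f (\<phi> y) m v) 1 \<and>
        (\<forall>l. cmod l \<le> 1 \<longrightarrow> nrm Y (f (\<phi> y + l *\<^sub>C v)) \<le> M)"
        using taylor_expansion_recentre[OF TE u(1) v(1) small zero_less_one]
          M[OF vecs_add[OF X u(1) vecs_scale[OF X v(1)]] small] unfolding eq add.assoc by auto
    qed
    then show "\<exists>e>0. \<exists>d>0. \<exists>M. \<forall>y\<in>T. dist y z < e \<longrightarrow> \<Phi> y d M"
      using e s0 by (intro exI[of _ e] conjI exI[of _ "s / 3"] exI[of _ M]) auto
  qed
  then obtain d M where d: "d > 0" and \<Phi>: "\<And>z. z \<in> T \<Longrightarrow> \<Phi> z d M" by blast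
  show ?thesis
  proof (rule exI[of _ d], intro exI[of _ M] conjI ballI impI allI d)
    fix z v assume z: "z \<in> T" and v: "v \<in> vecs X" "nrm X v \<le> d"
    have A: "approx_series Y (\<lambda>l. f (\<phi> z + l *\<^sub>C v)) (\<lambda>m. taylor X Y f (\<phi> z) m v) 1"
      and M: "\<And>l. cmod l \<le> 1 \<Longrightarrow> nrm Y (f (\<phi> z + l *\<^sub>C v)) \<le> M"
      using \<Phi>[OF z] v by (auto simp: \<Phi>_def)
    have f_in: "f (\<phi> z + l *\<^sub>C v) \<in> vecs Y" for l
      using \<phi>_in[OF z] v by (intro nholomorphic_in[OF f] vecs_add vecs_scale X)
    show "nrm Y (taylor X Y f (\<phi> z) m v) \<le> M" for m
      using approx_series_estimates(1)[OF Y A zero_less_one f_in M, of m] by simp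
    show "nrm Y (f (\<phi> z + l *\<^sub>C v) - (\<Sum>k<n. l ^ k *\<^sub>C taylor X Y f (\<phi> z) k v)) \<le> 2 * M * cmod l ^ n"
      if "cmod l \<le> 1/2" for n l
      using approx_series_estimates(2)[OF Y A zero_less_one f_in M, of l n] that by simp
  qed
qed

text \<open>The coefficient of \<open>l ^ m\<close> in \<open>f (\<phi> y + l \<psi> y)\<close> depends continuously on \<open>y\<close>, since by Cauchy's
  estimate it is controlled by the values on a fixed circle \<open>\<bar>l\<bar> = r\<close>, and these vary uniformly in \<open>l\<close>.\<close>

lemma continuous_map_taylor:
  fixes T :: "complex set"
  assumes f: "nholomorphic X Y f" and X: "normed_subspace X" and Y: "normed_subspace Y"
    and \<phi>: "continuous_map (top_of_set T) (nrm_topology X) \<phi>"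
    and \<psi>: "continuous_map (top_of_set T) (nrm_topology X) \<psi>"
  shows "continuous_map (top_of_set T) (nrm_topology Y) (\<lambda>z. taylor X Y f (\<phi> z) m (\<psi> z))"
  unfolding continuous_map_set_nrm_iff[OF Y]
proof (intro conjI ballI allI impI)
  have \<phi>_in: "\<phi> z \<in> vecs X" and \<psi>_in: "\<psi> z \<in> vecs X" if "z \<in> T" for z
    using \<phi> \<psi> that unfolding continuous_map_set_nrm_iff[OF X] by auto
  show "(\<lambda>z. taylor X Y f (\<phi> z) m (\<psi> z)) \<in> T \<rightarrow> vecs Y"
    using taylor_in[OF f X Y] \<phi>_in \<psi>_in by auto
  fix z and e :: real assume z: "z \<in> T" and e: "e > 0"
  obtain s where s: "taylor_expansion X Y f (\<phi> z) (taylor X Y f (\<phi> z)) s"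
    using taylor_expansion_taylor[OF f X Y \<phi>_in[OF z]] by blast
  note TE = s X Y f \<phi>_in[OF z]
  have s0: "s > 0" using taylor_expansionD(1)[OF TE] .
  define B where "B = nrm X (\<psi> z) + 1"
  have B: "B \<ge> 1" using nrm_nonneg[OF X \<psi>_in[OF z]] by (simp add: B_def)
  \<comment> \<open>For \<open>\<bar>l\<bar> \<le> r\<close> and \<open>y\<close> near \<open>z\<close> the points \<open>\<phi> y + l \<psi> y\<close> stay in the ball of radius \<open>s\<close> around \<open>\<phi> z\<close>.\<close>
  define r where "r = s / (4 * B)"
  have r: "r > 0" using s0 B by (simp add: r_def)
  have er: "e * r ^ m / 2 > 0" using e r by simp
  obtain d where d: "d > 0" and uc: "\<And>u w. u \<in> vecs X \<Longrightarrow> w \<in> vecs X \<Longrightarrow> nrm X u < s \<Longrightarrow> nrm X w < s \<Longrightarrow>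
    nrm X (u - w) < d \<Longrightarrow> nrm Y (f (\<phi> z + u) - f (\<phi> z + w)) < e * r ^ m / 2"
    using taylor_expansion_uniformly_continuous[OF TE er] by blast
  define q where "q = min (s / 4) (d / (2 * (1 + r)))"
  have q: "q > 0" using s0 d r by (simp add: q_def)
  have q1: "min q 1 > 0" using q by simp
  obtain a where a: "a > 0" "\<And>y. y \<in> T \<Longrightarrow> dist y z < a \<Longrightarrow> nrm X (\<phi> y - \<phi> z) < q"
    using \<phi> z q unfolding continuous_map_set_nrm_iff[OF X] by meson
  obtain b where b: "b > 0" "\<And>y. y \<in> T \<Longrightarrow> dist y z < b \<Longrightarrow> nrm X (\<psi> y - \<psi> z) < min q 1"
    using \<psi> z q1 unfolding continuous_map_set_nrm_iff[OF X] by meson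
  have ap: "\<And>l. cmod l \<le> r \<Longrightarrow> nrm X (\<phi> y - \<phi> z + l *\<^sub>C \<psi> y) < s"
     "approx_series Y (\<lambda>l. f (\<phi> y + l *\<^sub>C \<psi> y)) (\<lambda>m. taylor X Y f (\<phi> y) m (\<psi> y)) r"
    if y: "y \<in> T" "nrm X (\<phi> y - \<phi> z) < s / 4" "nrm X (\<psi> y) \<le> B" for y
  proof -
    have u: "\<phi> y - \<phi> z \<in> vecs X" using y z \<phi>_in by (intro vecs_diff X) auto
    show small: "nrm X (\<phi> y - \<phi> z + l *\<^sub>C \<psi> y) < s" if l: "cmod l \<le> r" for l
    proof -
      have "nrm X (\<phi> y - \<phi> z + l *\<^sub>C \<psi> y) \<le> nrm X (\<phi> y - \<phi> z) + cmod l * nrm X (\<psi> y)"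
        using nrm_triangle[OF X u vecs_scale[OF X \<psi>_in[OF y(1)]], of l] \<psi>_in[OF y(1)]
        by (simp add: nrm_scale X)
      also have "cmod l * nrm X (\<psi> y) \<le> r * B"
        using l y r \<psi>_in[OF y(1)] by (intro mult_mono nrm_nonneg X) auto
      also have "r * B = s / 4" using B by (simp add: r_def)
      finally show ?thesis using y s0 by simp
    qed
    show "approx_series Y (\<lambda>l. f (\<phi> y + l *\<^sub>C \<psi> y)) (\<lambda>m. taylor X Y f (\<phi> y) m (\<psi> y)) r"
      using taylor_expansion_recentre[OF TE u \<psi>_in[OF y(1)] small r] by simp
  qed
  have z1: "nrm X (\<phi> z - \<phi> z) < s / 4" "nrm X (\<psi> z) \<le> B" using s0 by (auto simp: nrm_0 X B_def)
  have "nrm Y (taylor X Y f (\<phi> y) m (\<psi> y) - taylor X Y f (\<phi> z) m (\<psi> z)) < e"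
    if y: "y \<in> T" "dist y z < min a b" for y
  proof -
    have 1: "nrm X (\<phi> y - \<phi> z) < q" "nrm X (\<psi> y - \<psi> z) < min q 1" using a b y by auto
    have y1: "nrm X (\<phi> y - \<phi> z) < s / 4" using 1 by (simp add: q_def)
    have y2: "nrm X (\<psi> y) \<le> B"
      using nrm_diff_le[OF X \<psi>_in[OF y(1)] \<psi>_in[OF z]] 1 by (simp add: B_def)
    have f_in: "f (\<phi> y + l *\<^sub>C \<psi> y) \<in> vecs Y" if "y \<in> T" for l y
      using that \<phi>_in \<psi>_in by (intro nholomorphic_in[OF f] vecs_add vecs_scale X)
    have "nrm Y (taylor X Y f (\<phi> y) m (\<psi> y) - taylor X Y f (\<phi> z) m (\<psi> z)) * r ^ m \<le> e * r ^ m / 2"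
    proof (rule approx_series_estimates(1)[OF Y approx_series_diff[OF Y ap(2)[OF y(1) y1 y2] ap(2)[OF z z1]
            f_in[OF y(1)] f_in[OF z]] r])
      fix l assume l: "cmod l \<le> r"
      show "f (\<phi> y + l *\<^sub>C \<psi> y) - f (\<phi> z + l *\<^sub>C \<psi> z) \<in> vecs Y" using y z f_in by (intro vecs_diff Y) auto
      have "nrm X ((\<phi> y - \<phi> z + l *\<^sub>C \<psi> y) - (\<phi> z - \<phi> z + l *\<^sub>C \<psi> z))
          = nrm X ((\<phi> y - \<phi> z) + l *\<^sub>C (\<psi> y - \<psi> z))"
        by (simp add: complex_vector.scale_right_diff_distrib add_diff_eq)
      also have "\<dots> \<le> nrm X (\<phi> y - \<phi> z) + cmod l * nrm X (\<psi> y - \<psi> z)"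
        using nrm_triangle[OF X, of "\<phi> y - \<phi> z" "l *\<^sub>C (\<psi> y - \<psi> z)"] \<phi>_in \<psi>_in y z
        by (simp add: nrm_scale X vecs_closed)
      also have "\<dots> \<le> q + r * q"
        using 1 l r \<psi>_in y z by (intro add_mono mult_mono nrm_nonneg X vecs_diff) auto
      also have "\<dots> = (1 + r) * q" by (simp add: algebra_simps)
      also have "\<dots> \<le> (1 + r) * (d / (2 * (1 + r)))" using r by (intro mult_left_mono) (auto simp: q_def)
      also have "\<dots> = d / 2" using r by (simp add: divide_simps)
      also have "\<dots> < d" using d by simp
      finally have "nrm X ((\<phi> y - \<phi> z + l *\<^sub>C \<psi> y) - (\<phi> z - \<phi> z + l *\<^sub>C \<psi> z)) < d" .
      from uc[OF _ _ ap(1)[OF y(1) y1 y2 l] ap(1)[OF z z1 l] this] y z \<phi>_in \<psi>_in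
      have "nrm Y (f (\<phi> z + (\<phi> y - \<phi> z + l *\<^sub>C \<psi> y)) - f (\<phi> z + (\<phi> z - \<phi> z + l *\<^sub>C \<psi> z))) < e * r ^ m / 2"
        by (simp add: vecs_closed X)
      then show "nrm Y (f (\<phi> y + l *\<^sub>C \<psi> y) - f (\<phi> z + l *\<^sub>C \<psi> z)) \<le> e * r ^ m / 2"
        by (simp add: add.assoc[symmetric])
    qed
    also have "\<dots> < e * r ^ m" using e r by simp
    finally show ?thesis using r by simp
  qed
  then show "\<exists>d>0. \<forall>y\<in>T. dist y z < d \<longrightarrow>
      nrm Y (taylor X Y f (\<phi> y) m (\<psi> y) - taylor X Y f (\<phi> z) m (\<psi> z)) < e"
    using a b by (intro exI[of _ "min a b"]) auto
qed

section \<open>Taylor coefficients along holomorphic curves\<close>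

text \<open>The pair \<open>(p, k)\<close> is the index of the vector coefficient of \<open>l ^ p * h ^ k\<close>. Leaving out \<open>(0, 0)\<close>,
  the base point of the expansion, is what makes the coefficients below finite sums.\<close>

definition slots :: "nat \<Rightarrow> (nat \<times> nat) set" where
  "slots K = {..1} \<times> {..<K} - {(0, 0)}"

text \<open>The ways of filling the \<open>m\<close> slots of a multilinear map that contribute to \<open>l ^ j * h ^ i\<close>.\<close>

definition slot_maps :: "nat \<Rightarrow> nat \<Rightarrow> nat \<Rightarrow> nat \<Rightarrow> (nat \<Rightarrow> nat \<times> nat) set" where
  "slot_maps m K j i = {g \<in> {..<m} \<rightarrow>\<^sub>E slots K. (\<Sum>l<m. fst (g l)) = j \<and> (\<Sum>l<m. snd (g l)) = i}"

lemma finite_slots: "finite (slots K)"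
  by (simp add: slots_def)

lemma slot_maps_stable: "slot_maps m (Suc i + K) j i = slot_maps m (Suc i) j i"
proof -
  have "g l \<in> slots (Suc i)" if g: "g \<in> slot_maps m (Suc i + K) j i" and l: "l < m" for g l
  proof -
    have "snd (g l) \<le> (\<Sum>l<m. snd (g l))" using l by (intro member_le_sum) auto
    also have "\<dots> = i" using g by (simp add: slot_maps_def)
    finally have "snd (g l) < Suc i" by simp
    moreover have "g l \<in> slots (Suc i + K)" using g l by (auto simp: slot_maps_def)
    ultimately show ?thesis by (cases "g l") (auto simp: slots_def)
  qed
  then have "slot_maps m (Suc i + K) j i \<subseteq> slot_maps m (Suc i) j i"
    by (auto simp: slot_maps_def PiE_iff)
  moreover have "slots (Suc i) \<subseteq> slots (Suc i + K)" by (auto simp: slots_def)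
  then have "slot_maps m (Suc i) j i \<subseteq> slot_maps m (Suc i + K) j i"
    unfolding slot_maps_def using PiE_mono[of "{..<m}" "\<lambda>_. slots (Suc i)" "\<lambda>_. slots (Suc i + K)"]
    by blast
  ultimately show ?thesis by blast
qed

lemma slot_maps_empty:
  assumes "i + j < m"
  shows "slot_maps m K j i = {}"
proof -
  have "m \<le> i + j" if g: "g \<in> slot_maps m K j i" for g
  proof -
    have "m = (\<Sum>l<m. 1)" by simp
    also have "\<dots> \<le> (\<Sum>l<m. fst (g l) + snd (g l))"
    proof (rule sum_mono)
      fix l assume "l \<in> {..<m}"
      then have "g l \<in> slots K" using g by (auto simp: slot_maps_def)
      then show "1 \<le> fst (g l) + snd (g l)" by (cases "g l") (auto simp: slots_def)
    qed
    also have "\<dots> = i + j" using g by (simp add: slot_maps_def sum.distrib)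
    finally show ?thesis .
  qed
  with assms show ?thesis by force
qed

lemma multilinear_expand_slots:
  assumes A: "multilinear m X Y A" and X: "normed_subspace X"
    and w: "\<And>p. w p \<in> vecs X" and J: "m < J" and I: "m * K < I"
  shows "A (\<lambda>q\<in>{..<m}. \<Sum>p\<in>slots K. (l ^ fst p * h ^ snd p) *\<^sub>C w p)
    = (\<Sum>j<J. l ^ j *\<^sub>C (\<Sum>i<I. h ^ i *\<^sub>C (\<Sum>g\<in>slot_maps m K j i. A (\<lambda>q\<in>{..<m}. w (g q)))))"
proof -
  let ?G = "{..<m} \<rightarrow>\<^sub>E slots K"
  define E where "E g = ((\<Sum>q<m. fst (g q)), (\<Sum>q<m. snd (g q)))" for g :: "nat \<Rightarrow> nat \<times> nat"
  define F where "F g = A (\<lambda>q\<in>{..<m}. w (g q))" for g :: "nat \<Rightarrow> nat \<times> nat"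
  have fin: "finite ?G" by (intro finite_PiE finite_slots) auto
  have EG: "E ` ?G \<subseteq> {..<J} \<times> {..<I}"
  proof (clarsimp simp: E_def)
    fix g assume g: "g \<in> ?G"
    have "fst (g q) \<le> 1" "snd (g q) \<le> K" if "q < m" for q
    proof -
      have "g q \<in> slots K" using g that by auto
      then show "fst (g q) \<le> 1" "snd (g q) \<le> K" by (cases "g q"; auto simp: slots_def)+
    qed
    then have "(\<Sum>q<m. fst (g q)) \<le> (\<Sum>q<m. 1)" "(\<Sum>q<m. snd (g q)) \<le> (\<Sum>q<m. K)"
      by (intro sum_mono; simp)+
    then show "(\<Sum>q<m. fst (g q)) < J \<and> (\<Sum>q<m. snd (g q)) < I" using J I by simp
  qed
  have "A (\<lambda>q\<in>{..<m}. \<Sum>p\<in>slots K. (l ^ fst p * h ^ snd p) *\<^sub>C w p)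
      = (\<Sum>g\<in>?G. (\<Prod>q<m. l ^ fst (g q) * h ^ snd (g q)) *\<^sub>C F g)"
    unfolding F_def using w by (intro multilinear_expand[OF A X] finite_slots)
  also have "\<dots> = (\<Sum>g\<in>?G. (l ^ fst (E g) * h ^ snd (E g)) *\<^sub>C F g)"
    by (simp add: E_def prod.distrib power_sum)
  also have "\<dots> = (\<Sum>p\<in>{..<J} \<times> {..<I}. \<Sum>g | g \<in> ?G \<and> E g = p. (l ^ fst (E g) * h ^ snd (E g)) *\<^sub>C F g)"
    by (intro sum.group[symmetric] fin EG) auto
  also have "\<dots> = (\<Sum>(j, i)\<in>{..<J} \<times> {..<I}. (l ^ j * h ^ i) *\<^sub>C (\<Sum>g\<in>slot_maps m K j i. F g))"
  proof (intro sum.cong refl, clarify)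
    fix j i
    have "{g. g \<in> ?G \<and> E g = (j, i)} = slot_maps m K j i" by (auto simp: slot_maps_def E_def)
    then have "(\<Sum>g | g \<in> ?G \<and> E g = (j, i). (l ^ fst (E g) * h ^ snd (E g)) *\<^sub>C F g)
        = (\<Sum>g\<in>slot_maps m K j i. (l ^ fst (E g) * h ^ snd (E g)) *\<^sub>C F g)" by (simp only:)
    also have "\<dots> = (\<Sum>g\<in>slot_maps m K j i. (l ^ j * h ^ i) *\<^sub>C F g)"
      by (intro sum.cong refl) (auto simp: slot_maps_def E_def)
    finally show "(\<Sum>g | g \<in> ?G \<and> E g = (j, i). (l ^ fst (E g) * h ^ snd (E g)) *\<^sub>C F g)
        = (l ^ j * h ^ i) *\<^sub>C (\<Sum>g\<in>slot_maps m K j i. F g)"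
      by (simp only: complex_vector.scale_sum_right)
  qed
  also have "\<dots> = (\<Sum>j<J. \<Sum>i<I. (l ^ j * h ^ i) *\<^sub>C (\<Sum>g\<in>slot_maps m K j i. F g))"
    by (rule sum.cartesian_product[symmetric])
  finally show ?thesis unfolding F_def
    by (simp only: complex_vector.scale_sum_right complex_vector.scale_scale)
qed

lemma sum_slots:
  fixes a b :: "nat \<Rightarrow> 'v::complex_vector"
  assumes "K > 0"
  shows "(\<Sum>p\<in>slots K. (l ^ fst p * h ^ snd p) *\<^sub>C (if fst p = 0 then a (snd p) else b (snd p)))
    = (vpoly a K h - a 0) + l *\<^sub>C vpoly b K h"
proof -
  let ?F = "\<lambda>p. (l ^ fst p * h ^ snd p) *\<^sub>C (if fst p = 0 then a (snd p) else b (snd p))"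
  have "(\<Sum>p\<in>slots K. ?F p) = (\<Sum>p\<in>{..1} \<times> {..<K}. ?F p) - a 0"
    using assms unfolding slots_def by (subst sum_diff) auto
  also have "(\<Sum>p\<in>{..1} \<times> {..<K}. ?F p) = (\<Sum>q\<le>1. \<Sum>k<K. ?F (q, k))"
    by (subst sum.cartesian_product) (auto intro!: sum.cong)
  also have "\<dots> = vpoly a K h + l *\<^sub>C vpoly b K h"
    by (simp add: complex_vector.scale_sum_right)
  finally show ?thesis by simp
qed

text \<open>Expanding \<open>f (\<phi> h + l \<psi> h)\<close> jointly in \<open>h\<close> and \<open>l\<close>: the coefficient of
  \<open>l ^ j * h ^ i\<close> involves only the Taylor polynomials of degree at most \<open>i + j\<close>, since each slot
  contributes weight at least one, so it is the same finite sum \<open>D i\<close> for all truncations that are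
  long enough, and no limit has to be taken. Cauchy's estimate in \<open>l\<close> isolates the coefficient of
  \<open>l ^ j\<close>. For \<open>j = 0\<close> this is the holomorphy of \<open>f \<circ> \<phi>\<close>.\<close>

lemma taylor_along_curve_power_series:
  assumes f: "nholomorphic X Y f" and X: "normed_subspace X" and Y: "normed_subspace Y"
    and \<phi>_in: "\<And>h. cmod h \<le> \<rho> \<Longrightarrow> \<phi> h \<in> vecs X" and \<psi>_in: "\<And>h. cmod h \<le> \<rho> \<Longrightarrow> \<psi> h \<in> vecs X"
    and \<phi>: "approx_series X \<phi> a \<rho>" and \<psi>: "approx_series X \<psi> b \<rho>" and \<rho>: "\<rho> > 0"
  shows "\<exists>r>0. \<exists>c. power_series Y (\<lambda>h. taylor X Y f (\<phi> h) j (\<psi> h)) c r"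
proof -
  have a: "a k \<in> vecs X" and b: "b k \<in> vecs X" for k using \<phi> \<psi> by (auto simp: approx_series_def)
  have x0: "\<phi> 0 = a 0"
    using power_series_at_0[OF X power_seriesI[OF X \<phi> \<rho> \<phi>_in]] \<rho> \<phi>_in[of 0] by simp
  have x0_in: "a 0 \<in> vecs X" by (rule a)
  obtain s where s: "taylor_expansion X Y f (a 0) (taylor X Y f (a 0)) s"
    using taylor_expansion_taylor[OF f X Y x0_in] by blast
  note TE = s X Y f x0_in
  have s0: "s > 0" using taylor_expansionD(1)[OF TE] .
  define P where "P = taylor X Y f (a 0)"
  have hP: "homogeneous_polynomial m X Y (P m)" "bounded_near_0 X Y (P m)" for m
    using taylor_expansionD(2,3)[OF TE] by (auto simp: P_def)
  have "\<forall>m. \<exists>A. multilinear m X Y A \<and> (\<forall>x\<in>vecs X. P m x = A (\<lambda>i\<in>{..<m}. x))"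
    using hP(1) by (auto simp: homogeneous_polynomial_def)
  then obtain A where A: "\<And>m. multilinear m X Y (A m)"
    and PA: "\<And>m x. x \<in> vecs X \<Longrightarrow> P m x = A m (\<lambda>i\<in>{..<m}. x)" by metis
  define w where "w p = (if fst p = 0 then a (snd p) else b (snd p))" for p :: "nat \<times> nat"
  have w: "w p \<in> vecs X" for p using a b by (simp add: w_def)
  define C where "C m K j i = (\<Sum>g\<in>slot_maps m K j i. A m (\<lambda>q\<in>{..<m}. w (g q)))" for m K j i
  have C_in: "C m K j i \<in> vecs Y" for m K j i
    unfolding C_def using w by (intro vecs_sum Y multilinear_in[OF A]) auto
  define D where "D i = (\<Sum>m\<le>i + j. C m (Suc i) j i)" for i
  have D_in: "D i \<in> vecs Y" for i unfolding D_def using C_in by (intro vecs_sum Y)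

  obtain M\<^sub>\<phi> where M\<^sub>\<phi>: "\<And>h. cmod h \<le> \<rho> \<Longrightarrow> nrm X (\<phi> h) \<le> M\<^sub>\<phi>"
    using poly_approx_bounded[OF X approx_series_imp_poly_approx[OF \<phi>] \<phi>_in] by blast
  obtain M\<^sub>\<psi> where M\<^sub>\<psi>: "\<And>h. cmod h \<le> \<rho> \<Longrightarrow> nrm X (\<psi> h) \<le> M\<^sub>\<psi>"
    using poly_approx_bounded[OF X approx_series_imp_poly_approx[OF \<psi>] \<psi>_in] by blast
  have M0: "M\<^sub>\<phi> \<ge> 0" "M\<^sub>\<psi> \<ge> 0"
    using M\<^sub>\<phi>[of 0] M\<^sub>\<psi>[of 0] nrm_nonneg[OF X \<phi>_in[of 0]] nrm_nonneg[OF X \<psi>_in[of 0]] \<rho> by auto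
  \<comment> \<open>For \<open>\<bar>h\<bar> \<le> r\<close> and \<open>\<bar>l\<bar> \<le> \<mu>\<close> both \<open>\<phi> h - a 0\<close> and \<open>l \<psi> h\<close> have norm at most \<open>s / 4\<close>.\<close>
  define r where "r = min (\<rho> / 2) (\<rho> * s / (8 * (M\<^sub>\<phi> + 1)))"
  have "r \<le> \<rho> / 2" unfolding r_def by (rule min.cobounded1)
  moreover have "r > 0" using \<rho> s0 M0 by (simp add: r_def)
  ultimately have r: "r > 0" "r \<le> \<rho>" "r \<le> \<rho> / 2" using \<rho> by auto
  define \<mu> where "\<mu> = s / (4 * (M\<^sub>\<psi> + 1))"
  have \<mu>: "\<mu> > 0" using s0 M0 by (simp add: \<mu>_def)
  define v where "v h = \<phi> h - a 0" for h
  have v_in: "v h \<in> vecs X" if "cmod h \<le> r" for h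
    unfolding v_def using that r \<phi>_in a by (intro vecs_diff X) auto
  have \<psi>r: "\<psi> h \<in> vecs X" if "cmod h \<le> r" for h using that r \<psi>_in by auto
  have v_small: "nrm X (v h) \<le> s / 4" if h: "cmod h \<le> r" for h
  proof -
    have "nrm X (\<phi> h - vpoly a 1 h) \<le> 2 * M\<^sub>\<phi> * (cmod h / \<rho>) ^ 1"
      using h r by (intro approx_series_estimates(2)[OF X \<phi> \<rho> \<phi>_in M\<^sub>\<phi>]) auto
    then have "nrm X (v h) \<le> 2 * M\<^sub>\<phi> * (cmod h / \<rho>)" by (simp add: v_def)
    also have "\<dots> \<le> 2 * (M\<^sub>\<phi> + 1) * ((\<rho> * s / (8 * (M\<^sub>\<phi> + 1))) / \<rho>)"
      using h M0 \<rho> by (intro mult_mono divide_right_mono) (auto simp: r_def)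
    also have "\<dots> = s / 4"
    proof -
      have "2 * B * ((\<rho> * s / (8 * B)) / \<rho>) = s / 4" if "B > 0" for B
        using that \<rho> by simp
      from this[of "M\<^sub>\<phi> + 1"] show ?thesis using M0 by linarith
    qed
    finally show ?thesis .
  qed
  have vl_small: "nrm X (v h + l *\<^sub>C \<psi> h) < s" if h: "cmod h \<le> r" and l: "cmod l \<le> \<mu>" for h l
  proof -
    have "nrm X (v h + l *\<^sub>C \<psi> h) \<le> nrm X (v h) + cmod l * nrm X (\<psi> h)"
      using nrm_triangle[OF X v_in[OF h] vecs_scale[OF X \<psi>r[OF h]], of l] \<psi>r[OF h]
      by (simp add: nrm_scale X)
    also have "cmod l * nrm X (\<psi> h) \<le> \<mu> * (M\<^sub>\<psi> + 1)"
      using l h r M\<^sub>\<psi>[of h] \<mu> nrm_nonneg[OF X \<psi>r[OF h]] by (intro mult_mono) auto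
    also have "\<dots> = s / 4"
    proof -
      have "s / (4 * B) * B = s / 4" if "B > 0" for B using that by simp
      from this[of "M\<^sub>\<psi> + 1"] show ?thesis unfolding \<mu>_def using M0 by linarith
    qed
    finally show ?thesis using v_small[OF h] s0 by linarith
  qed

  have taylor_j_in: "taylor X Y f (\<phi> h) j (\<psi> h) \<in> vecs Y" if "cmod h \<le> r" for h
    using that r \<phi>_in \<psi>_in by (intro taylor_in[OF f X Y]) auto
  have "approx_series Y (\<lambda>h. taylor X Y f (\<phi> h) j (\<psi> h)) D (r / 2)"
    unfolding approx_series_def
  proof (intro conjI allI impI D_in)
    fix n and e :: real assume e: "e > 0"
    \<comment> \<open>Half of the error \<open>\<epsilon>\<close> comes from truncating the Taylor series of \<open>f\<close> to degrees below \<open>M\<close>, the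
      other half from truncating \<open>\<phi>\<close> and \<open>\<psi>\<close> to degrees below \<open>K\<close>.\<close>
    define \<epsilon> where "\<epsilon> = e * \<mu> ^ j / 2"
    have \<epsilon>: "\<epsilon> > 0" using e \<mu> by (simp add: \<epsilon>_def)
    then have \<epsilon>2: "\<epsilon> / 2 > 0" by simp
    obtain N where N: "\<forall>n\<ge>N. \<forall>v\<in>vecs X. nrm X v < s \<longrightarrow> nrm Y (f (a 0 + v) - (\<Sum>m<n. P m v)) < \<epsilon> / 2"
      using taylor_expansionD(4)[OF TE \<epsilon>2] unfolding P_def by blast
    define M where "M = max N (n + j + 1)"
    have M: "M \<ge> N" "M > n + j" by (auto simp: M_def)
    obtain L where L: "L \<ge> 0" "\<And>u v. u \<in> vecs X \<Longrightarrow> v \<in> vecs X \<Longrightarrow> nrm X u \<le> s \<Longrightarrow> nrm X v \<le> 1 \<Longrightarrow>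
      nrm Y ((\<Sum>m<M. P m (u + v)) - (\<Sum>m<M. P m u)) \<le> L * nrm X v"
      using poly_sum_Lipschitz[OF hP X Y, of s M] by blast
    define \<eta> where "\<eta> = min 1 (\<epsilon> / (2 * (L + 1))) / (1 + \<mu>)"
    have \<eta>: "\<eta> > 0" using \<epsilon> L \<mu> by (simp add: \<eta>_def)
    have \<rho>2: "\<rho> / 2 > 0" using \<rho> by simp
    obtain K1 where K1: "\<forall>n\<ge>K1. \<forall>h. cmod h < \<rho> / 2 \<longrightarrow> nrm X (\<phi> h - vpoly a n h) < \<eta>"
      by (rule power_seriesE[OF power_seriesI[OF X \<phi> \<rho> \<phi>_in] \<eta>])
    obtain K2 where K2: "\<forall>n\<ge>K2. \<forall>h. cmod h < \<rho> / 2 \<longrightarrow> nrm X (\<psi> h - vpoly b n h) < \<eta>"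
      by (rule power_seriesE[OF power_seriesI[OF X \<psi> \<rho> \<psi>_in] \<eta>])
    define K where "K = max (max K1 K2) (Suc n)"
    have K: "K \<ge> K1" "K \<ge> K2" "K > n" "K > 0" by (auto simp: K_def)
    define I where "I = M * K + n + 1"
    have I: "m * K < I" if "m < M" for m
      unfolding I_def using mult_le_mono1[OF less_imp_le[OF that], of K] by linarith
    define S where "S j' h = (\<Sum>i<I. h ^ i *\<^sub>C (\<Sum>m<M. C m K j' i))" for j' h
    have S_in: "S j' h \<in> vecs Y" for j' h
      unfolding S_def using C_in by (intro vecs_sum vecs_scale Y)
    have close: "nrm Y (f (\<phi> h + l *\<^sub>C \<psi> h) - (\<Sum>j'<M. l ^ j' *\<^sub>C S j' h)) \<le> \<epsilon>"
      if h: "cmod h < r" and l: "cmod l \<le> \<mu>" for h l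
    proof -
      have hr: "cmod h \<le> r" "cmod h < \<rho> / 2" using h r by auto
      define u where "u = v h + l *\<^sub>C \<psi> h"
      define uK where "uK = (\<Sum>p\<in>slots K. (l ^ fst p * h ^ snd p) *\<^sub>C w p)"
      have u_in: "u \<in> vecs X" unfolding u_def using v_in \<psi>r hr by (intro vecs_add vecs_scale X)
      have uK_in: "uK \<in> vecs X" unfolding uK_def using w by (intro vecs_sum vecs_scale X)
      have uK: "uK = (vpoly a K h - a 0) + l *\<^sub>C vpoly b K h"
        unfolding uK_def w_def by (rule sum_slots) (rule K)
      have "(\<Sum>m<M. P m uK) = (\<Sum>m<M. \<Sum>j'<M. l ^ j' *\<^sub>C (\<Sum>i<I. h ^ i *\<^sub>C C m K j' i))"
      proof (rule sum.cong)
        fix m assume m: "m \<in> {..<M}"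
        have "P m uK = A m (\<lambda>q\<in>{..<m}. uK)" using uK_in by (rule PA)
        also have "\<dots> = (\<Sum>j'<M. l ^ j' *\<^sub>C (\<Sum>i<I. h ^ i *\<^sub>C C m K j' i))"
          unfolding uK_def C_def using m I w by (intro multilinear_expand_slots[OF A X]) auto
        finally show "P m uK = (\<Sum>j'<M. l ^ j' *\<^sub>C (\<Sum>i<I. h ^ i *\<^sub>C C m K j' i))" .
      qed simp
      also have "\<dots> = (\<Sum>j'<M. \<Sum>m<M. l ^ j' *\<^sub>C (\<Sum>i<I. h ^ i *\<^sub>C C m K j' i))" by (rule sum.swap)
      also have "\<dots> = (\<Sum>j'<M. l ^ j' *\<^sub>C (\<Sum>m<M. \<Sum>i<I. h ^ i *\<^sub>C C m K j' i))"
        by (simp only: complex_vector.scale_sum_right)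
      also have "\<dots> = (\<Sum>j'<M. l ^ j' *\<^sub>C S j' h)"
        unfolding S_def complex_vector.scale_sum_right by (subst sum.swap) (rule refl)
      finally have PuK: "(\<Sum>m<M. P m uK) = (\<Sum>j'<M. l ^ j' *\<^sub>C S j' h)" .
      have d1: "nrm X (\<phi> h - vpoly a K h) \<le> \<eta>" "nrm X (\<psi> h - vpoly b K h) \<le> \<eta>"
        using K1 K2 K hr by (auto intro: less_imp_le)
      have in1: "vpoly a K h \<in> vecs X" "vpoly b K h \<in> vecs X"
        "\<phi> h \<in> vecs X" "\<psi> h \<in> vecs X"
        using a b \<phi>_in \<psi>_in hr r by (auto intro!: vecs_sum vecs_scale X)
      have "u - uK = (\<phi> h - vpoly a K h) + l *\<^sub>C (\<psi> h - vpoly b K h)"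
        unfolding uK u_def v_def by (simp add: complex_vector.scale_right_diff_distrib)
      then have "nrm X (u - uK) \<le> nrm X (\<phi> h - vpoly a K h)
          + cmod l * nrm X (\<psi> h - vpoly b K h)"
        using nrm_triangle[OF X vecs_diff[OF X in1(3,1)] vecs_scale[OF X vecs_diff[OF X in1(4,2)]], of l]
          in1 by (simp add: nrm_scale vecs_diff X)
      also have "\<dots> \<le> \<eta> + \<mu> * \<eta>"
        using d1 l \<mu> in1 by (intro add_mono mult_mono nrm_nonneg X vecs_diff) auto
      also have "\<dots> = (1 + \<mu>) * \<eta>" by (simp add: algebra_simps)
      also have "\<dots> = min 1 (\<epsilon> / (2 * (L + 1)))" using \<mu> by (simp add: \<eta>_def)
      finally have "nrm X (u - uK) \<le> min 1 (\<epsilon> / (2 * (L + 1)))" .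
      moreover have "nrm X (uK - u) = nrm X (u - uK)" by (intro nrm_minus_commute X u_in uK_in)
      ultimately have d: "nrm X (uK - u) \<le> 1" "nrm X (uK - u) \<le> \<epsilon> / (2 * (L + 1))" by auto
      have us: "nrm X u < s" unfolding u_def using vl_small hr l by blast
      have "nrm Y ((\<Sum>m<M. P m (u + (uK - u))) - (\<Sum>m<M. P m u)) \<le> L * nrm X (uK - u)"
        using us d by (intro L u_in uK_in vecs_diff X) auto
      also have "\<dots> \<le> L * (\<epsilon> / (2 * (L + 1)))" using d L by (intro mult_left_mono)
      also have "\<dots> \<le> \<epsilon> / 2" using L \<epsilon> by (simp add: field_simps)
      finally have 1: "nrm Y ((\<Sum>m<M. P m uK) - (\<Sum>m<M. P m u)) \<le> \<epsilon> / 2" by simp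
      have 2: "nrm Y (f (a 0 + u) - (\<Sum>m<M. P m u)) < \<epsilon> / 2" using N M us u_in by blast
      have Pin: "(\<Sum>m<M. P m x) \<in> vecs Y" if "x \<in> vecs X" for x
        using that homogeneous_polynomial_in[OF hP(1)] by (intro vecs_sum Y)
      have f_in: "f (a 0 + u) \<in> vecs Y" using u_in a by (intro nholomorphic_in[OF f] vecs_add X)
      have "nrm Y (f (a 0 + u) - (\<Sum>m<M. P m uK)) \<le> nrm Y (f (a 0 + u) - (\<Sum>m<M. P m u))
          + nrm Y ((\<Sum>m<M. P m u) - (\<Sum>m<M. P m uK))"
        by (intro nrm_triangle_sub Y f_in Pin u_in uK_in)
      also have "nrm Y ((\<Sum>m<M. P m u) - (\<Sum>m<M. P m uK)) = nrm Y ((\<Sum>m<M. P m uK) - (\<Sum>m<M. P m u))"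
        by (intro nrm_minus_commute Y Pin u_in uK_in)
      finally have "nrm Y (f (a 0 + u) - (\<Sum>m<M. P m uK)) \<le> \<epsilon>" using 1 2 by simp
      moreover have "a 0 + u = \<phi> h + l *\<^sub>C \<psi> h" by (simp add: u_def v_def)
      ultimately show ?thesis unfolding PuK by simp
    qed
    have "nrm Y (taylor X Y f (\<phi> h) j (\<psi> h) - S j h) < e" if h: "cmod h \<le> r / 2" for h
    proof -
      have hr: "cmod h \<le> r" "cmod h < r" using h r by auto
      have eq: "a 0 + v h = \<phi> h" by (simp add: v_def)
      have g_in: "f (\<phi> h + l *\<^sub>C \<psi> h) \<in> vecs Y" for l
        using hr r \<phi>_in \<psi>_in by (intro nholomorphic_in[OF f] vecs_add vecs_scale X) auto
      have p_in: "(\<Sum>j'<M. l ^ j' *\<^sub>C S j' h) \<in> vecs Y" for l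
        using S_in by (intro vecs_sum vecs_scale Y)
      have "approx_series Y (\<lambda>l. f (\<phi> h + l *\<^sub>C \<psi> h)) (\<lambda>m. taylor X Y f (\<phi> h) m (\<psi> h)) \<mu>"
        using taylor_expansion_recentre[OF TE v_in[OF hr(1)] \<psi>r[OF hr(1)] vl_small[OF hr(1)] \<mu>]
        by (simp add: eq)
      from approx_series_diff[OF Y this approx_series_polynomial[where d = "\<lambda>k. S k h" and n = M, OF Y S_in]]
      have "approx_series Y (\<lambda>l. f (\<phi> h + l *\<^sub>C \<psi> h) - (\<Sum>j'<M. l ^ j' *\<^sub>C S j' h))
          (\<lambda>m. taylor X Y f (\<phi> h) m (\<psi> h) - (if m < M then S m h else 0)) \<mu>"
        using g_in p_in by blast
      from approx_series_estimates(1)[OF Y this \<mu>, of \<epsilon> j]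
      have "nrm Y (taylor X Y f (\<phi> h) j (\<psi> h) - (if j < M then S j h else 0)) * \<mu> ^ j \<le> \<epsilon>"
        using close[OF hr(2)] g_in p_in by (simp add: vecs_diff Y)
      then have "nrm Y (taylor X Y f (\<phi> h) j (\<psi> h) - S j h) * \<mu> ^ j \<le> e / 2 * \<mu> ^ j"
        using M by (simp add: \<epsilon>_def)
      then have "nrm Y (taylor X Y f (\<phi> h) j (\<psi> h) - S j h) \<le> e / 2" using \<mu> by simp
      then show ?thesis using e by simp
    qed
    moreover have "(\<Sum>m<M. C m K j i) = D i" if i: "i < n" for i
    proof -
      have "(\<Sum>m<M. C m K j i) = (\<Sum>m\<le>i + j. C m K j i)"
        using M i by (intro sum.mono_neutral_right) (auto simp: C_def slot_maps_empty)
      also have "\<dots> = D i"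
        using slot_maps_stable[of _ i "K - Suc i" j] K i by (simp add: D_def C_def)
      finally show ?thesis .
    qed
    moreover have "n \<le> I" by (simp add: I_def)
    moreover have "(\<Sum>m<M. C m K j i) \<in> vecs Y" for i using C_in by (intro vecs_sum Y)
    ultimately show "\<exists>N\<ge>n. \<exists>d. (\<forall>k. d k \<in> vecs Y) \<and> (\<forall>k<n. nrm Y (d k - D k) < e) \<and>
        (\<forall>h. cmod h \<le> r / 2 \<longrightarrow>
          nrm Y (taylor X Y f (\<phi> h) j (\<psi> h) - vpoly d N h) < e)"
      using e unfolding S_def
      by (intro exI[of _ I] conjI exI[of _ "\<lambda>i. \<Sum>m<M. C m K j i"]) (auto simp: nrm_0 Y)
  qed
  then have "power_series Y (\<lambda>h. taylor X Y f (\<phi> h) j (\<psi> h)) D (r / 2 / 2)"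
    using r taylor_j_in by (intro power_seriesI[OF Y]) auto
  then show ?thesis using r by (intro exI[of _ "r / 2 / 2"]) auto
qed

section \<open>Holomorphic curves\<close>

lemma power_series_monom:
  assumes Y: "normed_subspace Y" and c: "c \<in> vecs Y"
  shows "homogeneous_polynomial m complex_nspace Y (\<lambda>h. h ^ m *\<^sub>C c)"
    and "bounded_near_0 complex_nspace Y (\<lambda>h. h ^ m *\<^sub>C c)"
proof -
  define A where "A a = (\<Prod>i<m. a i) *\<^sub>C c" for a :: "nat \<Rightarrow> complex"
  have upd: "(\<Prod>k<m. (a(i := x)) k) = x * (\<Prod>k\<in>{..<m} - {i}. a k)" if "i < m" for a :: "nat \<Rightarrow> complex" and i x
  proof -
    have "(\<Prod>k<m. (a(i := x)) k) = (a(i := x)) i * (\<Prod>k\<in>{..<m} - {i}. (a(i := x)) k)"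
      using that by (intro prod.remove) auto
    also have "(\<Prod>k\<in>{..<m} - {i}. (a(i := x)) k) = (\<Prod>k\<in>{..<m} - {i}. a k)"
      by (intro prod.cong) auto
    finally show ?thesis by simp
  qed
  have "multilinear m complex_nspace Y A"
    unfolding multilinear_def A_def using c
    by (auto simp: upd vecs_scale Y complex_vector.scale_left_distrib distrib_right scaleC_complex_def
        mult.assoc simp del: fun_upd_apply)
  then show "homogeneous_polynomial m complex_nspace Y (\<lambda>h. h ^ m *\<^sub>C c)"
    unfolding homogeneous_polynomial_def by (intro exI[of _ A]) (auto simp: A_def)
  show "bounded_near_0 complex_nspace Y (\<lambda>h. h ^ m *\<^sub>C c)"
    unfolding bounded_near_0_def
  proof (rule exI[of _ 1], intro conjI exI[of _ "nrm Y c"] ballI impI)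
    fix h :: complex assume "nrm complex_nspace h < 1"
    then have "cmod h ^ m \<le> 1" by (intro power_le_one) (auto simp: complex_nspace_def)
    then show "nrm Y (h ^ m *\<^sub>C c) \<le> nrm Y c"
      using c by (simp add: nrm_scale Y norm_power mult_left_le_one_le nrm_nonneg)
  qed simp
qed

lemma nholomorphic_curveD:
  assumes g: "nholomorphic_on complex_nspace U Y g" and Y: "normed_subspace Y" and z: "z \<in> U"
  shows "\<exists>r>0. \<exists>c. power_series Y (\<lambda>h. g (z + h)) c r \<and> ball z r \<subseteq> U"
proof -
  have gU: "g \<in> U \<rightarrow> vecs Y" using g by (simp add: nholomorphic_on_def)
  obtain r P where P': "\<forall>m. homogeneous_polynomial m complex_nspace Y (P m) \<and>
      continuous_map (nrm_topology complex_nspace) (nrm_topology Y) (P m)"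
    and U': "\<forall>y\<in>vecs complex_nspace. nrm complex_nspace (y - z) < r \<longrightarrow> y \<in> U \<and>
      limitin (nrm_topology Y) (\<lambda>n. \<Sum>m<n. P m (y - z)) (g y) sequentially"
    and ex': "\<exists>s>0. s \<le> r \<and> (\<forall>e>0. \<exists>N. \<forall>n\<ge>N. \<forall>y\<in>vecs complex_nspace.
      nrm complex_nspace (y - z) < s \<longrightarrow> nrm Y ((\<Sum>m<n. P m (y - z)) - g y) < e)"
    using g z unfolding nholomorphic_on_def by blast
  have P: "homogeneous_polynomial m complex_nspace Y (P m)" for m using P' by blast
  have U: "y \<in> U" if "cmod (y - z) < r" for y using U' that by (simp add: complex_nspace_def)
  have ex: "\<exists>s>0. s \<le> r \<and> (\<forall>e>0. \<exists>N. \<forall>n\<ge>N. \<forall>y. cmod (y - z) < s \<longrightarrow>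
      nrm Y ((\<Sum>m<n. P m (y - z)) - g y) < e)"
    using ex' by (simp add: complex_nspace_def)
  obtain s where s: "s > 0" "s \<le> r" and unif: "\<forall>e>0. \<exists>N. \<forall>n\<ge>N. \<forall>y. cmod (y - z) < s \<longrightarrow>
              nrm Y ((\<Sum>m<n. P m (y - z)) - g y) < e"
    using ex by blast
  have PY: "P m h \<in> vecs Y" for m h
    using homogeneous_polynomial_in[OF P] by (simp add: complex_nspace_def)
  have Pm: "P m h = h ^ m *\<^sub>C P m 1" for m h
    using homogeneous_polynomial_scale[OF P normed_subspace_complex, of 1 m h]
    by (simp add: complex_nspace_def scaleC_complex_def)
  have "power_series Y (\<lambda>h. g (z + h)) (\<lambda>m. P m 1) s"
    unfolding power_series_def
  proof (intro conjI allI impI PY)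
    fix e :: real assume "e > 0"
    then obtain N where N: "\<forall>n\<ge>N. \<forall>y. cmod (y - z) < s \<longrightarrow> nrm Y ((\<Sum>m<n. P m (y - z)) - g y) < e"
      using unif by blast
    have "nrm Y (g (z + h) - (\<Sum>k<n. h ^ k *\<^sub>C P k 1)) < e" if "n \<ge> N" "cmod h < s" for n h
    proof -
      have "g (z + h) \<in> vecs Y" using U[of "z + h"] gU that s by auto
      then have "nrm Y (g (z + h) - (\<Sum>m<n. P m h)) = nrm Y ((\<Sum>m<n. P m h) - g (z + h))"
        using PY by (intro nrm_minus_commute Y vecs_sum)
      also have "\<dots> < e" using N[rule_format, OF that(1), of "z + h"] that by simp
      also have "(\<Sum>m<n. P m h) = (\<Sum>k<n. h ^ k *\<^sub>C P k 1)" by (rule sum.cong) (simp_all only: Pm[symmetric])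
      finally show ?thesis .
    qed
    then show "\<exists>N. \<forall>n\<ge>N. \<forall>h. cmod h < s \<longrightarrow> nrm Y (g (z + h) - (\<Sum>k<n. h ^ k *\<^sub>C P k 1)) < e"
      by blast
  qed
  moreover have "ball z s \<subseteq> U"
    using U s by (auto simp: dist_norm norm_minus_commute)
  ultimately show ?thesis using s by blast
qed

lemma nholomorphic_curveI:
  assumes Y: "normed_subspace Y" and U: "open U" and g: "g \<in> U \<rightarrow> vecs Y"
    and ps: "\<And>z. z \<in> U \<Longrightarrow> \<exists>r>0. \<exists>c. power_series Y (\<lambda>h. g (z + h)) c r"
  shows "nholomorphic_on complex_nspace U Y g"
  unfolding nholomorphic_on_def
proof (intro conjI ballI)
  show "U \<subseteq> vecs complex_nspace" by (simp add: complex_nspace_def)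
  show "g \<in> U \<rightarrow> vecs Y" by fact
  fix z assume z: "z \<in> U"
  obtain r0 c where r0: "r0 > 0" and P: "power_series Y (\<lambda>h. g (z + h)) c r0" using ps[OF z] by blast
  obtain r1 where r1: "r1 > 0" "ball z r1 \<subseteq> U" using U z by (meson open_contains_ball)
  define r where "r = min r0 r1"
  have r: "r > 0" "r \<le> r0" "r \<le> r1" using r0 r1 by (auto simp: r_def)
  have c: "c k \<in> vecs Y" for k using P by (simp add: power_series_def)
  have sum_in: "vpoly c n h \<in> vecs Y" for n h using c by (intro vecs_sum vecs_scale Y)
  have U': "y \<in> U" if "cmod (y - z) < r" for y
    using r1(2) that r by (auto simp: subset_eq dist_norm norm_minus_commute)
  have unif: "\<exists>N. \<forall>n\<ge>N. \<forall>y\<in>vecs complex_nspace. nrm complex_nspace (y - z) < r \<longrightarrow>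
      nrm Y ((\<Sum>m<n. (y - z) ^ m *\<^sub>C c m) - g y) < e" if e: "e > 0" for e
  proof -
    obtain N where N: "\<forall>n\<ge>N. \<forall>h. cmod h < r0 \<longrightarrow> nrm Y (g (z + h) - vpoly c n h) < e"
      by (rule power_seriesE[OF P e])
    have "nrm Y ((\<Sum>m<n. (y - z) ^ m *\<^sub>C c m) - g y) < e" if "n \<ge> N" "cmod (y - z) < r" for n y
    proof -
      have "nrm Y ((\<Sum>m<n. (y - z) ^ m *\<^sub>C c m) - g y) = nrm Y (g y - (\<Sum>m<n. (y - z) ^ m *\<^sub>C c m))"
        using g U'[OF that(2)] by (intro nrm_minus_commute Y sum_in) auto
      then show ?thesis using N[rule_format, OF that(1), of "y - z"] that r by simp
    qed
    then show ?thesis by (auto simp: complex_nspace_def)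
  qed
  show "\<exists>r>0. \<exists>P.
        (\<forall>m. homogeneous_polynomial m complex_nspace Y (P m) \<and>
             continuous_map (nrm_topology complex_nspace) (nrm_topology Y) (P m)) \<and>
        (\<forall>y\<in>vecs complex_nspace. nrm complex_nspace (y - z) < r \<longrightarrow>
           y \<in> U \<and> limitin (nrm_topology Y) (\<lambda>n. \<Sum>m<n. P m (y - z)) (g y) sequentially) \<and>
        (\<exists>s>0. s \<le> r \<and> (\<forall>\<epsilon>>0. \<exists>N. \<forall>n\<ge>N. \<forall>y\<in>vecs complex_nspace. nrm complex_nspace (y - z) < s \<longrightarrow>
              nrm Y ((\<Sum>m<n. P m (y - z)) - g y) < \<epsilon>))"
  proof (rule exI[of _ r], intro conjI r(1) exI[of _ "\<lambda>m h. h ^ m *\<^sub>C c m"] allI ballI impI)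
    fix m
    show hp: "homogeneous_polynomial m complex_nspace Y (\<lambda>h. h ^ m *\<^sub>C c m)"
      by (rule power_series_monom[OF Y c])
    show "continuous_map (nrm_topology complex_nspace) (nrm_topology Y) (\<lambda>h. h ^ m *\<^sub>C c m)"
      using continuous_map_homogeneous_polynomial_iff[OF hp normed_subspace_complex Y]
        power_series_monom(2)[OF Y c] by blast
  next
    fix y assume y: "nrm complex_nspace (y - z) < r"
    then show "y \<in> U" using U' by (simp add: complex_nspace_def)
    then have gy: "g y \<in> vecs Y" using g by auto
    have "\<exists>N. \<forall>n\<ge>N. (\<Sum>m<n. (y - z) ^ m *\<^sub>C c m) \<in> vecs Y \<and>
        nrm Y ((\<Sum>m<n. (y - z) ^ m *\<^sub>C c m) - g y) < e" if e: "e > 0" for e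
    proof -
      obtain N where "\<forall>n\<ge>N. \<forall>y\<in>vecs complex_nspace. nrm complex_nspace (y - z) < r \<longrightarrow>
          nrm Y ((\<Sum>m<n. (y - z) ^ m *\<^sub>C c m) - g y) < e" using unif[OF e] by blast
      then show ?thesis using y sum_in by (intro exI[of _ N]) (simp add: complex_nspace_def)
    qed
    then show "limitin (nrm_topology Y) (\<lambda>n. \<Sum>m<n. (y - z) ^ m *\<^sub>C c m) (g y) sequentially"
      unfolding limitin_nrm_iff[OF Y] eventually_sequentially using gy by blast
  next
    show "\<exists>s>0. s \<le> r \<and> (\<forall>\<epsilon>>0. \<exists>N. \<forall>n\<ge>N. \<forall>y\<in>vecs complex_nspace. nrm complex_nspace (y - z) < s \<longrightarrow>
              nrm Y ((\<Sum>m<n. (y - z) ^ m *\<^sub>C c m) - g y) < \<epsilon>)"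
      using unif r by blast
  qed
qed

lemma power_series_combine:
  assumes Y: "normed_subspace Y" and P: "power_series Y g c r" and Q: "power_series Y h d r"
    and gh: "\<And>l. cmod l < r \<Longrightarrow> g l \<in> vecs Y" "\<And>l. cmod l < r \<Longrightarrow> h l \<in> vecs Y"
  shows "power_series Y (\<lambda>l. g l + a *\<^sub>C h l) (\<lambda>k. c k + a *\<^sub>C d k) r"
  unfolding power_series_def
proof (intro conjI allI impI)
  have cd: "c k \<in> vecs Y" "d k \<in> vecs Y" for k using P Q by (auto simp: power_series_def)
  then show "c k + a *\<^sub>C d k \<in> vecs Y" for k by (intro vecs_add vecs_scale Y)
  have a: "cmod a + 1 > 0" by (simp add: add_nonneg_pos)
  fix e :: real assume e: "e > 0"
  define \<delta> where "\<delta> = e / (cmod a + 1)"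
  have \<delta>: "\<delta> > 0" using e a by (simp add: \<delta>_def)
  obtain N where N: "\<forall>n\<ge>N. \<forall>l. cmod l < r \<longrightarrow> nrm Y (g l - vpoly c n l) < \<delta>"
    by (rule power_seriesE[OF P \<delta>])
  obtain K where K: "\<forall>n\<ge>K. \<forall>l. cmod l < r \<longrightarrow> nrm Y (h l - vpoly d n l) < \<delta>"
    by (rule power_seriesE[OF Q \<delta>])
  have "nrm Y (g l + a *\<^sub>C h l - (\<Sum>k<n. l ^ k *\<^sub>C (c k + a *\<^sub>C d k))) < e"
    if n: "n \<ge> max N K" and l: "cmod l < r" for n l
  proof -
    have "vpoly c n l \<in> vecs Y" "vpoly d n l \<in> vecs Y"
      using cd by (intro vecs_sum vecs_scale Y; simp)+
    from nrm_combine_less[OF Y vecs_diff[OF Y gh(1)[OF l] this(1)] vecs_diff[OF Y gh(2)[OF l] this(2)]]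
    have "nrm Y ((g l - vpoly c n l) + a *\<^sub>C (h l - vpoly d n l)) < e"
      using N K n l by (simp add: \<delta>_def)
    moreover have "(\<Sum>k<n. l ^ k *\<^sub>C (c k + a *\<^sub>C d k))
        = vpoly c n l + a *\<^sub>C vpoly d n l"
      by (simp add: complex_vector.scale_right_distrib sum.distrib complex_vector.scale_sum_right mult.commute)
    ultimately show ?thesis by (simp add: complex_vector.scale_right_diff_distrib algebra_simps)
  qed
  then show "\<exists>N. \<forall>n\<ge>N. \<forall>l. cmod l < r \<longrightarrow>
      nrm Y (g l + a *\<^sub>C h l - (\<Sum>k<n. l ^ k *\<^sub>C (c k + a *\<^sub>C d k))) < e" by blast
qed

lemma power_series_mono_radius: "power_series Y g c r \<Longrightarrow> s \<le> r \<Longrightarrow> power_series Y g c s"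
  by (auto simp: power_series_def) (metis order_less_le_trans)

lemma nholomorphic_curve_combine:
  assumes Y: "normed_subspace Y" and U: "open U"
    and g: "nholomorphic_on complex_nspace U Y g" and h: "nholomorphic_on complex_nspace U Y h"
  shows "nholomorphic_on complex_nspace U Y (\<lambda>z. g z + a *\<^sub>C h z)"
proof (rule nholomorphic_curveI[OF Y U])
  have gh: "g z \<in> vecs Y" "h z \<in> vecs Y" if "z \<in> U" for z
    using g h that by (auto simp: nholomorphic_on_def)
  then show "(\<lambda>z. g z + a *\<^sub>C h z) \<in> U \<rightarrow> vecs Y" by (auto intro: vecs_add vecs_scale Y)
  fix z assume z: "z \<in> U"
  obtain r c where r: "r > 0" and P: "power_series Y (\<lambda>l. g (z + l)) c r" and rU: "ball z r \<subseteq> U"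
    using nholomorphic_curveD[OF g Y z] by blast
  obtain s d where s: "s > 0" and Q: "power_series Y (\<lambda>l. h (z + l)) d s"
    using nholomorphic_curveD[OF h Y z] by blast
  have in1: "z + l \<in> U" if "cmod l < min r s" for l using that rU by (auto simp: subset_eq dist_norm)
  have "power_series Y (\<lambda>l. g (z + l) + a *\<^sub>C h (z + l)) (\<lambda>k. c k + a *\<^sub>C d k) (min r s)"
    using power_series_mono_radius[OF P, of "min r s"] power_series_mono_radius[OF Q, of "min r s"]
    by (intro power_series_combine Y gh in1) auto
  then show "\<exists>r>0. \<exists>c. power_series Y (\<lambda>l. g (z + l) + a *\<^sub>C h (z + l)) c r"
    using r s by (intro exI[of _ "min r s"]) auto
qed

lemma nholomorphic_curve_cong:
  assumes Y: "normed_subspace Y" and U: "open U" and g: "nholomorphic_on complex_nspace U Y g"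
    and eq: "\<And>z. z \<in> U \<Longrightarrow> h z = g z"
  shows "nholomorphic_on complex_nspace U Y h"
proof (rule nholomorphic_curveI[OF Y U])
  show "h \<in> U \<rightarrow> vecs Y" using g eq by (auto simp: nholomorphic_on_def)
  fix z assume z: "z \<in> U"
  obtain r c where r: "r > 0" and P: "power_series Y (\<lambda>l. g (z + l)) c r" and rU: "ball z r \<subseteq> U"
    using nholomorphic_curveD[OF g Y z] by blast
  have "h (z + l) = g (z + l)" if "cmod l < r" for l
    using that rU by (intro eq) (auto simp: subset_eq dist_norm)
  then have "power_series Y (\<lambda>l. h (z + l)) c r" using P by (simp add: power_series_def)
  then show "\<exists>r>0. \<exists>c. power_series Y (\<lambda>l. h (z + l)) c r" using r by blast
qed

lemma nholomorphic_curve_taylor: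
  assumes f: "nholomorphic X Y f" and X: "normed_subspace X" and Y: "normed_subspace Y"
    and U: "open U" and \<phi>: "nholomorphic_on complex_nspace U X \<phi>" and \<psi>: "nholomorphic_on complex_nspace U X \<psi>"
  shows "nholomorphic_on complex_nspace U Y (\<lambda>z. taylor X Y f (\<phi> z) m (\<psi> z))"
proof (rule nholomorphic_curveI[OF Y U])
  have in1: "\<phi> z \<in> vecs X" "\<psi> z \<in> vecs X" if "z \<in> U" for z
    using \<phi> \<psi> that by (auto simp: nholomorphic_on_def)
  then show "(\<lambda>z. taylor X Y f (\<phi> z) m (\<psi> z)) \<in> U \<rightarrow> vecs Y"
    using taylor_in[OF f X Y] by auto
  fix z assume z: "z \<in> U"
  obtain r a where r: "r > 0" and P: "power_series X (\<lambda>l. \<phi> (z + l)) a r" and rU: "ball z r \<subseteq> U"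
    using nholomorphic_curveD[OF \<phi> X z] by blast
  obtain s b where s: "s > 0" and Q: "power_series X (\<lambda>l. \<psi> (z + l)) b s"
    using nholomorphic_curveD[OF \<psi> X z] by blast
  define \<rho> where "\<rho> = min r s / 2"
  have \<rho>: "\<rho> > 0" "\<rho> < r" "\<rho> < s" using r s by (auto simp: \<rho>_def)
  have U': "z + l \<in> U" if "cmod l \<le> \<rho>" for l using that rU \<rho> by (auto simp: subset_eq dist_norm)
  show "\<exists>r>0. \<exists>c. power_series Y (\<lambda>l. taylor X Y f (\<phi> (z + l)) m (\<psi> (z + l))) c r"
    using taylor_along_curve_power_series[OF f X Y in1(1)[OF U'] in1(2)[OF U']
        power_series_imp_approx_series[OF P \<rho>(2) X] power_series_imp_approx_series[OF Q \<rho>(3) X] \<rho>(1)] .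
qed


section \<open>The sum of a compatible couple\<close>

lemma compatible_coupleD:
  assumes "compatible_couple X0 X1"
  shows couple_normed0: "normed_subspace X0" and couple_normed1: "normed_subspace X1"
    and couple_embedding0: "continuous_map (nrm_topology X0) euclidean id"
    and couple_embedding1: "continuous_map (nrm_topology X1) euclidean id"
  using assms by (auto simp: compatible_couple_def banach_subspace_def)

lemma nrm_sum_space_le:
  assumes C: "compatible_couple X0 X1" and x: "x0 \<in> vecs X0" "x1 \<in> vecs X1"
  shows "nrm (sum_space X0 X1) (x0 + x1) \<le> nrm X0 x0 + nrm X1 x1"
  unfolding sum_space_def nspace.simps
proof (rule cInf_lower)
  show "nrm X0 x0 + nrm X1 x1 \<in> {nrm X0 y0 + nrm X1 y1 | y0 y1. y0 \<in> vecs X0 \<and> y1 \<in> vecs X1 \<and> x0 + x1 = y0 + y1}"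
    using x by blast
  show "bdd_below {nrm X0 y0 + nrm X1 y1 | y0 y1. y0 \<in> vecs X0 \<and> y1 \<in> vecs X1 \<and> x0 + x1 = y0 + y1}"
    using nrm_nonneg[OF couple_normed0[OF C]] nrm_nonneg[OF couple_normed1[OF C]]
    by (intro bdd_belowI[of _ 0]) (auto intro: add_nonneg_nonneg)
qed

lemma nrm_sum_space_less:
  assumes x: "x \<in> vecs (sum_space X0 X1)" and d: "nrm (sum_space X0 X1) x < d"
  shows "\<exists>x0\<in>vecs X0. \<exists>x1\<in>vecs X1. x = x0 + x1 \<and> nrm X0 x0 + nrm X1 x1 < d"
proof -
  let ?S = "{nrm X0 x0 + nrm X1 x1 | x0 x1. x0 \<in> vecs X0 \<and> x1 \<in> vecs X1 \<and> x = x0 + x1}"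
  have "?S \<noteq> {}" using x by (auto simp: sum_space_def)
  moreover have "Inf ?S < d" using d by (simp add: sum_space_def)
  ultimately show ?thesis using cInf_lessD[of ?S d] by blast
qed

lemma nrm_tendsto_0:
  fixes u :: "nat \<Rightarrow> 'v::complex_tvs"
  assumes X: "normed_subspace X" and e: "continuous_map (nrm_topology X) euclidean id"
    and u: "\<And>n. u n \<in> vecs X" "\<And>n. nrm X (u n) < 1 / real (Suc n)"
  shows "u \<longlonglongrightarrow> 0"
proof -
  have "limitin (nrm_topology X) u 0 sequentially"
    unfolding limitin_nrm_iff[OF X]
  proof (intro conjI vecs_0 X allI impI)
    fix e :: real assume "e > 0"
    then have "\<forall>\<^sub>F n in sequentially. 1 / real (Suc n) < e"
      using order_tendstoD(2)[OF lim_inverse_n'[THEN LIMSEQ_Suc]] by simp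
    then show "\<forall>\<^sub>F n in sequentially. u n \<in> vecs X \<and> nrm X (u n - 0) < e"
    proof (rule eventually_mono)
      fix n assume "1 / real (Suc n) < e"
      with u(2)[of n] u(1) show "u n \<in> vecs X \<and> nrm X (u n - 0) < e" by simp
    qed
  qed
  from continuous_map_limit[OF e this] show ?thesis by simp
qed

text \<open>Definiteness comes from the ambient topology: a vector whose sum norm vanishes is the constant
  sum of two sequences that tend to \<open>0\<close> in a Hausdorff space.\<close>

lemma normed_subspace_sum_space:
  fixes X0 X1 :: "'v::complex_tvs nspace"
  assumes C: "compatible_couple X0 X1"
  shows "normed_subspace (sum_space X0 X1)"
proof -
  let ?S = "sum_space X0 X1"
  note X0 = couple_normed0[OF C] and X1 = couple_normed1[OF C]
  have S: "x \<in> vecs ?S \<longleftrightarrow> (\<exists>x0\<in>vecs X0. \<exists>x1\<in>vecs X1. x = x0 + x1)" for x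
    by (auto simp: sum_space_def)
  have sub: "complex_vector.subspace (vecs ?S)"
    unfolding complex_vector.subspace_def S
  proof (intro conjI ballI allI)
    show "\<exists>x0\<in>vecs X0. \<exists>x1\<in>vecs X1. 0 = x0 + x1" using vecs_0[OF X0] vecs_0[OF X1] by force
  next
    fix x y assume "x \<in> vecs ?S" "y \<in> vecs ?S"
    then obtain x0 x1 y0 y1 where "x0 \<in> vecs X0" "x1 \<in> vecs X1" "y0 \<in> vecs X0" "y1 \<in> vecs X1"
      "x = x0 + x1" "y = y0 + y1" unfolding S by blast
    then show "\<exists>x0\<in>vecs X0. \<exists>x1\<in>vecs X1. x + y = x0 + x1"
      by (intro bexI[of _ "x0 + y0"] bexI[of _ "x1 + y1"] vecs_add X0 X1) (simp_all add: algebra_simps)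
  next
    fix x c assume "x \<in> vecs ?S"
    then obtain x0 x1 where "x0 \<in> vecs X0" "x1 \<in> vecs X1" "x = x0 + x1" unfolding S by blast
    then show "\<exists>x0\<in>vecs X0. \<exists>x1\<in>vecs X1. c *\<^sub>C x = x0 + x1"
      by (intro bexI[of _ "c *\<^sub>C x0"] bexI[of _ "c *\<^sub>C x1"] vecs_scale X0 X1)
        (simp_all add: complex_vector.scale_right_distrib)
  qed
  have nonneg: "0 \<le> nrm ?S x" if x: "x \<in> vecs ?S" for x
  proof (rule ccontr)
    assume "\<not> 0 \<le> nrm ?S x"
    then obtain x0 x1 where "x0 \<in> vecs X0" "x1 \<in> vecs X1" "nrm X0 x0 + nrm X1 x1 < 0"
      using nrm_sum_space_less[OF x, of 0] by auto
    then show False using nrm_nonneg[OF X0, of x0] nrm_nonneg[OF X1, of x1] by simp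
  qed
  have definite: "x = 0" if x: "x \<in> vecs ?S" "nrm ?S x = 0" for x
  proof -
    have "\<forall>n. \<exists>x0 x1. x0 \<in> vecs X0 \<and> x1 \<in> vecs X1 \<and> x = x0 + x1 \<and> nrm X0 x0 + nrm X1 x1 < 1 / real (Suc n)"
    proof
      fix n
      have "nrm ?S x < 1 / real (Suc n)" using x(2) by simp
      from nrm_sum_space_less[OF x(1) this]
      show "\<exists>x0 x1. x0 \<in> vecs X0 \<and> x1 \<in> vecs X1 \<and> x = x0 + x1 \<and>
          nrm X0 x0 + nrm X1 x1 < 1 / real (Suc n)" by blast
    qed
    then obtain a b where ab: "\<And>n. a n \<in> vecs X0" "\<And>n. b n \<in> vecs X1" "\<And>n. x = a n + b n"
      "\<And>n. nrm X0 (a n) + nrm X1 (b n) < 1 / real (Suc n)" by metis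
    have "nrm X0 (a n) < 1 / real (Suc n)" "nrm X1 (b n) < 1 / real (Suc n)" for n
      using ab(4)[of n] nrm_nonneg[OF X0 ab(1)[of n]] nrm_nonneg[OF X1 ab(2)[of n]] by linarith+
    then have "a \<longlonglongrightarrow> 0" "b \<longlonglongrightarrow> 0"
      using ab couple_embedding0[OF C] couple_embedding1[OF C] X0 X1 by (blast intro: nrm_tendsto_0)+
    then have "(\<lambda>n. a n + b n) \<longlonglongrightarrow> 0 + 0" by (rule tendsto_add)
    then have "(\<lambda>n::nat. x) \<longlonglongrightarrow> 0" using ab(3) by simp
    then show "x = 0" using LIMSEQ_unique[OF tendsto_const[of x]] by blast
  qed
  have tri: "nrm ?S (x + y) \<le> nrm ?S x + nrm ?S y" if xy: "x \<in> vecs ?S" "y \<in> vecs ?S" for x y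
  proof (rule field_le_epsilon)
    fix e :: real assume e: "e > 0"
    obtain x0 x1 where x: "x0 \<in> vecs X0" "x1 \<in> vecs X1" "x = x0 + x1" "nrm X0 x0 + nrm X1 x1 < nrm ?S x + e / 2"
      using nrm_sum_space_less[OF xy(1), of "nrm ?S x + e / 2"] e by auto
    obtain y0 y1 where y: "y0 \<in> vecs X0" "y1 \<in> vecs X1" "y = y0 + y1" "nrm X0 y0 + nrm X1 y1 < nrm ?S y + e / 2"
      using nrm_sum_space_less[OF xy(2), of "nrm ?S y + e / 2"] e by auto
    have "nrm ?S ((x0 + y0) + (x1 + y1)) \<le> nrm X0 (x0 + y0) + nrm X1 (x1 + y1)"
      using x y by (intro nrm_sum_space_le C vecs_add X0 X1)
    also have "nrm X0 (x0 + y0) \<le> nrm X0 x0 + nrm X0 y0" using x y by (intro nrm_triangle X0)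
    also have "nrm X1 (x1 + y1) \<le> nrm X1 x1 + nrm X1 y1" using x y by (intro nrm_triangle X1)
    finally have "nrm ?S ((x0 + y0) + (x1 + y1)) \<le> nrm ?S x + nrm ?S y + e" using x y by linarith
    then show "nrm ?S (x + y) \<le> nrm ?S x + nrm ?S y + e" using x y by (simp add: algebra_simps)
  qed
  have scale_le: "nrm ?S (c *\<^sub>C x) \<le> cmod c * nrm ?S x" if x: "x \<in> vecs ?S" for c x
  proof (rule field_le_epsilon)
    fix e :: real assume e: "e > 0"
    define d where "d = e / (cmod c + 1)"
    have d: "d > 0" using e by (simp add: d_def add_nonneg_pos)
    obtain x0 x1 where x: "x0 \<in> vecs X0" "x1 \<in> vecs X1" "x = x0 + x1" "nrm X0 x0 + nrm X1 x1 < nrm ?S x + d"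
      using nrm_sum_space_less[OF x, of "nrm ?S x + d"] d by auto
    have "nrm ?S (c *\<^sub>C x0 + c *\<^sub>C x1) \<le> nrm X0 (c *\<^sub>C x0) + nrm X1 (c *\<^sub>C x1)"
      using x by (intro nrm_sum_space_le C vecs_scale X0 X1)
    also have "\<dots> = cmod c * (nrm X0 x0 + nrm X1 x1)" using x by (simp add: nrm_scale X0 X1 distrib_left)
    also have "\<dots> \<le> cmod c * (nrm ?S x + d)" using x by (intro mult_left_mono) auto
    also have "cmod c * d \<le> (cmod c + 1) * d" using d by (intro mult_right_mono) auto
    then have "cmod c * (nrm ?S x + d) \<le> cmod c * nrm ?S x + (cmod c + 1) * d" by (simp add: distrib_left)
    also have "(cmod c + 1) * d = e"
    proof -
      have "cmod c + 1 \<noteq> 0" using norm_ge_zero[of c] by linarith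
      then show ?thesis by (simp add: d_def)
    qed
    finally show "nrm ?S (c *\<^sub>C x) \<le> cmod c * nrm ?S x + e"
      using x by (simp add: complex_vector.scale_right_distrib)
  qed
  show ?thesis by (intro normed_subspaceI sub nonneg definite tri scale_le)
qed

lemma sum_space_embed0:
  assumes C: "compatible_couple X0 X1" and x: "x \<in> vecs X0"
  shows "x \<in> vecs (sum_space X0 X1)" and "nrm (sum_space X0 X1) x \<le> nrm X0 x"
proof -
  note X1 = couple_normed1[OF C]
  show "x \<in> vecs (sum_space X0 X1)" using x vecs_0[OF X1] unfolding sum_space_def by force
  show "nrm (sum_space X0 X1) x \<le> nrm X0 x"
    using nrm_sum_space_le[OF C x vecs_0[OF X1]] by (simp add: nrm_0 X1)
qed

lemma sum_space_embed1:
  assumes C: "compatible_couple X0 X1" and x: "x \<in> vecs X1"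
  shows "x \<in> vecs (sum_space X0 X1)" and "nrm (sum_space X0 X1) x \<le> nrm X1 x"
proof -
  note X0 = couple_normed0[OF C]
  show "x \<in> vecs (sum_space X0 X1)" using x vecs_0[OF X0] unfolding sum_space_def by force
  show "nrm (sum_space X0 X1) x \<le> nrm X1 x"
    using nrm_sum_space_le[OF C vecs_0[OF X0] x] by (simp add: nrm_0 X0)
qed

lemma power_series_embed:
  assumes P: "power_series Y g c r" and Y: "normed_subspace Y" and g: "\<And>l. cmod l < r \<Longrightarrow> g l \<in> vecs Y"
    and emb: "\<And>y. y \<in> vecs Y \<Longrightarrow> y \<in> vecs Z" "\<And>y. y \<in> vecs Y \<Longrightarrow> nrm Z y \<le> nrm Y y"
  shows "power_series Z g c r"
  unfolding power_series_def
proof (intro conjI allI impI)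
  have c: "c k \<in> vecs Y" for k using P by (simp add: power_series_def)
  then show "c k \<in> vecs Z" for k by (rule emb)
  fix e :: real assume e: "e > 0"
  obtain N where N: "\<forall>n\<ge>N. \<forall>l. cmod l < r \<longrightarrow> nrm Y (g l - vpoly c n l) < e"
    by (rule power_seriesE[OF P e])
  have "nrm Z (g l - vpoly c n l) < e" if n: "n \<ge> N" and l: "cmod l < r" for n l
  proof -
    have "g l - vpoly c n l \<in> vecs Y" using g[OF l] c by (intro vecs_diff vecs_sum vecs_scale Y)
    from emb(2)[OF this] show ?thesis using N n l by fastforce
  qed
  then show "\<exists>N. \<forall>n\<ge>N. \<forall>l. cmod l < r \<longrightarrow> nrm Z (g l - vpoly c n l) < e" by blast
qed

text \<open>Taylor coefficients do not depend on the spaces in which the series is summed, because both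
  expansions converge in the larger target space.\<close>

lemma taylor_embed:
  assumes f: "nholomorphic X Y f" and X: "normed_subspace X" and Y: "normed_subspace Y"
    and f': "nholomorphic X' Y' f" and X': "normed_subspace X'" and Y': "normed_subspace Y'"
    and embX: "\<And>y. y \<in> vecs X \<Longrightarrow> y \<in> vecs X'"
    and embY: "\<And>y. y \<in> vecs Y \<Longrightarrow> y \<in> vecs Y'" "\<And>y. y \<in> vecs Y \<Longrightarrow> nrm Y' y \<le> nrm Y y"
    and x: "x \<in> vecs X" and v: "v \<in> vecs X"
  shows "taylor X' Y' f x m v = taylor X Y f x m v"
proof -
  have f_in: "f (x + l *\<^sub>C v) \<in> vecs Y" for l
    using x v by (intro nholomorphic_in[OF f] vecs_add vecs_scale X)
  obtain r where r: "r > 0" "power_series Y (\<lambda>l. f (x + l *\<^sub>C v)) (\<lambda>m. taylor X Y f x m v) r"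
    using taylor_power_series[OF f X Y x v] by blast
  obtain s where s: "s > 0" "power_series Y' (\<lambda>l. f (x + l *\<^sub>C v)) (\<lambda>m. taylor X' Y' f x m v) s"
    using taylor_power_series[OF f' X' Y' embX[OF x] embX[OF v]] by blast
  show ?thesis
    using power_series_unique[OF Y' s(2) power_series_embed[OF r(2) Y f_in embY] s(1) r(1)] f_in embY(1)
    by blast
qed

section \<open>Continuous functions into the spaces of a couple\<close>

lemma continuous_on_nrm:
  fixes T :: "complex set"
  assumes X: "normed_subspace X" and g: "continuous_map (top_of_set T) (nrm_topology X) g"
  shows "continuous_on T (\<lambda>z. nrm X (g z))"
  unfolding continuous_on_iff
proof (intro ballI allI impI)
  fix z and e :: real assume z: "z \<in> T" and e: "e > 0"
  have g_in: "g y \<in> vecs X" if "y \<in> T" for y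
    using g that unfolding continuous_map_set_nrm_iff[OF X] by auto
  obtain d where d: "d > 0" "\<forall>y\<in>T. dist y z < d \<longrightarrow> nrm X (g y - g z) < e"
    using g z e unfolding continuous_map_set_nrm_iff[OF X] by blast
  have "dist (nrm X (g y)) (nrm X (g z)) \<le> nrm X (g y - g z)" if "y \<in> T" for y
    using nrm_diff_le[OF X g_in[OF that] g_in[OF z]] nrm_diff_le[OF X g_in[OF z] g_in[OF that]]
      nrm_minus_commute[OF X g_in[OF that] g_in[OF z]] by (simp add: dist_real_def)
  with d show "\<exists>d>0. \<forall>y\<in>T. dist y z < d \<longrightarrow> dist (nrm X (g y)) (nrm X (g z)) < e"
    by (intro exI[of _ d]) fastforce
qed

lemma continuous_map_nrm_combine:
  fixes T :: "complex set"
  assumes X: "normed_subspace X" and g: "continuous_map (top_of_set T) (nrm_topology X) g"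
    and h: "continuous_map (top_of_set T) (nrm_topology X) h"
  shows "continuous_map (top_of_set T) (nrm_topology X) (\<lambda>z. g z + a *\<^sub>C h z)"
  unfolding continuous_map_set_nrm_iff[OF X]
proof (intro conjI ballI allI impI)
  have gh: "g y \<in> vecs X" "h y \<in> vecs X" if "y \<in> T" for y
    using g h that unfolding continuous_map_set_nrm_iff[OF X] by auto
  then show "(\<lambda>z. g z + a *\<^sub>C h z) \<in> T \<rightarrow> vecs X" by (auto intro: vecs_add vecs_scale X)
  fix z and e :: real assume z: "z \<in> T" and "e > 0"
  then have e: "e / (cmod a + 1) > 0" by (simp add: add_nonneg_pos)
  obtain d where d: "d > 0" "\<forall>y\<in>T. dist y z < d \<longrightarrow> nrm X (g y - g z) < e / (cmod a + 1)"
    using g z e unfolding continuous_map_set_nrm_iff[OF X] by blast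
  obtain d' where d': "d' > 0" "\<forall>y\<in>T. dist y z < d' \<longrightarrow> nrm X (h y - h z) < e / (cmod a + 1)"
    using h z e unfolding continuous_map_set_nrm_iff[OF X] by blast
  have "nrm X (g y + a *\<^sub>C h y - (g z + a *\<^sub>C h z)) < e" if y: "y \<in> T" "dist y z < min d d'" for y
    using nrm_combine_less[OF X, of "g y - g z" "h y - h z" e a] gh y z d d'
    by (simp add: vecs_diff X complex_vector.scale_right_diff_distrib algebra_simps)
  then show "\<exists>d>0. \<forall>y\<in>T. dist y z < d \<longrightarrow> nrm X (g y + a *\<^sub>C h y - (g z + a *\<^sub>C h z)) < e"
    using d d' by (intro exI[of _ "min d d'"]) auto
qed

lemma continuous_map_nrm_zero:
  fixes T :: "complex set"
  assumes X: "normed_subspace X"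
  shows "continuous_map (top_of_set T) (nrm_topology X) (\<lambda>_. 0)"
  unfolding continuous_map_set_nrm_iff[OF X] by (auto simp: vecs_0 nrm_0 X intro: exI[of _ 1])


section \<open>The annulus\<close>

lemma open_annulus: "open annulus"
  unfolding annulus_def by (intro open_Collect_conj open_Collect_less continuous_intros)

lemma closure_annulus_subset: "closure annulus \<subseteq> {z. 1 \<le> cmod z \<and> cmod z \<le> exp 1}"
  by (intro closure_minimal closed_Collect_conj closed_Collect_le continuous_intros)
    (auto simp: annulus_def)

lemma closed_annulus_cases:
  assumes "1 \<le> cmod z" "cmod z \<le> exp 1"
  obtains "cmod z = 1" | "cmod z = exp 1" | "z \<in> annulus"
  using assms by (auto simp: annulus_def less_le)

lemma compact_closure_annulus: "compact (closure annulus)"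
proof -
  have "bounded annulus"
    unfolding bounded_iff by (intro exI[of _ "exp 1"]) (auto simp: annulus_def)
  then show ?thesis by simp
qed

lemma compact_circle: "compact {z. cmod z = r}"
proof -
  have "{z. cmod z = r} = sphere 0 r" by (auto simp: dist_norm)
  then show ?thesis by simp
qed

lemma ex_angle:
  assumes "cmod z = 1"
  shows "\<exists>t\<in>{0..2 * pi}. z = exp (\<i> * complex_of_real t)"
  using assms Arg2pi_ge_0[of z] Arg2pi_lt_2pi[of z] Arg2pi_eq[of z]
  by (intro bexI[of _ "Arg2pi z"]) auto

lemma ex_angle_exp1:
  assumes "cmod z = exp 1"
  shows "\<exists>t\<in>{0..2 * pi}. z = exp (1 + \<i> * complex_of_real t)"
proof -
  have e: "exp (1::complex) = of_real (exp 1)" by (simp flip: exp_of_real)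
  have "cmod (z / exp 1) = 1" using assms by (simp add: e norm_divide)
  then obtain t where t: "t \<in> {0..2 * pi}" "z / exp 1 = exp (\<i> * complex_of_real t)"
    using ex_angle by blast
  then have "z = exp (1 + \<i> * complex_of_real t)" by (simp add: exp_add field_simps)
  with t show ?thesis by blast
qed


section \<open>Calderon's function space\<close>

context
  fixes X0 X1 :: "'v::complex_tvs nspace"
  assumes C: "compatible_couple X0 X1"
begin

private abbreviation (input) "S \<equiv> sum_space X0 X1"

lemma sum_space_normed: "normed_subspace S"
  by (rule normed_subspace_sum_space[OF C])

lemma calderon_functionsD:
  assumes "\<phi> \<in> calderon_functions X0 X1"
  shows calderon_continuous: "continuous_map (top_of_set (closure annulus)) (nrm_topology S) \<phi>"
    and calderon_holomorphic: "nholomorphic_on complex_nspace annulus S \<phi>"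
    and calderon_continuous0: "continuous_map (top_of_set {z. cmod z = 1}) (nrm_topology X0) \<phi>"
    and calderon_continuous1: "continuous_map (top_of_set {z. cmod z = exp 1}) (nrm_topology X1) \<phi>"
    and calderon_in0: "cmod z = 1 \<Longrightarrow> \<phi> z \<in> vecs X0"
    and calderon_in1: "cmod z = exp 1 \<Longrightarrow> \<phi> z \<in> vecs X1"
  using assms couple_normed0[OF C] couple_normed1[OF C]
  by (auto simp: calderon_functions_def continuous_map_set_nrm_iff)

lemma calderon_in_sum:
  assumes \<phi>: "\<phi> \<in> calderon_functions X0 X1" and z: "1 \<le> cmod z" "cmod z \<le> exp 1"
  shows "\<phi> z \<in> vecs S"
  using z
proof (cases rule: closed_annulus_cases)
  case 1
  then show ?thesis by (intro sum_space_embed0(1)[OF C] calderon_in0[OF \<phi>])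
next
  case 2
  then show ?thesis by (intro sum_space_embed1(1)[OF C] calderon_in1[OF \<phi>])
next
  case 3
  then show ?thesis using calderon_holomorphic[OF \<phi>] by (auto simp: nholomorphic_on_def)
qed

lemma calderon_functions_combine:
  assumes \<phi>: "\<phi> \<in> calderon_functions X0 X1" and \<psi>: "\<psi> \<in> calderon_functions X0 X1"
  shows "(\<lambda>z. \<phi> z + a *\<^sub>C \<psi> z) \<in> calderon_functions X0 X1"
  unfolding calderon_functions_def mem_Collect_eq
  by (intro conjI continuous_map_nrm_combine nholomorphic_curve_combine sum_space_normed open_annulus
      couple_normed0[OF C] couple_normed1[OF C] calderon_functionsD[OF \<phi>] calderon_functionsD[OF \<psi>])

lemma calderon_functions_zero: "(\<lambda>_. 0) \<in> calderon_functions X0 X1"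
proof -
  have "nholomorphic_on complex_nspace annulus S (\<lambda>_. 0)"
  proof (rule nholomorphic_curveI[OF sum_space_normed open_annulus])
    have "power_series S (\<lambda>_. 0) (\<lambda>_. 0) 1"
      by (auto simp: power_series_def vecs_0 nrm_0 sum_space_normed)
    then show "\<exists>r>0. \<exists>c. power_series S (\<lambda>h. 0) c r" by (intro exI[of _ 1]) auto
  qed (auto simp: vecs_0 sum_space_normed)
  then show ?thesis
    unfolding calderon_functions_def mem_Collect_eq
    by (intro conjI continuous_map_nrm_zero sum_space_normed couple_normed0[OF C] couple_normed1[OF C])
qed

lemma calderon_functions_add:
  "\<phi> \<in> calderon_functions X0 X1 \<Longrightarrow> \<psi> \<in> calderon_functions X0 X1 \<Longrightarrow>
    (\<lambda>z. \<phi> z + \<psi> z) \<in> calderon_functions X0 X1"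
  using calderon_functions_combine[of \<phi> \<psi> 1] by simp

lemma calderon_functions_diff:
  "\<phi> \<in> calderon_functions X0 X1 \<Longrightarrow> \<psi> \<in> calderon_functions X0 X1 \<Longrightarrow>
    (\<lambda>z. \<phi> z - \<psi> z) \<in> calderon_functions X0 X1"
  using calderon_functions_combine[of \<phi> \<psi> "-1"] by simp

lemma calderon_functions_scale:
  "\<phi> \<in> calderon_functions X0 X1 \<Longrightarrow> (\<lambda>z. a *\<^sub>C \<phi> z) \<in> calderon_functions X0 X1"
  using calderon_functions_combine[OF calderon_functions_zero, of \<phi> a] by simp

lemma calderon_functions_sum:
  "(\<And>i. i \<in> I \<Longrightarrow> \<phi> i \<in> calderon_functions X0 X1) \<Longrightarrow> (\<lambda>z. \<Sum>i\<in>I. \<phi> i z) \<in> calderon_functions X0 X1"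
  by (induction I rule: infinite_finite_induct) (auto intro: calderon_functions_zero calderon_functions_add)

lemma calderon_functions_cong:
  assumes \<phi>: "\<phi> \<in> calderon_functions X0 X1"
    and eq: "\<And>z. 1 \<le> cmod z \<Longrightarrow> cmod z \<le> exp 1 \<Longrightarrow> \<psi> z = \<phi> z"
  shows "\<psi> \<in> calderon_functions X0 X1"
proof -
  have "\<phi> z = \<psi> z" if "z \<in> closure annulus" for z
    using that closure_annulus_subset eq by force
  moreover have "1 \<le> exp (1::real)" by simp
  ultimately show ?thesis
    unfolding calderon_functions_def mem_Collect_eq
    by (intro conjI continuous_map_eq[OF calderon_continuous[OF \<phi>]]
        continuous_map_eq[OF calderon_continuous0[OF \<phi>]] continuous_map_eq[OF calderon_continuous1[OF \<phi>]]
        nholomorphic_curve_cong[OF sum_space_normed open_annulus calderon_holomorphic[OF \<phi>]])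
      (auto simp: eq annulus_def)
qed

lemma calderon_norm_le:
  assumes "\<And>z. cmod z = 1 \<Longrightarrow> nrm X0 (\<phi> z) \<le> B" "\<And>z. cmod z = exp 1 \<Longrightarrow> nrm X1 (\<phi> z) \<le> B"
  shows "calderon_norm X0 X1 \<phi> \<le> B"
  unfolding calderon_norm_def using assms by (intro cSUP_least) auto

lemma nrm_le_calderon_norm:
  assumes \<phi>: "\<phi> \<in> calderon_functions X0 X1"
  shows nrm0_le_calderon_norm: "cmod z = 1 \<Longrightarrow> nrm X0 (\<phi> z) \<le> calderon_norm X0 X1 \<phi>"
    and nrm1_le_calderon_norm: "cmod z = exp 1 \<Longrightarrow> nrm X1 (\<phi> z) \<le> calderon_norm X0 X1 \<phi>"
proof -
  let ?b = "\<lambda>t. max (nrm X0 (\<phi> (exp (\<i> * complex_of_real t)))) (nrm X1 (\<phi> (exp (1 + \<i> * complex_of_real t))))"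
  have "bounded ((\<lambda>z. nrm X0 (\<phi> z)) ` {z. cmod z = 1})"
    by (intro compact_imp_bounded compact_continuous_image compact_circle
        continuous_on_nrm[OF couple_normed0[OF C] calderon_continuous0[OF \<phi>]])
  then obtain B0 where B0: "\<And>z. cmod z = 1 \<Longrightarrow> nrm X0 (\<phi> z) \<le> B0"
    unfolding bounded_iff by (auto dest: abs_le_D1)
  have "bounded ((\<lambda>z. nrm X1 (\<phi> z)) ` {z. cmod z = exp 1})"
    by (intro compact_imp_bounded compact_continuous_image compact_circle
        continuous_on_nrm[OF couple_normed1[OF C] calderon_continuous1[OF \<phi>]])
  then obtain B1 where B1: "\<And>z. cmod z = exp 1 \<Longrightarrow> nrm X1 (\<phi> z) \<le> B1"
    unfolding bounded_iff by (auto dest: abs_le_D1)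
  have bdd: "bdd_above (?b ` {0..2 * pi})"
  proof (rule bdd_aboveI2)
    fix t
    show "?b t \<le> max B0 B1"
      using B0[of "exp (\<i> * complex_of_real t)"] B1[of "exp (1 + \<i> * complex_of_real t)"] by auto
  qed
  have b: "?b t \<le> calderon_norm X0 X1 \<phi>" if "t \<in> {0..2 * pi}" for t
    unfolding calderon_norm_def by (rule cSUP_upper[OF that bdd])
  show "nrm X0 (\<phi> z) \<le> calderon_norm X0 X1 \<phi>" if "cmod z = 1"
    using ex_angle[OF that] b by fastforce
  show "nrm X1 (\<phi> z) \<le> calderon_norm X0 X1 \<phi>" if "cmod z = exp 1"
    using ex_angle_exp1[OF that] b by fastforce
qed

lemma calderon_norm_nonneg:
  assumes \<phi>: "\<phi> \<in> calderon_functions X0 X1"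
  shows "0 \<le> calderon_norm X0 X1 \<phi>"
  using nrm_nonneg[OF couple_normed0[OF C] calderon_in0[OF \<phi>, of 1]] nrm0_le_calderon_norm[OF \<phi>, of 1]
  by simp

lemma calderon_norm_add:
  assumes \<phi>: "\<phi> \<in> calderon_functions X0 X1" and \<psi>: "\<psi> \<in> calderon_functions X0 X1"
  shows "calderon_norm X0 X1 (\<lambda>z. \<phi> z + \<psi> z) \<le> calderon_norm X0 X1 \<phi> + calderon_norm X0 X1 \<psi>"
proof (rule calderon_norm_le)
  fix z assume z: "cmod z = 1"
  have "nrm X0 (\<phi> z + \<psi> z) \<le> nrm X0 (\<phi> z) + nrm X0 (\<psi> z)"
    by (intro nrm_triangle couple_normed0[OF C] calderon_in0[OF \<phi> z] calderon_in0[OF \<psi> z])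
  then show "nrm X0 (\<phi> z + \<psi> z) \<le> calderon_norm X0 X1 \<phi> + calderon_norm X0 X1 \<psi>"
    using nrm0_le_calderon_norm[OF \<phi> z] nrm0_le_calderon_norm[OF \<psi> z] by linarith
next
  fix z assume z: "cmod z = exp 1"
  have "nrm X1 (\<phi> z + \<psi> z) \<le> nrm X1 (\<phi> z) + nrm X1 (\<psi> z)"
    by (intro nrm_triangle couple_normed1[OF C] calderon_in1[OF \<phi> z] calderon_in1[OF \<psi> z])
  then show "nrm X1 (\<phi> z + \<psi> z) \<le> calderon_norm X0 X1 \<phi> + calderon_norm X0 X1 \<psi>"
    using nrm1_le_calderon_norm[OF \<phi> z] nrm1_le_calderon_norm[OF \<psi> z] by linarith
qed

lemma calderon_norm_scale_le:
  assumes \<phi>: "\<phi> \<in> calderon_functions X0 X1"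
  shows "calderon_norm X0 X1 (\<lambda>z. c *\<^sub>C \<phi> z) \<le> cmod c * calderon_norm X0 X1 \<phi>"
  using nrm_scale[OF couple_normed0[OF C] calderon_in0[OF \<phi>]] nrm_scale[OF couple_normed1[OF C] calderon_in1[OF \<phi>]]
    nrm_le_calderon_norm[OF \<phi>]
  by (intro calderon_norm_le) (auto intro: mult_left_mono)

text \<open>The maximum principle for \<open>\<parallel>\<phi>\<parallel>\<close>. A function with the expansion \<open>\<phi> (z + h) = c0 + c1 h + c2 h\<^sup>2 + O(\<bar>h\<bar>\<^sup>3)\<close>
  agrees up to third order with its average over \<open>z \<plusminus> t, z \<plusminus> \<i> t\<close>, whereas the average of
  \<open>\<bar>z\<bar>\<^sup>2\<close> exceeds its value by \<open>t\<^sup>2\<close>. Hence \<open>\<parallel>\<phi>\<parallel> + \<epsilon> \<bar>z\<bar>\<^sup>2\<close> has no interior maximum.\<close>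

lemma calderon_no_interior_maximum:
  assumes \<phi>: "nholomorphic_on complex_nspace annulus S \<phi>" and z0: "z0 \<in> annulus" and e: "e > 0"
  shows "\<exists>z\<in>annulus. nrm S (\<phi> z0) + e * (cmod z0)\<^sup>2 < nrm S (\<phi> z) + e * (cmod z)\<^sup>2"
proof (rule ccontr)
  assume "\<not> ?thesis"
  then have max: "nrm S (\<phi> z) + e * (cmod z)\<^sup>2 \<le> nrm S (\<phi> z0) + e * (cmod z0)\<^sup>2" if "z \<in> annulus" for z
    using that by (meson not_le)
  obtain r c where r: "r > 0" and P: "power_series S (\<lambda>h. \<phi> (z0 + h)) c r" and rU: "ball z0 r \<subseteq> annulus"
    using nholomorphic_curveD[OF \<phi> sum_space_normed z0] by blast
  define \<rho> where "\<rho> = r / 2"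
  have \<rho>: "\<rho> > 0" "\<rho> < r" using r by (auto simp: \<rho>_def)
  have U: "z0 + h \<in> annulus" if "cmod h \<le> \<rho>" for h
    using that rU \<rho> by (auto simp: subset_eq dist_norm)
  have \<phi>_in: "\<phi> (z0 + h) \<in> vecs S" if "cmod h \<le> \<rho>" for h
    using U[OF that] \<phi> by (auto simp: nholomorphic_on_def)
  have A: "approx_series S (\<lambda>h. \<phi> (z0 + h)) c \<rho>"
    by (rule power_series_imp_approx_series[OF P \<rho>(2) sum_space_normed])
  have c: "c k \<in> vecs S" for k using P by (simp add: power_series_def)
  obtain M where M: "\<And>h. cmod h \<le> \<rho> \<Longrightarrow> nrm S (\<phi> (z0 + h)) \<le> M"
    using poly_approx_bounded[OF sum_space_normed approx_series_imp_poly_approx[OF A] \<phi>_in] by blast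
  have M0: "M \<ge> 0"
    using M[of 0] nrm_nonneg[OF sum_space_normed \<phi>_in[of 0]] \<rho> by simp
  have c0: "c 0 = \<phi> z0"
    using power_series_at_0[OF sum_space_normed P r] \<phi>_in[of 0] \<rho> by simp
  \<comment> \<open>So small that the cubic error \<open>2 * M * (t / \<rho>) ^ 3\<close> is less than the gain \<open>e * t\<^sup>2\<close>.\<close>
  define t where "t = min (\<rho> / 2) (e * \<rho> ^ 3 / (4 * (M + 1)))"
  have t: "t > 0" "t \<le> \<rho> / 2" "t \<le> e * \<rho> ^ 3 / (4 * (M + 1))"
    unfolding t_def using \<rho> e M0 by (simp_all only: min.cobounded1 min.cobounded2) auto
  define p where "p h = c 0 + h *\<^sub>C c 1 + h\<^sup>2 *\<^sub>C c 2" for h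
  have p_in: "p h \<in> vecs S" for h
    unfolding p_def using c by (intro vecs_add vecs_scale sum_space_normed)
  have bound: "nrm S (p h) \<le> nrm S (\<phi> z0) + e * (cmod z0)\<^sup>2 - e * (cmod (z0 + h))\<^sup>2 + 2 * M * (t / \<rho>) ^ 3"
    if h: "cmod h = t" for h
  proof -
    have h': "cmod h \<le> \<rho>" using h t \<rho> by simp
    have "nrm S (\<phi> (z0 + h) - vpoly c 3 h) \<le> 2 * M * (cmod h / \<rho>) ^ 3"
      using h t by (intro approx_series_estimates(2)[OF sum_space_normed A \<rho>(1) \<phi>_in M]) auto
    also have "vpoly c 3 h = p h"
      by (simp add: p_def numeral_3_eq_3 power2_eq_square)
        (simp add: numeral_2_eq_2)
    finally have 1: "nrm S (\<phi> (z0 + h) - p h) \<le> 2 * M * (t / \<rho>) ^ 3" using h by simp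
    have "nrm S (p h) \<le> nrm S (\<phi> (z0 + h)) + nrm S (p h - \<phi> (z0 + h))"
      by (intro nrm_diff_le sum_space_normed p_in \<phi>_in h')
    also have "nrm S (p h - \<phi> (z0 + h)) = nrm S (\<phi> (z0 + h) - p h)"
      by (intro nrm_minus_commute sum_space_normed p_in \<phi>_in h')
    finally show ?thesis using 1 max[OF U[OF h']] by linarith
  qed
  define T where "T = complex_of_real t"
  have cT: "cmod T = t" "cmod (- T) = t" "cmod (\<i> * T) = t" "cmod (- (\<i> * T)) = t"
    using t by (auto simp: T_def norm_mult)
  have "4 *\<^sub>C c 0 = p T + p (- T) + p (\<i> * T) + p (- (\<i> * T))"
  proof -
    have "p T + p (- T) + p (\<i> * T) + p (- (\<i> * T)) = c 0 + c 0 + c 0 + c 0"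
      by (simp add: p_def power_mult_distrib algebra_simps)
    also have "\<dots> = (1 + 1 + 1 + 1) *\<^sub>C c 0"
      by (simp only: complex_vector.scale_left_distrib complex_vector.scale_one)
    finally show ?thesis by simp
  qed
  then have "4 * nrm S (\<phi> z0) = nrm S (p T + p (- T) + p (\<i> * T) + p (- (\<i> * T)))"
    using nrm_scale[OF sum_space_normed c[of 0], of 4] by (simp add: c0)
  also have "\<dots> \<le> nrm S (p T) + nrm S (p (- T)) + nrm S (p (\<i> * T)) + nrm S (p (- (\<i> * T)))"
    using nrm_triangle[OF sum_space_normed, of "p T" "p (- T)"] nrm_triangle[OF sum_space_normed, of "p T + p (- T)" "p (\<i> * T)"]
      nrm_triangle[OF sum_space_normed, of "p T + p (- T) + p (\<i> * T)" "p (- (\<i> * T))"] p_in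
    by (simp add: vecs_add sum_space_normed)
  also have "\<dots> \<le> 4 * (nrm S (\<phi> z0) + e * (cmod z0)\<^sup>2 + 2 * M * (t / \<rho>) ^ 3)
      - e * ((cmod (z0 + T))\<^sup>2 + (cmod (z0 + - T))\<^sup>2 + (cmod (z0 + \<i> * T))\<^sup>2 + (cmod (z0 + - (\<i> * T)))\<^sup>2)"
    using bound[OF cT(1)] bound[OF cT(2)] bound[OF cT(3)] bound[OF cT(4)]
    by (simp add: distrib_left)
  also have "(cmod (z0 + T))\<^sup>2 + (cmod (z0 + - T))\<^sup>2 + (cmod (z0 + \<i> * T))\<^sup>2 + (cmod (z0 + - (\<i> * T)))\<^sup>2
      = 4 * (cmod z0)\<^sup>2 + 4 * t\<^sup>2"
    unfolding cmod_power2 T_def by (simp add: power2_eq_square algebra_simps)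
  finally have "e * t\<^sup>2 \<le> 2 * M * (t / \<rho>) ^ 3" by (simp add: algebra_simps)
  then have "e * t\<^sup>2 * \<rho> ^ 3 \<le> 2 * M * t * t\<^sup>2"
    using \<rho> by (simp add: power_divide divide_simps power3_eq_cube power2_eq_square mult_ac)
  then have "e * \<rho> ^ 3 \<le> 2 * M * t" using t
    by (simp add: power2_eq_square mult_ac)
  also have "\<dots> \<le> 2 * (M + 1) * (e * \<rho> ^ 3 / (4 * (M + 1)))"
    using t M0 by (intro mult_mono) auto
  also have "\<dots> = e * \<rho> ^ 3 / 2"
  proof -
    have "2 * B * (e * \<rho> ^ 3 / (4 * B)) = e * \<rho> ^ 3 / 2" if "B > 0" for B using that by simp
    from this[of "M + 1"] show ?thesis using M0 by linarith
  qed
  finally show False using e \<rho> by simp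
qed

lemma calderon_maximum_principle:
  assumes \<phi>: "\<phi> \<in> calderon_functions X0 X1" and z: "1 \<le> cmod z" "cmod z \<le> exp 1"
  shows "nrm S (\<phi> z) \<le> calderon_norm X0 X1 \<phi>"
proof -
  let ?B = "calderon_norm X0 X1 \<phi>"
  have bd: "nrm S (\<phi> y) \<le> ?B" if "cmod y = 1 \<or> cmod y = exp 1" for y
    using that sum_space_embed0(2)[OF C calderon_in0[OF \<phi>, of y]] sum_space_embed1(2)[OF C calderon_in1[OF \<phi>, of y]]
      nrm0_le_calderon_norm[OF \<phi>, of y] nrm1_le_calderon_norm[OF \<phi>, of y] by fastforce
  from z show ?thesis
  proof (cases rule: closed_annulus_cases)
    case 3
    show ?thesis
    proof (rule field_le_epsilon)
      fix \<delta> :: real assume \<delta>: "\<delta> > 0"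
      \<comment> \<open>Then the perturbation \<open>e * \<bar>z\<bar>\<^sup>2\<close> is at most \<open>\<delta>\<close> on the annulus.\<close>
      define e where "e = \<delta> / (exp 1)\<^sup>2"
      have e: "e > 0" using \<delta> by (simp add: e_def)
      let ?u = "\<lambda>z. nrm S (\<phi> z) + e * (cmod z)\<^sup>2"
      have zK: "z \<in> closure annulus" using 3 closure_subset by blast
      have "continuous_on (closure annulus) ?u"
        by (intro continuous_intros continuous_on_nrm[OF sum_space_normed calderon_continuous[OF \<phi>]])
      moreover have "closure annulus \<noteq> {}" using zK by (rule ex_in_conv[THEN iffD1, OF exI])
      ultimately have "\<exists>z0\<in>closure annulus. \<forall>y\<in>closure annulus. ?u y \<le> ?u z0"
        by (intro continuous_attains_sup[OF compact_closure_annulus])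
      then obtain z0 where z0: "z0 \<in> closure annulus" "\<And>y. y \<in> closure annulus \<Longrightarrow> ?u y \<le> ?u z0"
        by blast
      have "z0 \<notin> annulus"
      proof
        assume "z0 \<in> annulus"
        then obtain y where "y \<in> annulus" "?u z0 < ?u y"
          using calderon_no_interior_maximum[OF calderon_holomorphic[OF \<phi>] _ e] by blast
        then show False using z0(2)[of y] closure_subset by fastforce
      qed
      moreover have z0': "1 \<le> cmod z0" "cmod z0 \<le> exp 1" using z0(1) closure_annulus_subset by auto
      ultimately have "nrm S (\<phi> z0) \<le> ?B"
        using bd[of z0] closed_annulus_cases[OF z0'] by blast
      moreover have "e * (cmod z0)\<^sup>2 \<le> e * (exp 1)\<^sup>2"
        using z0' e by (intro mult_left_mono power_mono) auto
      moreover have "e * (exp 1)\<^sup>2 = \<delta>" by (simp add: e_def)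
      moreover have "nrm S (\<phi> z) \<le> ?u z" using e by simp
      ultimately show "nrm S (\<phi> z) \<le> ?B + \<delta>" using z0(2)[OF zK] by linarith
    qed
  qed (use bd in auto)
qed


section \<open>The interpolation space\<close>

context
  fixes \<theta> :: real
  assumes \<theta>: "0 \<le> \<theta>" "\<theta> \<le> 1"
begin

private abbreviation (input) "p \<equiv> complex_of_real (exp \<theta>)"
private abbreviation (input) "I \<equiv> interpolation_space X0 X1 \<theta>"

lemma interpolation_point: "1 \<le> cmod p" "cmod p \<le> exp 1"
  using \<theta> by auto

lemma interpolation_space_in: "\<phi> \<in> calderon_functions X0 X1 \<Longrightarrow> \<phi> p \<in> vecs I"
  by (auto simp: interpolation_space_def)

lemma interpolation_space_E:
  assumes "x \<in> vecs I"
  obtains \<phi> where "\<phi> \<in> calderon_functions X0 X1" "\<phi> p = x"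
  using assms by (auto simp: interpolation_space_def)

lemma nrm_interpolation_space_le:
  assumes "\<phi> \<in> calderon_functions X0 X1"
  shows "nrm I (\<phi> p) \<le> calderon_norm X0 X1 \<phi>"
  unfolding interpolation_space_def nspace.simps
  using assms calderon_norm_nonneg by (intro cInf_lower bdd_belowI[of _ 0]) auto

lemma nrm_interpolation_space_less:
  assumes x: "x \<in> vecs I" and d: "nrm I x < d"
  obtains \<phi> where "\<phi> \<in> calderon_functions X0 X1" "\<phi> p = x" "calderon_norm X0 X1 \<phi> < d"
proof -
  let ?N = "{calderon_norm X0 X1 \<phi> | \<phi>. \<phi> \<in> calderon_functions X0 X1 \<and> \<phi> p = x}"
  have "?N \<noteq> {}" using x by (auto simp: interpolation_space_def)
  moreover have "Inf ?N < d" using d by (simp add: interpolation_space_def)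
  ultimately obtain y where "y \<in> ?N" "y < d" using cInf_lessD[of ?N d] by blast
  then show ?thesis using that by blast
qed

lemma interpolation_space_subset_sum:
  "x \<in> vecs I \<Longrightarrow> x \<in> vecs S"
  using calderon_in_sum[OF _ interpolation_point] by (metis interpolation_space_E)

text \<open>This makes the interpolation norm definite.\<close>

lemma nrm_sum_le_interpolation_space:
  assumes x: "x \<in> vecs I"
  shows "nrm S x \<le> nrm I x"
proof (rule field_le_epsilon)
  fix e :: real assume "e > 0"
  then have "nrm I x < nrm I x + e" by simp
  then obtain \<phi> where "\<phi> \<in> calderon_functions X0 X1" "\<phi> p = x" "calderon_norm X0 X1 \<phi> < nrm I x + e"
    by (rule nrm_interpolation_space_less[OF x])
  then show "nrm S x \<le> nrm I x + e"
    using calderon_maximum_principle[OF _ interpolation_point] by fastforce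
qed

lemma normed_subspace_interpolation_space: "normed_subspace I"
proof -
  have zero_in: "0 \<in> vecs I" using interpolation_space_in[OF calderon_functions_zero] .
  have add: "x + y \<in> vecs I" if xy: "x \<in> vecs I" "y \<in> vecs I" for x y
  proof -
    obtain \<phi> \<psi> where "\<phi> \<in> calderon_functions X0 X1" "\<phi> p = x" "\<psi> \<in> calderon_functions X0 X1" "\<psi> p = y"
      using xy by (metis interpolation_space_E)
    then show ?thesis using interpolation_space_in[OF calderon_functions_add] by blast
  qed
  have scale: "c *\<^sub>C x \<in> vecs I" if x: "x \<in> vecs I" for c x
  proof -
    obtain \<phi> where "\<phi> \<in> calderon_functions X0 X1" "\<phi> p = x" using x by (rule interpolation_space_E)
    then show ?thesis using interpolation_space_in[OF calderon_functions_scale] by blast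
  qed
  have nonneg: "0 \<le> nrm I x" if x: "x \<in> vecs I" for x
    using nrm_sum_le_interpolation_space[OF x] nrm_nonneg[OF sum_space_normed interpolation_space_subset_sum[OF x]]
    by linarith
  have definite: "x = 0" if x: "x \<in> vecs I" "nrm I x = 0" for x
  proof -
    have "nrm S x = 0"
      using nrm_sum_le_interpolation_space[OF x(1)] nrm_nonneg[OF sum_space_normed interpolation_space_subset_sum[OF x(1)]] x(2)
      by linarith
    then show ?thesis using nrm_eq_0[OF sum_space_normed interpolation_space_subset_sum[OF x(1)]] by blast
  qed
  have tri: "nrm I (x + y) \<le> nrm I x + nrm I y" if xy: "x \<in> vecs I" "y \<in> vecs I" for x y
  proof (rule field_le_epsilon)
    fix e :: real assume e: "e > 0"
    obtain \<phi> where \<phi>: "\<phi> \<in> calderon_functions X0 X1" "\<phi> p = x" "calderon_norm X0 X1 \<phi> < nrm I x + e / 2"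
      using e by (auto intro: nrm_interpolation_space_less[OF xy(1), of "nrm I x + e / 2"])
    obtain \<psi> where \<psi>: "\<psi> \<in> calderon_functions X0 X1" "\<psi> p = y" "calderon_norm X0 X1 \<psi> < nrm I y + e / 2"
      using e by (auto intro: nrm_interpolation_space_less[OF xy(2), of "nrm I y + e / 2"])
    show "nrm I (x + y) \<le> nrm I x + nrm I y + e"
      using nrm_interpolation_space_le[OF calderon_functions_add[OF \<phi>(1) \<psi>(1)]]
        calderon_norm_add[OF \<phi>(1) \<psi>(1)] \<phi> \<psi> by simp
  qed
  have scale_le: "nrm I (c *\<^sub>C x) \<le> cmod c * nrm I x" if x: "x \<in> vecs I" for c x
  proof (rule field_le_epsilon)
    fix e :: real assume e: "e > 0"
    have c: "cmod c + 1 > 0" by (simp add: add_nonneg_pos)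
    define d where "d = e / (cmod c + 1)"
    have d: "d > 0" using e c by (simp add: d_def)
    obtain \<phi> where \<phi>: "\<phi> \<in> calderon_functions X0 X1" "\<phi> p = x" "calderon_norm X0 X1 \<phi> < nrm I x + d"
      using d by (auto intro: nrm_interpolation_space_less[OF x, of "nrm I x + d"])
    have "nrm I (c *\<^sub>C x) \<le> cmod c * calderon_norm X0 X1 \<phi>"
      using nrm_interpolation_space_le[OF calderon_functions_scale[OF \<phi>(1)], of c]
        calderon_norm_scale_le[OF \<phi>(1), of c] \<phi> order_trans by blast
    also have "\<dots> \<le> cmod c * (nrm I x + d)" using \<phi> by (intro mult_left_mono) auto
    also have "\<dots> \<le> cmod c * nrm I x + (cmod c + 1) * d" using d by (simp add: distrib_left distrib_right)
    also have "(cmod c + 1) * d = e" using c by (simp add: d_def)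
    finally show "nrm I (c *\<^sub>C x) \<le> cmod c * nrm I x + e" .
  qed
  have "complex_vector.subspace (vecs I)"
    unfolding complex_vector.subspace_def using zero_in add scale by blast
  then show ?thesis by (intro normed_subspaceI nonneg definite tri scale_le)
qed

end

end

section \<open>Holomorphic maps between couples\<close>

context
  fixes X0 X1 :: "'v::complex_tvs nspace"
    and Y0 Y1 :: "'w::complex_tvs nspace"
    and f :: "'v \<Rightarrow> 'w"
  assumes CX: "compatible_couple X0 X1" and CY: "compatible_couple Y0 Y1"
    and f: "nholomorphic (sum_space X0 X1) (sum_space Y0 Y1) f"
    and f0: "nholomorphic X0 Y0 f" and f1: "nholomorphic X1 Y1 f"
begin

private abbreviation (input) "SX \<equiv> sum_space X0 X1"
private abbreviation (input) "SY \<equiv> sum_space Y0 Y1"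
private abbreviation (input) "FX \<equiv> calderon_functions X0 X1"
private abbreviation (input) "FY \<equiv> calderon_functions Y0 Y1"

lemmas SX_normed = normed_subspace_sum_space[OF CX]
lemmas SY_normed = normed_subspace_sum_space[OF CY]
lemmas X_normed = couple_normed0[OF CX] couple_normed1[OF CX]
lemmas Y_normed = couple_normed0[OF CY] couple_normed1[OF CY]

lemma taylor_sum_space0:
  "x \<in> vecs X0 \<Longrightarrow> v \<in> vecs X0 \<Longrightarrow> taylor SX SY f x m v = taylor X0 Y0 f x m v"
  by (rule taylor_embed[OF f0 X_normed(1) Y_normed(1) f SX_normed SY_normed
        sum_space_embed0(1)[OF CX] sum_space_embed0[OF CY]])

lemma taylor_sum_space1:
  "x \<in> vecs X1 \<Longrightarrow> v \<in> vecs X1 \<Longrightarrow> taylor SX SY f x m v = taylor X1 Y1 f x m v"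
  by (rule taylor_embed[OF f1 X_normed(2) Y_normed(2) f SX_normed SY_normed
        sum_space_embed1(1)[OF CX] sum_space_embed1[OF CY]])

text \<open>On the boundary circles the Taylor coefficients in the sum spaces coincide with those in the
  spaces of the couple, and hence are continuous into the latter.\<close>

lemma calderon_functions_taylor:
  assumes \<phi>: "\<phi> \<in> FX" and \<psi>: "\<psi> \<in> FX"
  shows "(\<lambda>z. taylor SX SY f (\<phi> z) m (\<psi> z)) \<in> FY"
  unfolding calderon_functions_def mem_Collect_eq
proof (intro conjI)
  note \<Phi> = calderon_functionsD[OF CX \<phi>] and \<Psi> = calderon_functionsD[OF CX \<psi>]
  show "continuous_map (top_of_set (closure annulus)) (nrm_topology SY)
      (\<lambda>z. taylor SX SY f (\<phi> z) m (\<psi> z))"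
    by (rule continuous_map_taylor[OF f SX_normed SY_normed \<Phi>(1) \<Psi>(1)])
  show "nholomorphic_on complex_nspace annulus SY (\<lambda>z. taylor SX SY f (\<phi> z) m (\<psi> z))"
    by (rule nholomorphic_curve_taylor[OF f SX_normed SY_normed open_annulus \<Phi>(2) \<Psi>(2)])
  show "continuous_map (top_of_set {z. cmod z = 1}) (nrm_topology Y0)
      (\<lambda>z. taylor SX SY f (\<phi> z) m (\<psi> z))"
    by (rule continuous_map_eq[OF continuous_map_taylor[OF f0 X_normed(1) Y_normed(1) \<Phi>(3) \<Psi>(3)]])
      (simp add: taylor_sum_space0 \<Phi> \<Psi>)
  show "continuous_map (top_of_set {z. cmod z = exp 1}) (nrm_topology Y1)
      (\<lambda>z. taylor SX SY f (\<phi> z) m (\<psi> z))"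
    by (rule continuous_map_eq[OF continuous_map_taylor[OF f1 X_normed(2) Y_normed(2) \<Phi>(4) \<Psi>(4)]])
      (simp add: taylor_sum_space1 \<Phi> \<Psi>)
qed

lemma calderon_functions_compose:
  assumes \<phi>: "\<phi> \<in> FX"
  shows "(\<lambda>z. f (\<phi> z)) \<in> FY"
proof (rule calderon_functions_cong[OF CY calderon_functions_taylor[OF \<phi> \<phi>, of 0]])
  fix z assume "1 \<le> cmod z" "cmod z \<le> exp 1"
  then have "\<phi> z \<in> vecs SX" by (rule calderon_in_sum[OF CX \<phi>])
  then show "f (\<phi> z) = taylor SX SY f (\<phi> z) 0 (\<phi> z)"
    by (simp add: taylor_0[OF f SX_normed SY_normed])
qed

text \<open>The Calderon norm sees only the two boundary circles, and there \<open>\<phi>\<close> has compact range in \<open>X0\<close>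
  and in \<open>X1\<close>, so the uniform estimates along compact sets apply.\<close>

lemma taylor_calderon_estimates:
  assumes \<phi>: "\<phi> \<in> FX"
  shows "\<exists>d>0. \<exists>M. \<forall>\<psi>\<in>FX. calderon_norm X0 X1 \<psi> < d \<longrightarrow>
    (\<forall>m. calderon_norm Y0 Y1 (\<lambda>z. taylor SX SY f (\<phi> z) m (\<psi> z)) \<le> M) \<and>
    (\<forall>n. calderon_norm Y0 Y1 (\<lambda>z. (\<Sum>k<n. taylor SX SY f (\<phi> z) k (\<psi> z)) - f (\<phi> z + \<psi> z)) \<le> 2 * M / 2 ^ n)"
proof -
  \<comment> \<open>The uniform estimates are used at \<open>l = 1/2\<close> and \<open>2 v\<close> in place of \<open>v\<close>, whence the factor \<open>1 / 2 ^ n\<close>.\<close>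
  have half: "\<exists>d>0. \<exists>M. \<forall>z\<in>T. \<forall>v\<in>vecs X. nrm X v \<le> d \<longrightarrow>
      (\<forall>m. nrm Y (taylor X Y f (\<phi> z) m v) \<le> M) \<and>
      (\<forall>n. nrm Y ((\<Sum>k<n. taylor X Y f (\<phi> z) k v) - f (\<phi> z + v)) \<le> 2 * M / 2 ^ n)"
    if f: "nholomorphic X Y f" and X: "normed_subspace X" and Y: "normed_subspace Y" and T: "compact T"
      and \<phi>: "continuous_map (top_of_set T) (nrm_topology X) \<phi>"
    for X :: "'v nspace" and Y :: "'w nspace" and T
  proof -
    obtain d M where d: "d > 0" and bd: "\<forall>z\<in>T. \<forall>v\<in>vecs X. nrm X v \<le> d \<longrightarrow>
      (\<forall>m. nrm Y (taylor X Y f (\<phi> z) m v) \<le> M) \<and>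
      (\<forall>n. \<forall>l. cmod l \<le> 1/2 \<longrightarrow>
         nrm Y (f (\<phi> z + l *\<^sub>C v) - (\<Sum>k<n. l ^ k *\<^sub>C taylor X Y f (\<phi> z) k v)) \<le> 2 * M * cmod l ^ n)"
      using taylor_uniform_on_compact[OF f X Y T \<phi>] by blast
    have "nrm Y (taylor X Y f (\<phi> z) m v) \<le> M"
      "nrm Y ((\<Sum>k<n. taylor X Y f (\<phi> z) k v) - f (\<phi> z + v)) \<le> 2 * M / 2 ^ n"
      if z: "z \<in> T" and v: "v \<in> vecs X" "nrm X v \<le> d / 2" for z v m n
    proof -
      have \<phi>z: "\<phi> z \<in> vecs X" using \<phi> z unfolding continuous_map_set_nrm_iff[OF X] by auto
      have P_in: "taylor X Y f (\<phi> z) k v \<in> vecs Y" for k by (rule taylor_in[OF f X Y \<phi>z v(1)])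
      have v2: "2 *\<^sub>C v \<in> vecs X" "nrm X (2 *\<^sub>C v) \<le> d"
        using v by (auto simp: vecs_scale nrm_scale X)
      have hom: "taylor X Y f (\<phi> z) k (2 *\<^sub>C v) = 2 ^ k *\<^sub>C taylor X Y f (\<phi> z) k v" for k
        by (rule homogeneous_polynomial_scale[OF taylor_homogeneous_polynomial[OF f X Y \<phi>z] X v(1)])
      show "nrm Y (taylor X Y f (\<phi> z) m v) \<le> M" using bd z v d by simp
      have "nrm Y (f (\<phi> z + (1/2) *\<^sub>C 2 *\<^sub>C v)
          - (\<Sum>k<n. (1/2) ^ k *\<^sub>C taylor X Y f (\<phi> z) k (2 *\<^sub>C v))) \<le> 2 * M * cmod (1/2) ^ n"
        by (rule bd[rule_format, OF z v2, THEN conjunct2, rule_format]) simp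
      then have "nrm Y (f (\<phi> z + v) - (\<Sum>k<n. taylor X Y f (\<phi> z) k v)) \<le> 2 * M / 2 ^ n"
        unfolding hom by (simp add: power_one_over field_simps flip: power_mult_distrib)
      moreover have "nrm Y ((\<Sum>k<n. taylor X Y f (\<phi> z) k v) - f (\<phi> z + v))
          = nrm Y (f (\<phi> z + v) - (\<Sum>k<n. taylor X Y f (\<phi> z) k v))"
        using P_in \<phi>z v by (intro nrm_minus_commute Y vecs_sum nholomorphic_in[OF f] vecs_add X)
      ultimately show "nrm Y ((\<Sum>k<n. taylor X Y f (\<phi> z) k v) - f (\<phi> z + v)) \<le> 2 * M / 2 ^ n" by simp
    qed
    then show ?thesis using d by (intro exI[of _ "d / 2"] conjI exI[of _ M]) auto
  qed
  note \<Phi> = calderon_functionsD[OF CX \<phi>]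
  obtain d0 M0 where d0: "d0 > 0" and E0: "\<forall>z\<in>{z. cmod z = 1}. \<forall>v\<in>vecs X0. nrm X0 v \<le> d0 \<longrightarrow>
      (\<forall>m. nrm Y0 (taylor X0 Y0 f (\<phi> z) m v) \<le> M0) \<and>
      (\<forall>n. nrm Y0 ((\<Sum>k<n. taylor X0 Y0 f (\<phi> z) k v) - f (\<phi> z + v)) \<le> 2 * M0 / 2 ^ n)"
    using half[OF f0 X_normed(1) Y_normed(1) compact_circle \<Phi>(3)] by blast
  obtain d1 M1 where d1: "d1 > 0" and E1: "\<forall>z\<in>{z. cmod z = exp 1}. \<forall>v\<in>vecs X1. nrm X1 v \<le> d1 \<longrightarrow>
      (\<forall>m. nrm Y1 (taylor X1 Y1 f (\<phi> z) m v) \<le> M1) \<and>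
      (\<forall>n. nrm Y1 ((\<Sum>k<n. taylor X1 Y1 f (\<phi> z) k v) - f (\<phi> z + v)) \<le> 2 * M1 / 2 ^ n)"
    using half[OF f1 X_normed(2) Y_normed(2) compact_circle \<Phi>(4)] by blast
  define d where "d = min d0 d1"
  define M where "M = max M0 M1"
  have le: "2 * M0 / 2 ^ n \<le> 2 * M / 2 ^ n" "2 * M1 / 2 ^ n \<le> 2 * M / 2 ^ n" for n :: nat
    by (auto simp: M_def intro!: divide_right_mono)
  have "calderon_norm Y0 Y1 (\<lambda>z. taylor SX SY f (\<phi> z) m (\<psi> z)) \<le> M"
    "calderon_norm Y0 Y1 (\<lambda>z. (\<Sum>k<n. taylor SX SY f (\<phi> z) k (\<psi> z)) - f (\<phi> z + \<psi> z)) \<le> 2 * M / 2 ^ n"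
    if \<psi>: "\<psi> \<in> FX" "calderon_norm X0 X1 \<psi> < d" for \<psi> m n
  proof -
    note \<Psi> = calderon_functionsD[OF CX \<psi>(1)]
    have b0: "nrm Y0 (taylor SX SY f (\<phi> z) m (\<psi> z)) \<le> M"
      "nrm Y0 ((\<Sum>k<n. taylor SX SY f (\<phi> z) k (\<psi> z)) - f (\<phi> z + \<psi> z)) \<le> 2 * M / 2 ^ n"
      if z: "cmod z = 1" for z
    proof -
      have "nrm X0 (\<psi> z) \<le> d0" using nrm0_le_calderon_norm[OF CX \<psi>(1) z] \<psi>(2) by (simp add: d_def)
      then have "nrm Y0 (taylor X0 Y0 f (\<phi> z) m (\<psi> z)) \<le> M0"
        "nrm Y0 ((\<Sum>k<n. taylor X0 Y0 f (\<phi> z) k (\<psi> z)) - f (\<phi> z + \<psi> z)) \<le> 2 * M0 / 2 ^ n"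
        using E0 z \<Psi>(5)[OF z] by blast+
      then show "nrm Y0 (taylor SX SY f (\<phi> z) m (\<psi> z)) \<le> M"
        "nrm Y0 ((\<Sum>k<n. taylor SX SY f (\<phi> z) k (\<psi> z)) - f (\<phi> z + \<psi> z)) \<le> 2 * M / 2 ^ n"
        using le(1)[of n] by (auto simp: taylor_sum_space0[OF \<Phi>(5)[OF z] \<Psi>(5)[OF z]] M_def)
    qed
    have b1: "nrm Y1 (taylor SX SY f (\<phi> z) m (\<psi> z)) \<le> M"
      "nrm Y1 ((\<Sum>k<n. taylor SX SY f (\<phi> z) k (\<psi> z)) - f (\<phi> z + \<psi> z)) \<le> 2 * M / 2 ^ n"
      if z: "cmod z = exp 1" for z
    proof -
      have "nrm X1 (\<psi> z) \<le> d1" using nrm1_le_calderon_norm[OF CX \<psi>(1) z] \<psi>(2) by (simp add: d_def)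
      then have "nrm Y1 (taylor X1 Y1 f (\<phi> z) m (\<psi> z)) \<le> M1"
        "nrm Y1 ((\<Sum>k<n. taylor X1 Y1 f (\<phi> z) k (\<psi> z)) - f (\<phi> z + \<psi> z)) \<le> 2 * M1 / 2 ^ n"
        using E1 z \<Psi>(6)[OF z] by blast+
      then show "nrm Y1 (taylor SX SY f (\<phi> z) m (\<psi> z)) \<le> M"
        "nrm Y1 ((\<Sum>k<n. taylor SX SY f (\<phi> z) k (\<psi> z)) - f (\<phi> z + \<psi> z)) \<le> 2 * M / 2 ^ n"
        using le(2)[of n] by (auto simp: taylor_sum_space1[OF \<Phi>(6)[OF z] \<Psi>(6)[OF z]] M_def)
    qed
    show "calderon_norm Y0 Y1 (\<lambda>z. taylor SX SY f (\<phi> z) m (\<psi> z)) \<le> M"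
      by (intro calderon_norm_le[OF CY] b0 b1)
    show "calderon_norm Y0 Y1 (\<lambda>z. (\<Sum>k<n. taylor SX SY f (\<phi> z) k (\<psi> z)) - f (\<phi> z + \<psi> z)) \<le> 2 * M / 2 ^ n"
      by (intro calderon_norm_le[OF CY] b0 b1)
  qed
  moreover have "d > 0" using d0 d1 by (simp add: d_def)
  ultimately show ?thesis by (intro exI[of _ d] conjI exI[of _ M]) auto
qed

lemma nholomorphic_interpolation_space:
  assumes \<theta>: "0 \<le> \<theta>" "\<theta> \<le> 1"
  shows "nholomorphic (interpolation_space X0 X1 \<theta>) (interpolation_space Y0 Y1 \<theta>) f"
proof -
  let ?X = "interpolation_space X0 X1 \<theta>" and ?Y = "interpolation_space Y0 Y1 \<theta>"
  define p where "p = complex_of_real (exp \<theta>)"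
  note X = normed_subspace_interpolation_space[OF CX \<theta>] and Y = normed_subspace_interpolation_space[OF CY \<theta>]
  note Y_in = interpolation_space_in[OF CY \<theta>, folded p_def]
  note Y_le = nrm_interpolation_space_le[OF CY \<theta>, folded p_def]
  note X_E = interpolation_space_E[OF CX \<theta>, folded p_def]
  note X_less = nrm_interpolation_space_less[OF CX \<theta>, folded p_def]
  have f_in: "f x \<in> vecs ?Y" if x: "x \<in> vecs ?X" for x
  proof -
    obtain \<phi> where "\<phi> \<in> FX" "\<phi> p = x" using x by (rule X_E)
    then show ?thesis using Y_in[OF calderon_functions_compose[of \<phi>]] by simp
  qed
  show ?thesis
    unfolding nholomorphic_on_def
  proof (intro conjI ballI)
    show "vecs ?X \<subseteq> vecs ?X" by simp
    show "f \<in> vecs ?X \<rightarrow> vecs ?Y" using f_in by blast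
    fix x assume x: "x \<in> vecs ?X"
    obtain \<phi> where \<phi>: "\<phi> \<in> FX" "\<phi> p = x" using x by (rule X_E)
    define P where "P m = taylor SX SY f x m" for m
    have Tp: "taylor SX SY f (\<phi> p) m h = P m h" for m h by (simp add: P_def \<phi>(2))
    obtain d M where d: "d > 0"
      and M1: "\<And>\<psi> m. \<psi> \<in> FX \<Longrightarrow> calderon_norm X0 X1 \<psi> < d \<Longrightarrow>
        calderon_norm Y0 Y1 (\<lambda>z. taylor SX SY f (\<phi> z) m (\<psi> z)) \<le> M"
      and M2: "\<And>\<psi> n. \<psi> \<in> FX \<Longrightarrow> calderon_norm X0 X1 \<psi> < d \<Longrightarrow>
        calderon_norm Y0 Y1 (\<lambda>z. (\<Sum>k<n. taylor SX SY f (\<phi> z) k (\<psi> z)) - f (\<phi> z + \<psi> z)) \<le> 2 * M / 2 ^ n"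
      using taylor_calderon_estimates[OF \<phi>(1)] by blast
    have P_in: "P m h \<in> vecs ?Y" if h: "h \<in> vecs ?X" for m h
    proof -
      obtain \<psi> where \<psi>: "\<psi> \<in> FX" "\<psi> p = h" using h by (rule X_E)
      then show ?thesis using Y_in[OF calderon_functions_taylor[OF \<phi>(1) \<psi>(1), of m]] by (simp add: Tp)
    qed
    have hom: "homogeneous_polynomial m ?X ?Y (P m)" for m
      unfolding P_def
    proof (rule homogeneous_polynomial_restrict[OF _ SX_normed X _ Y])
      show "homogeneous_polynomial m SX SY (taylor SX SY f x m)"
        by (intro taylor_homogeneous_polynomial[OF f SX_normed SY_normed]
            interpolation_space_subset_sum[OF CX \<theta>] x)
      show "vecs ?X \<subseteq> vecs SX" using interpolation_space_subset_sum[OF CX \<theta>] by blast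
      show "taylor SX SY f x m h \<in> vecs ?Y" if "h \<in> vecs ?X" for h
        using P_in[OF that] by (simp add: P_def)
    qed
    have bdd: "bounded_near_0 ?X ?Y (P m)" for m
    proof -
      have "nrm ?Y (P m h) \<le> M" if h: "h \<in> vecs ?X" "nrm ?X h < d" for h
      proof -
        obtain \<psi> where \<psi>: "\<psi> \<in> FX" "\<psi> p = h" "calderon_norm X0 X1 \<psi> < d"
          using h by (rule X_less)
        have "nrm ?Y (taylor SX SY f (\<phi> p) m (\<psi> p)) \<le> M"
          using Y_le[OF calderon_functions_taylor[OF \<phi>(1) \<psi>(1)], of m] M1[OF \<psi>(1,3), of m] by linarith
        then show ?thesis by (simp add: Tp \<psi>)
      qed
      then show ?thesis unfolding bounded_near_0_def using d by blast
    qed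
    have rate: "nrm ?Y ((\<Sum>m<n. P m (y - x)) - f y) \<le> 2 * M / 2 ^ n"
      if y: "y \<in> vecs ?X" "nrm ?X (y - x) < d" for y n
    proof -
      obtain \<psi> where \<psi>: "\<psi> \<in> FX" "\<psi> p = y - x" "calderon_norm X0 X1 \<psi> < d"
        using vecs_diff[OF X y(1) x] y(2) by (rule X_less)
      have "(\<lambda>z. (\<Sum>k<n. taylor SX SY f (\<phi> z) k (\<psi> z)) - f (\<phi> z + \<psi> z)) \<in> FY"
        by (intro calderon_functions_diff[OF CY] calderon_functions_sum[OF CY]
            calderon_functions_taylor calderon_functions_compose calderon_functions_add[OF CX] \<phi> \<psi>)
      from Y_le[OF this] M2[OF \<psi>(1,3), of n]
      have "nrm ?Y ((\<Sum>k<n. taylor SX SY f (\<phi> p) k (\<psi> p)) - f (\<phi> p + \<psi> p)) \<le> 2 * M / 2 ^ n"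
        by linarith
      then show ?thesis unfolding Tp \<psi>(2) by (simp add: \<phi>(2))
    qed
    have "(\<lambda>n. 2 * M * (1 / 2) ^ n) \<longlonglongrightarrow> 2 * M * 0"
      by (intro tendsto_intros LIMSEQ_power_zero) auto
    then have lim: "(\<lambda>n. 2 * M / 2 ^ n) \<longlonglongrightarrow> 0" by (simp add: power_one_over)
    have unif: "\<exists>N. \<forall>n\<ge>N. \<forall>y\<in>vecs ?X. nrm ?X (y - x) < d \<longrightarrow> nrm ?Y ((\<Sum>m<n. P m (y - x)) - f y) < e"
      if e: "e > 0" for e
    proof -
      obtain N where N: "\<And>n. n \<ge> N \<Longrightarrow> 2 * M / 2 ^ n < e"
        using order_tendstoD(2)[OF lim e] by (auto simp: eventually_sequentially)
      show ?thesis
        using rate N by (intro exI[of _ N]) (meson le_less_trans)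
    qed
    show "\<exists>r>0. \<exists>P.
        (\<forall>m. homogeneous_polynomial m ?X ?Y (P m) \<and>
             continuous_map (nrm_topology ?X) (nrm_topology ?Y) (P m)) \<and>
        (\<forall>y\<in>vecs ?X. nrm ?X (y - x) < r \<longrightarrow>
           y \<in> vecs ?X \<and>
           limitin (nrm_topology ?Y) (\<lambda>n. \<Sum>m<n. P m (y - x)) (f y) sequentially) \<and>
        (\<exists>s>0. s \<le> r \<and>
           (\<forall>\<epsilon>>0. \<exists>N. \<forall>n\<ge>N. \<forall>y\<in>vecs ?X. nrm ?X (y - x) < s \<longrightarrow>
              nrm ?Y ((\<Sum>m<n. P m (y - x)) - f y) < \<epsilon>))"
    proof (rule exI[of _ d], intro conjI d exI[of _ P] allI ballI impI)
      show "homogeneous_polynomial m ?X ?Y (P m)" for m by (rule hom)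
      show "continuous_map (nrm_topology ?X) (nrm_topology ?Y) (P m)" for m
        using continuous_map_homogeneous_polynomial_iff[OF hom X Y] bdd by blast
    next
      fix y assume y: "y \<in> vecs ?X" "nrm ?X (y - x) < d"
      show "y \<in> vecs ?X" by fact
      have s_in: "(\<Sum>m<n. P m (y - x)) \<in> vecs ?Y" for n
        using P_in vecs_diff[OF X y(1) x] by (intro vecs_sum Y)
      have "\<exists>N. \<forall>n\<ge>N. (\<Sum>m<n. P m (y - x)) \<in> vecs ?Y \<and> nrm ?Y ((\<Sum>m<n. P m (y - x)) - f y) < e"
        if "e > 0" for e
        using unif[OF that] s_in y by blast
      then show "limitin (nrm_topology ?Y) (\<lambda>n. \<Sum>m<n. P m (y - x)) (f y) sequentially"
        unfolding limitin_nrm_iff[OF Y] eventually_sequentially using f_in[OF y(1)] by blast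
    next
      show "\<exists>s>0. s \<le> d \<and> (\<forall>\<epsilon>>0. \<exists>N. \<forall>n\<ge>N. \<forall>y\<in>vecs ?X. nrm ?X (y - x) < s \<longrightarrow>
              nrm ?Y ((\<Sum>m<n. P m (y - x)) - f y) < \<epsilon>)"
        using unif d by blast
    qed
  qed
qed

end

theorem theorem2p3:
  fixes X0 X1 :: "'v::complex_tvs nspace"
    and Y0 Y1 :: "'w::complex_tvs nspace"
    and f :: "'v \<Rightarrow> 'w"
    and \<theta> :: real
  assumes "compatible_couple X0 X1"
    and "compatible_couple Y0 Y1"
    and "f ` vecs X0 \<subseteq> vecs Y0"
    and "f ` vecs X1 \<subseteq> vecs Y1"
    and "nholomorphic (sum_space X0 X1) (sum_space Y0 Y1) f"
    and "nholomorphic X0 Y0 f"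
    and "nholomorphic X1 Y1 f"
    and "0 \<le> \<theta>" and "\<theta> \<le> 1"
  shows "nholomorphic (interpolation_space X0 X1 \<theta>) (interpolation_space Y0 Y1 \<theta>) f"
  using assms(1,2,5-9) by (rule nholomorphic_interpolation_space)

end
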